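(* Let $(X,\mathfrak A,P)$ and $(Y,\mathfrak B,Q)$ be probability spaces such that $(Y,\mathfrak B,Q)$ admits a lifting, let $R$ be a probability measure on $\mathfrak A\otimes\mathfrak B$ with marginals $P$ and $Q$, and let $\{S_y:y\in Y\}$ be a product regular conditional probability on $\mathfrak A$ for $R$ with respect to $Q$. Assume that $\mathfrak A$ contains a countably generated $\sigma$-algebra which is dense in $\mathfrak A$ (in the Fréchet–Nikodym pseudometric) with respect to $P$. Then there exist liftings $\sigma_y\in\Lambda(\widehat S_y)$ for all $y\in Y$ and a lifting $\pi\in\Lambda(\widehat R)$ such that $$[\pi(E)]^y=\sigma_y([\pi(E)]^y)\qquad\text{for all }y\in Y\text{ and all }E\in\mathfrak A\widehat\otimes_R\mathfrak B.$$ Equivalently, for each $f\in\mathcal L^\infty(\widehat R)$ and each $y\in Y$, $[\pi(f)]^y=\sigma_y([\pi(f)]^y)$.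
   Context: For a probability space $(Z,\mathfrak Z,S)$, $(Z,\widehat{\mathfrak Z},\widehat S)$ denotes its completion and $\mathcal L^\infty(S)$ the space of bounded $\mathfrak Z$-measurable real functions (not identified a.e.). A lower density on $(Z,\mathfrak Z,S)$ is a map $\delta:\mathfrak Z\to\mathfrak Z$ such that $\delta(A)=A$ a.e. $(S)$; $A=B$ a.e. implies $\delta(A)=\delta(B)$; $\delta(\varnothing)=\varnothing$, $\delta(Z)=Z$; $\delta(A\cap B)=\delta(A)\cap\delta(B)$. A lifting is a lower density with in addition $\delta(A^c)=\delta(A)^c$. $\Lambda(S)$ is the set of all liftings on $(Z,\mathfrak Z,S)$. Each lifting $\delta$ on $\mathfrak Z$ corresponds to a unique lifting on $\mathcal L^\infty(S)$ (a positive, linear, multiplicative map, preserving constants, choosing one representative from each a.e.-equivalence class), denoted by the same letter, with $\delta(\chi_A)=\chi_{\delta(A)}$. $\mathfrak A\otimes\mathfrak B$ is the product $\sigma$-algebra; $(X\times Y,\mathfrak A\widehat\otimes_R\mathfrak B,\widehat R)$ is the completion of $(X\times Y,\mathfrak A\otimes\mathfrak B,R)$. A product regular conditional probability on $\mathfrak A$ for $R$ with respect to $Q$ is a family $\{S_y:y\in Y\}$ of probability measures on $\mathfrak A$ such that $y\mapsto S_y(A)$ is $\mathfrak B$-measurable for each $A\in\mathfrak A$, and $R(A\times B)=\int_B S_y(A)\,dQ(y)$ for all $A\in\mathfrak A$, $B\in\mathfrak B$. $(X,\widehat{\mathfrak A}_y,\widehat S_y)$ is the completion of $(X,\mathfrak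 A,S_y)$; liftings in $\Lambda(\widehat S_y)$ are defined on $\widehat{\mathfrak A}_y$. The Fréchet–Nikodym pseudometric is $d(A,A')=P(A\triangle A')$. Sections: $E^y=\{x:(x,y)\in E\}$, $f^y(x)=f(x,y)$. The displayed equalities include the assertion that the sections are $\widehat{\mathfrak A}_y$-measurable. *)

theory Defs
  imports "HOL-Probability.Probability"
begin

text \<open>\<open>\<delta>\<close> acts on the measurable sets of \<open>M\<close> itself, which need not be complete; its values outside
  \<open>sets M\<close> are irrelevant.\<close>

definition lower_density :: "'a measure \<Rightarrow> ('a set \<Rightarrow> 'a set) \<Rightarrow> bool" where
  "lower_density M \<delta> \<longleftrightarrow>
     (\<forall>A\<in>sets M. \<delta> A \<in> sets M \<and> (AE x in M. x \<in> \<delta> A \<longleftrightarrow> x \<in> A)) \<and>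
     (\<forall>A\<in>sets M. \<forall>B\<in>sets M. (AE x in M. x \<in> A \<longleftrightarrow> x \<in> B) \<longrightarrow> \<delta> A = \<delta> B) \<and>
     \<delta> {} = {} \<and> \<delta> (space M) = space M \<and>
     (\<forall>A\<in>sets M. \<forall>B\<in>sets M. \<delta> (A \<inter> B) = \<delta> A \<inter> \<delta> B)"

definition lifting :: "'a measure \<Rightarrow> ('a set \<Rightarrow> 'a set) \<Rightarrow> bool" where
  "lifting M \<delta> \<longleftrightarrow>
     lower_density M \<delta> \<and> (\<forall>A\<in>sets M. \<delta> (space M - A) = space M - \<delta> A)"

definition Liftings :: "'a measure \<Rightarrow> ('a set \<Rightarrow> 'a set) set" where
  "Liftings M = {\<delta>. lifting M \<delta>}"

text \<open>Bounded measurable functions, without a.e. identification. Functions are total on the type;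
  everything below only concerns their values on \<open>space M\<close>.\<close>

definition Linf :: "'a measure \<Rightarrow> ('a \<Rightarrow> real) set" where
  "Linf M = {f \<in> borel_measurable M. bounded (f ` space M)}"

definition function_lifting :: "'a measure \<Rightarrow> (('a \<Rightarrow> real) \<Rightarrow> 'a \<Rightarrow> real) \<Rightarrow> bool" where
  "function_lifting M L \<longleftrightarrow>
     (\<forall>f\<in>Linf M. L f \<in> Linf M \<and> (AE x in M. L f x = f x)) \<and>
     (\<forall>f\<in>Linf M. \<forall>g\<in>Linf M. (AE x in M. f x = g x) \<longrightarrow> (\<forall>x\<in>space M. L f x = L g x)) \<and>
     (\<forall>c. \<forall>x\<in>space M. L (\<lambda>_. c) x = c) \<and>
     (\<forall>f\<in>Linf M. (\<forall>x\<in>space M. 0 \<le> f x) \<longrightarrow> (\<forall>x\<in>space M. 0 \<le> L f x)) \<and>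
     (\<forall>f\<in>Linf M. \<forall>g\<in>Linf M. \<forall>a b. \<forall>x\<in>space M.
        L (\<lambda>z. a * f z + b * g z) x = a * L f x + b * L g x) \<and>
     (\<forall>f\<in>Linf M. \<forall>g\<in>Linf M. \<forall>x\<in>space M. L (\<lambda>z. f z * g z) x = L f x * L g x)"

text \<open>\<open>L\<close> is the lifting on bounded functions that corresponds to the set lifting \<open>\<delta>\<close>. For a lifting
  \<open>\<delta>\<close> such an \<open>L\<close> exists, and its values \<open>L f x\<close> for \<open>f \<in> Linf M\<close>, \<open>x \<in> space M\<close> are unique.\<close>

definition induced_function_lifting ::
    "'a measure \<Rightarrow> ('a set \<Rightarrow> 'a set) \<Rightarrow> (('a \<Rightarrow> real) \<Rightarrow> 'a \<Rightarrow> real) \<Rightarrow> bool" where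
  "induced_function_lifting M \<delta> L \<longleftrightarrow>
     function_lifting M L \<and>
     (\<forall>A\<in>sets M. \<forall>x\<in>space M. L (indicat_real A) x = indicat_real (\<delta> A) x)"

definition product_regular_conditional_probability ::
    "'a measure \<Rightarrow> 'b measure \<Rightarrow> ('a \<times> 'b) measure \<Rightarrow> ('b \<Rightarrow> 'a measure) \<Rightarrow> bool" where
  "product_regular_conditional_probability P Q R S \<longleftrightarrow>
     (\<forall>y\<in>space Q. prob_space (S y) \<and> sets (S y) = sets P) \<and>
     (\<forall>A\<in>sets P. (\<lambda>y. emeasure (S y) A) \<in> borel_measurable Q) \<and>
     (\<forall>A\<in>sets P. \<forall>B\<in>sets Q. emeasure R (A \<times> B) = (\<integral>\<^sup>+y\<in>B. emeasure (S y) A \<partial>Q))"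

definition has_dense_countably_generated_subalgebra :: "'a measure \<Rightarrow> bool" where
  "has_dense_countably_generated_subalgebra P \<longleftrightarrow>
     (\<exists>G. countable G \<and> G \<subseteq> sets P \<and>
       (\<forall>A\<in>sets P. \<forall>e>0. \<exists>C\<in>sigma_sets (space P) G. measure P ((A - C) \<union> (C - A)) < e))"

definition hsection :: "('a \<times> 'b) set \<Rightarrow> 'b \<Rightarrow> 'a set" where
  "hsection E y = {x. (x, y) \<in> E}"

end

theory Submission
  imports Defs
begin

text \<open>The measure algebra of each \<open>S y\<close> is complete, so Boolean homomorphisms into it extend from
  subalgebras (Sikorski). For almost every \<open>y\<close> there is a natural partial homomorphism from \<open>sets R\<close>
  into the measure algebra of \<open>S y\<close>: it relates \<open>E\<close> to \<open>A\<close> if both are approximated by the same sets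
  \<open>C\<close> of a countable algebra, where \<open>E\<close> is compared with \<open>C \<times> space Q\<close> along the filter which the
  lifting of \<open>Q\<close> attaches to \<open>y\<close>. It contains the pair \<open>(E, hsection E y)\<close> for almost every \<open>y\<close>. If
  \<open>H y\<close> is a total extension and \<open>\<sigma> y\<close> a lifting for \<open>completion (S y)\<close>, then
  \<open>hsection (\<pi> E) y = \<sigma> y (H y E)\<close> defines an operation whose sections are fixed by \<open>\<sigma> y\<close>. Joint
  measurability of \<open>\<pi> E\<close> is the only constraint on \<open>\<sigma> y\<close>: it suffices that \<open>\<sigma> y\<close> contains the density
  points with respect to the countable algebra, as these depend measurably on \<open>y\<close>. Such \<open>\<sigma> y\<close>
  exist by the von Neumann--Maharam extension theorem for liftings, whose limit step rests on the
  martingale convergence theorem for indicator functions.\<close>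

text \<open>The obstacle is that \<open>\<sigma> y (hsection E y)\<close> does not depend on the
  class of E alone: a null set of R has null sections only for almost every y, the exceptional y
  vary with E, and there are uncountably many E, so no single null set of y can be discarded. The
  relation along the filter at y repairs this, because it sees E only modulo null sets of R. At a
  given y it may miss many E; there the extension supplies some value, and nothing further is asked
  of it. Agreement with E is demanded for almost every y only, whereas the algebraic laws and the
  fixed sections hold at every y by construction.

  The choices at different y are unrelated, so measurability of \<open>\<pi> E\<close> has to come
  from a sandwich. The fibrewise density points of E form a set in \<open>sets R\<close> that covers
  almost all of E and lies in \<open>\<pi> E\<close> off a null set; the same holds for the
  complement. Hence \<open>\<pi> E\<close> agrees with E almost everywhere, and it is measurable for
  the completion.\<close>

section \<open>Extension of Boolean homomorphisms\<close>

text \<open>A Boolean homomorphism on a subalgebra of \<open>sets M\<close> is represented by its graph \<open>\<Gamma>\<close>, which is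
  single-valued only modulo the ideal \<open>J\<close>.\<close>

definition hom_graph :: "'a measure \<Rightarrow> 'b measure \<Rightarrow> 'b set set \<Rightarrow> ('a set \<times> 'b set) set \<Rightarrow> bool" where
  "hom_graph M N J \<Gamma> \<longleftrightarrow>
     \<Gamma> \<subseteq> sets M \<times> sets N \<and> ({}, {}) \<in> \<Gamma> \<and>
     (\<forall>A B A' B'. (A, B) \<in> \<Gamma> \<longrightarrow> (A', B') \<in> \<Gamma> \<longrightarrow> (A \<inter> A', B \<inter> B') \<in> \<Gamma>) \<and>
     (\<forall>A B. (A, B) \<in> \<Gamma> \<longrightarrow> (space M - A, space N - B) \<in> \<Gamma>) \<and>
     (\<forall>A B. (A, B) \<in> \<Gamma> \<longrightarrow> A \<in> null_sets M \<longrightarrow> B \<in> J)"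

text \<open>Two ideals matter. \<open>null_sets N\<close> gives homomorphisms into the measure
  algebra; \<open>{{}}\<close> gives homomorphisms into the sets themselves, which is how partial
  liftings and ultrafilters are encoded below.\<close>

definition set_ideal :: "'b measure \<Rightarrow> 'b set set \<Rightarrow> bool" where
  "set_ideal N J \<longleftrightarrow> (\<forall>B\<in>J. \<forall>C\<in>sets N. C \<subseteq> B \<longrightarrow> C \<in> J) \<and> (\<forall>B\<in>J. \<forall>C\<in>J. B \<union> C \<in> J)"

lemma set_ideal_null_sets: "set_ideal N (null_sets N)"
  unfolding set_ideal_def using null_sets_subset by blast

lemma set_ideal_empty: "set_ideal N {{}}"
  unfolding set_ideal_def by auto

lemma hom_graphD:
  assumes "hom_graph M N J \<Gamma>"
  shows "(A, B) \<in> \<Gamma> \<Longrightarrow> A \<in> sets M" "(A, B) \<in> \<Gamma> \<Longrightarrow> B \<in> sets N"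
    "({}, {}) \<in> \<Gamma>"
    "(A, B) \<in> \<Gamma> \<Longrightarrow> (A', B') \<in> \<Gamma> \<Longrightarrow> (A \<inter> A', B \<inter> B') \<in> \<Gamma>"
    "(A, B) \<in> \<Gamma> \<Longrightarrow> (space M - A, space N - B) \<in> \<Gamma>"
    "(A, B) \<in> \<Gamma> \<Longrightarrow> A \<in> null_sets M \<Longrightarrow> B \<in> J"
  using assms unfolding hom_graph_def by blast+

lemma hom_graph_space: "hom_graph M N J \<Gamma> \<Longrightarrow> (space M, space N) \<in> \<Gamma>"
  using hom_graphD(5)[OF _ hom_graphD(3), of M N J \<Gamma>] by simp

lemma hom_graph_Diff:
  assumes "hom_graph M N J \<Gamma>" "(A, B) \<in> \<Gamma>" "(A', B') \<in> \<Gamma>"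
  shows "(A - A', B - B') \<in> \<Gamma>"
proof -
  have "(A \<inter> (space M - A'), B \<inter> (space N - B')) \<in> \<Gamma>"
    using assms hom_graphD(4,5) by metis
  moreover have "A \<inter> (space M - A') = A - A'" "B \<inter> (space N - B') = B - B'"
    using hom_graphD(1,2)[OF assms(1,2)] sets.sets_into_space by blast+
  ultimately show ?thesis by simp
qed

lemma hom_graph_Un:
  assumes "hom_graph M N J \<Gamma>" "(A, B) \<in> \<Gamma>" "(A', B') \<in> \<Gamma>"
  shows "(A \<union> A', B \<union> B') \<in> \<Gamma>"
proof -
  have "(space M - (space M - A - A'), space N - (space N - B - B')) \<in> \<Gamma>"
    using assms hom_graphD(5) hom_graph_Diff by metis
  moreover have "space M - (space M - A - A') = A \<union> A'"
    using hom_graphD(1)[OF assms(1,2)] hom_graphD(1)[OF assms(1,3)] sets.sets_into_space by blast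
  moreover have "space N - (space N - B - B') = B \<union> B'"
    using hom_graphD(2)[OF assms(1,2)] hom_graphD(2)[OF assms(1,3)] sets.sets_into_space by blast
  ultimately show ?thesis by simp
qed

text \<open>Each defining condition involves at most two members of the graph, and in a chain any
  two lie in a common member.\<close>

lemma hom_graph_Union_chain:
  assumes "\<And>\<Gamma>. \<Gamma> \<in> C \<Longrightarrow> hom_graph M N J \<Gamma>" "C \<noteq> {}"
    and "\<And>\<Gamma> \<Gamma>'. \<Gamma> \<in> C \<Longrightarrow> \<Gamma>' \<in> C \<Longrightarrow> \<Gamma> \<subseteq> \<Gamma>' \<or> \<Gamma>' \<subseteq> \<Gamma>"
  shows "hom_graph M N J (\<Union>C)"
proof -
  have pair: "\<exists>\<Gamma>\<in>C. p \<in> \<Gamma> \<and> q \<in> \<Gamma>" if "p \<in> \<Union>C" "q \<in> \<Union>C" for p q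
    using that assms(3) by (meson UnionE subsetD)
  show ?thesis
    unfolding hom_graph_def
  proof (intro conjI allI impI)
    show "\<Union>C \<subseteq> sets M \<times> sets N" using assms(1) unfolding hom_graph_def by blast
    show "({}, {}) \<in> \<Union>C" using assms(2) hom_graphD(3)[OF assms(1)] by blast
    show "(A \<inter> A', B \<inter> B') \<in> \<Union>C" if ab: "(A, B) \<in> \<Union>C" "(A', B') \<in> \<Union>C" for A B A' B'
    proof -
      obtain \<Gamma> where "\<Gamma> \<in> C" "(A, B) \<in> \<Gamma>" "(A', B') \<in> \<Gamma>" using pair[OF ab] by blast
      then show ?thesis using hom_graphD(4)[OF assms(1)] by (intro UnionI[of \<Gamma>])
    qed
    show "(space M - A, space N - B) \<in> \<Union>C" if "(A, B) \<in> \<Union>C" for A B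
      using that hom_graphD(5)[OF assms(1)] by blast
    show "B \<in> J" if "(A, B) \<in> \<Union>C" "A \<in> null_sets M" for A B
      using that hom_graphD(6)[OF assms(1)] by blast
  qed
qed

text \<open>The algebra generated by a subalgebra and one further set E consists of the sets
  \<open>(F \<inter> E) \<union> (F' - E)\<close>; sending E to a leaves no freedom for their
  images.\<close>

definition graph_step ::
    "'a set \<Rightarrow> 'b set \<Rightarrow> ('a set \<times> 'b set) set \<Rightarrow> ('a set \<times> 'b set) set" where
  "graph_step E a \<Gamma> =
     {((F \<inter> E) \<union> (F' - E), (A \<inter> a) \<union> (A' - a)) | F A F' A'. (F, A) \<in> \<Gamma> \<and> (F', A') \<in> \<Gamma>}"

lemma graph_stepI:
  "(F, A) \<in> \<Gamma> \<Longrightarrow> (F', A') \<in> \<Gamma> \<Longrightarrow> ((F \<inter> E) \<union> (F' - E), (A \<inter> a) \<union> (A' - a)) \<in> graph_step E a \<Gamma>"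
  unfolding graph_step_def by blast

text \<open>A combination \<open>(F \<inter> E) \<union> (F' - E)\<close> is null exactly when both
  pieces are, so two one-sided conditions suffice. Modulo J, \<open>above\<close> makes a contain
  the images of sets essentially inside E, and \<open>below\<close> keeps a disjoint from the images
  of sets essentially outside E.\<close>

lemma hom_graph_step:
  assumes \<Gamma>: "hom_graph M N J \<Gamma>" and J: "set_ideal N J"
    and E: "E \<in> sets M" and a: "a \<in> sets N"
    and below: "\<And>F A. (F, A) \<in> \<Gamma> \<Longrightarrow> F \<inter> E \<in> null_sets M \<Longrightarrow> A \<inter> a \<in> J"
    and above: "\<And>F A. (F, A) \<in> \<Gamma> \<Longrightarrow> F - E \<in> null_sets M \<Longrightarrow> A - a \<in> J"
  shows "hom_graph M N J (graph_step E a \<Gamma>)" "\<Gamma> \<subseteq> graph_step E a \<Gamma>"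
    "(E, a) \<in> graph_step E a \<Gamma>"
proof -
  show sub: "\<Gamma> \<subseteq> graph_step E a \<Gamma>"
  proof
    fix p assume "p \<in> \<Gamma>"
    then show "p \<in> graph_step E a \<Gamma>"
      using graph_stepI[of "fst p" "snd p" \<Gamma> "fst p" "snd p" E a] by (simp add: Int_Diff_Un)
  qed
  show "(E, a) \<in> graph_step E a \<Gamma>"
  proof -
    have "space M \<inter> E = E" "space N \<inter> a = a" using E a sets.Int_space_eq1 by blast+
    then show ?thesis
      using graph_stepI[OF hom_graph_space[OF \<Gamma>] hom_graphD(3)[OF \<Gamma>], of E a] by simp
  qed
  show "hom_graph M N J (graph_step E a \<Gamma>)"
    unfolding hom_graph_def
  proof (intro conjI allI impI)
    show "graph_step E a \<Gamma> \<subseteq> sets M \<times> sets N"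
      using hom_graphD(1,2)[OF \<Gamma>] E a unfolding graph_step_def by auto
    show "({}, {}) \<in> graph_step E a \<Gamma>" using sub hom_graphD(3)[OF \<Gamma>] by blast
    fix G B assume GB: "(G, B) \<in> graph_step E a \<Gamma>"
    then obtain F A F' A' where 1: "(F, A) \<in> \<Gamma>" "(F', A') \<in> \<Gamma>"
      "G = (F \<inter> E) \<union> (F' - E)" "B = (A \<inter> a) \<union> (A' - a)"
      unfolding graph_step_def by blast
    show "(G \<inter> G', B \<inter> B') \<in> graph_step E a \<Gamma>" if GB': "(G', B') \<in> graph_step E a \<Gamma>" for G' B'
    proof -
      obtain K C K' C' where 2: "(K, C) \<in> \<Gamma>" "(K', C') \<in> \<Gamma>"
        "G' = (K \<inter> E) \<union> (K' - E)" "B' = (C \<inter> a) \<union> (C' - a)"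
        using GB' unfolding graph_step_def by blast
      have "G \<inter> G' = (F \<inter> K \<inter> E) \<union> (F' \<inter> K' - E)" "B \<inter> B' = (A \<inter> C \<inter> a) \<union> (A' \<inter> C' - a)"
        unfolding 1 2 by blast+
      then show ?thesis using graph_stepI hom_graphD(4)[OF \<Gamma>] 1(1,2) 2(1,2) by metis
    qed
    show "(space M - G, space N - B) \<in> graph_step E a \<Gamma>"
    proof -
      have "space M - G = ((space M - F) \<inter> E) \<union> ((space M - F') - E)"
        "space N - B = ((space N - A) \<inter> a) \<union> ((space N - A') - a)"
        unfolding 1 by blast+
      then show ?thesis using graph_stepI hom_graphD(5)[OF \<Gamma>] 1(1,2) by metis
    qed
    assume null: "G \<in> null_sets M"
    have "F \<inter> E \<in> null_sets M" "F' - E \<in> null_sets M"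
      using null_sets_subset[OF null] hom_graphD(1)[OF \<Gamma>] 1 E by auto
    then have "A \<inter> a \<in> J" "A' - a \<in> J" using below above 1 by auto
    then show "B \<in> J" using J 1(4) unfolding set_ideal_def by blast
  qed
qed

text \<open>The measures of the \<open>A n\<close> approach the supremum s. Closure under unions
  gives \<open>measure M (B \<union> A n) \<le> s\<close>, so B exceeds \<open>A n\<close> by at
  most \<open>1 / Suc n\<close>. The union is the supremum of the family in the measure algebra:
  this is the completeness behind both one-set extensions below.\<close>

lemma (in finite_measure) countable_essential_union:
  assumes "\<C> \<subseteq> sets M" "\<C> \<noteq> {}" and Un: "\<And>A B. A \<in> \<C> \<Longrightarrow> B \<in> \<C> \<Longrightarrow> A \<union> B \<in> \<C>"
  obtains A :: "nat \<Rightarrow> 'a set" where "range A \<subseteq> \<C>" "\<And>B. B \<in> \<C> \<Longrightarrow> B - (\<Union>i. A i) \<in> null_sets M"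
proof -
  define s where "s = Sup (measure M ` \<C>)"
  have bdd: "bdd_above (measure M ` \<C>)"
    by (rule bdd_aboveI[of _ "measure M (space M)"]) (auto intro: bounded_measure)
  have "\<exists>A\<in>\<C>. s - 1 / Suc n < measure M A" for n
  proof -
    have "s - 1 / Suc n < s" by simp
    then show ?thesis using assms(2) less_cSup_iff[OF _ bdd] unfolding s_def by auto
  qed
  then obtain A where A: "\<And>n. A n \<in> \<C>" "\<And>n. s - 1 / Suc n < measure M (A n)" by metis
  have "B - (\<Union>i. A i) \<in> null_sets M" if B: "B \<in> \<C>" for B
  proof -
    have meas: "B \<in> sets M" "\<And>n. A n \<in> sets M" using B A(1) assms(1) by auto
    have "measure M (B - (\<Union>i. A i)) \<le> 1 / Suc n" for n
    proof -
      have "measure M (B - (\<Union>i. A i)) \<le> measure M (B - A n)"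
        using meas by (intro finite_measure_mono) auto
      also have "\<dots> = measure M (B \<union> A n) - measure M (A n)"
        using finite_measure_Union[of "A n" "B - A n"] meas
        by (simp add: Un_commute Un_Diff_cancel)
      also have "measure M (B \<union> A n) \<le> s"
        unfolding s_def using bdd Un[OF B A(1)] by (intro cSup_upper) auto
      finally show ?thesis using A(2)[of n] by linarith
    qed
    then have "measure M (B - (\<Union>i. A i)) \<le> 0"
      by (metis inverse_eq_divide lim_const LIMSEQ_inverse_real_of_nat LIMSEQ_le_const)
    then have "measure M (B - (\<Union>i. A i)) = 0" using measure_nonneg by (simp add: order_antisym)
    moreover have "B - (\<Union>i. A i) \<in> sets M" using meas by auto
    ultimately show ?thesis by (simp add: null_setsI emeasure_eq_measure)
  qed
  then show ?thesis using that A(1) by blast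
qed

text \<open>A form of Sikorski's extension theorem: the measure algebra of \<open>N\<close> is complete, hence injective.\<close>

theorem hom_graph_extend:
  assumes N: "finite_measure N" and \<Gamma>0: "hom_graph M N (null_sets N) \<Gamma>0"
  obtains \<Gamma> where "hom_graph M N (null_sets N) \<Gamma>" "\<Gamma>0 \<subseteq> \<Gamma>" "\<And>E. E \<in> sets M \<Longrightarrow> \<exists>A. (E, A) \<in> \<Gamma>"
proof -
  interpret finite_measure N by fact
  let ?S = "{\<Gamma>. hom_graph M N (null_sets N) \<Gamma> \<and> \<Gamma>0 \<subseteq> \<Gamma>}"
  have "\<exists>U\<in>?S. \<forall>X\<in>C. X \<subseteq> U" if C: "subset.chain ?S C" for C
  proof (cases "C = {}")
    case False
    have "hom_graph M N (null_sets N) (\<Union>C)"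
      using C False by (intro hom_graph_Union_chain) (auto simp: subset_chain_def)
    moreover have "\<Gamma>0 \<subseteq> \<Union>C" using C False unfolding subset_chain_def by blast
    ultimately show ?thesis by blast
  qed (use \<Gamma>0 in auto)
  then obtain \<Gamma> where \<Gamma>: "hom_graph M N (null_sets N) \<Gamma>" "\<Gamma>0 \<subseteq> \<Gamma>"
    and max: "\<And>\<Gamma>'. hom_graph M N (null_sets N) \<Gamma>' \<Longrightarrow> \<Gamma> \<subseteq> \<Gamma>' \<Longrightarrow> \<Gamma>' = \<Gamma>"
    using subset_Zorn[of ?S] by auto
  have "\<exists>A. (E, A) \<in> \<Gamma>" if E: "E \<in> sets M" for E
  proof -
    \<comment> \<open>The members of \<open>\<C>\<close> are the values that any admissible image of
      E must contain; their essential union a is the least admissible image.\<close>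
    define \<C> where "\<C> = {A. \<exists>F. (F, A) \<in> \<Gamma> \<and> F - E \<in> null_sets M}"
    have "\<C> \<subseteq> sets N" using hom_graphD(2)[OF \<Gamma>(1)] unfolding \<C>_def by blast
    moreover have "{} \<in> \<C>" using hom_graphD(3)[OF \<Gamma>(1)] unfolding \<C>_def by auto
    moreover have "A \<union> B \<in> \<C>" if AB: "A \<in> \<C>" "B \<in> \<C>" for A B
    proof -
      obtain F G where FG: "(F, A) \<in> \<Gamma>" "F - E \<in> null_sets M" "(G, B) \<in> \<Gamma>" "G - E \<in> null_sets M"
        using AB unfolding \<C>_def by blast
      then have "F \<union> G - E \<in> null_sets M" by (simp add: Un_Diff null_sets.Un)
      then show ?thesis using hom_graph_Un[OF \<Gamma>(1) FG(1,3)] unfolding \<C>_def by blast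
    qed
    ultimately obtain A :: "nat \<Rightarrow> _" where A: "range A \<subseteq> \<C>" "\<And>B. B \<in> \<C> \<Longrightarrow> B - (\<Union>i. A i) \<in> null_sets N"
      using countable_essential_union[of \<C>] by (metis empty_iff)
    define a where "a = (\<Union>i. A i)"
    have "a \<in> sets N" using A(1) \<open>\<C> \<subseteq> sets N\<close> unfolding a_def by auto
    moreover have "B \<inter> a \<in> null_sets N" if B: "(F, B) \<in> \<Gamma>" "F \<inter> E \<in> null_sets M" for F B
    proof -
      have "B \<inter> A i \<in> null_sets N" for i
      proof -
        obtain F' where F': "(F', A i) \<in> \<Gamma>" "F' - E \<in> null_sets M" using A(1) unfolding \<C>_def by blast
        \<comment> \<open>\<open>F \<inter> F'\<close> lies in
          \<open>(F \<inter> E) \<union> (F' - E)\<close>, so the graph itself forces B and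
          \<open>A i\<close> to be disjoint modulo null sets.\<close>
        have "F \<inter> F' \<in> null_sets M"
          using hom_graphD(1)[OF \<Gamma>(1)] B(1) F'(1)
          by (intro null_sets_subset[OF null_sets.Un[OF B(2) F'(2)]]) auto
        then show ?thesis using hom_graphD(6)[OF \<Gamma>(1)] hom_graphD(4)[OF \<Gamma>(1)] B(1) F'(1) by blast
      qed
      then have "(\<Union>i. B \<inter> A i) \<in> null_sets N" by blast
      moreover have "(\<Union>i. B \<inter> A i) = B \<inter> a" unfolding a_def by blast
      ultimately show ?thesis by simp
    qed
    moreover have "B - a \<in> null_sets N" if "(F, B) \<in> \<Gamma>" "F - E \<in> null_sets M" for F B
      using that A(2) unfolding \<C>_def a_def by blast
    ultimately have "graph_step E a \<Gamma> = \<Gamma>" "(E, a) \<in> graph_step E a \<Gamma>"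
      using hom_graph_step[OF \<Gamma>(1) set_ideal_null_sets E, of a] max by auto
    then show ?thesis by auto
  qed
  with that \<Gamma> show ?thesis by blast
qed

section \<open>Partial liftings\<close>

text \<open>The closure of \<open>\<C>\<close> in the Frechet-Nikodym pseudometric.\<close>

definition approx_by :: "'a measure \<Rightarrow> 'a set set \<Rightarrow> 'a set set" where
  "approx_by M \<C> = {E \<in> sets M. \<forall>e>0. \<exists>C\<in>\<C>. measure M (sym_diff E C) < e}"

lemma approx_by_superset:
  assumes "\<C> \<subseteq> sets M" shows "\<C> \<subseteq> approx_by M \<C>"
  unfolding approx_by_def using assms by force

lemma approx_byE:
  assumes "E \<in> approx_by M \<C>" "e > 0"
  obtains C where "C \<in> \<C>" "measure M (sym_diff E C) < e"
  using assms unfolding approx_by_def by blast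

text \<open>Complement and union are continuous for the pseudometric, and a countable union is the
  limit of its finite partial unions. For an algebra \<open>\<C>\<close> the closure therefore
  contains the generated sigma-algebra.\<close>

lemma (in finite_measure) sigma_algebra_approx_by:
  assumes sub: "\<C> \<subseteq> sets M" and empty: "{} \<in> \<C>"
    and compl: "\<And>C. C \<in> \<C> \<Longrightarrow> space M - C \<in> \<C>"
    and Un: "\<And>C D. C \<in> \<C> \<Longrightarrow> D \<in> \<C> \<Longrightarrow> C \<union> D \<in> \<C>"
  shows "sigma_algebra (space M) (approx_by M \<C>)"
proof -
  let ?A = "approx_by M \<C>"
  have Un': "E \<union> F \<in> ?A" if E: "E \<in> ?A" and F: "F \<in> ?A" for E F
  proof -
    have [measurable]: "E \<in> sets M" "F \<in> sets M" using E F unfolding approx_by_def by auto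
    have "\<exists>C\<in>\<C>. measure M (sym_diff (E \<union> F) C) < e" if "e > 0" for e
    proof -
      have "e / 2 > 0" using that by simp
      then obtain C D where CD: "C \<in> \<C>" "measure M (sym_diff E C) < e / 2"
          "D \<in> \<C>" "measure M (sym_diff F D) < e / 2"
        using approx_byE[OF E] approx_byE[OF F] by metis
      have [measurable]: "C \<in> sets M" "D \<in> sets M" using CD sub by auto
      have "measure M (sym_diff (E \<union> F) (C \<union> D)) \<le> measure M (sym_diff E C \<union> sym_diff F D)"
        by (intro finite_measure_mono) auto
      also have "\<dots> \<le> measure M (sym_diff E C) + measure M (sym_diff F D)"
        by (intro measure_Un_le) auto
      finally show ?thesis using CD Un by (intro bexI[of _ "C \<union> D"]) auto
    qed
    then show ?thesis unfolding approx_by_def by auto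
  qed
  have empty': "{} \<in> ?A" using approx_by_superset[OF sub] empty by auto
  show ?thesis
  proof (rule sigma_algebra.intro)
    show "algebra (space M) ?A"
      unfolding algebra_iff_Un
    proof (intro conjI ballI empty' Un')
      show "?A \<subseteq> Pow (space M)" unfolding approx_by_def using sets.sets_into_space by blast
      fix E assume E: "E \<in> ?A"
      have [measurable]: "E \<in> sets M" using E unfolding approx_by_def by auto
      have "\<exists>C\<in>\<C>. measure M (sym_diff (space M - E) C) < e" if "e > 0" for e
      proof -
        obtain C where C: "C \<in> \<C>" "measure M (sym_diff E C) < e"
          using E \<open>e > 0\<close> unfolding approx_by_def by blast
        have "sym_diff (space M - E) (space M - C) = sym_diff E C"
          using C(1) sub \<open>E \<in> sets M\<close> sets.sets_into_space by blast
        then show ?thesis using C compl by metis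
      qed
      then show "space M - E \<in> ?A" unfolding approx_by_def by auto
    qed
    show "sigma_algebra_axioms ?A"
    proof
      fix E :: "nat \<Rightarrow> 'a set" assume E: "range E \<subseteq> ?A"
      then have meas [measurable]: "\<And>i. E i \<in> sets M" unfolding approx_by_def by auto
      have "\<exists>C\<in>\<C>. measure M (sym_diff (\<Union>i. E i) C) < e" if "e > 0" for e
      proof -
        have "(\<lambda>n. measure M (\<Union>i<n. E i)) \<longlonglongrightarrow> measure M (\<Union>n. \<Union>i<n. E i)"
          by (intro finite_Lim_measure_incseq) (auto simp: incseq_def intro: less_le_trans)
        also have "(\<Union>n. \<Union>i<n. E i) = (\<Union>i. E i)" by auto
        finally have "\<forall>\<^sub>F n in sequentially. measure M (\<Union>i. E i) - e / 2 < measure M (\<Union>i<n. E i)"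
          using \<open>e > 0\<close> by (intro order_tendstoD(1)) auto
        then obtain n where n: "measure M (\<Union>i. E i) - e / 2 < measure M (\<Union>i<n. E i)"
          unfolding eventually_sequentially by blast
        have "(\<Union>i<n. E i) \<in> ?A"
        proof (induction n)
          case (Suc n)
          have "(\<Union>i<Suc n. E i) = E n \<union> (\<Union>i<n. E i)" by (auto simp: less_Suc_eq)
          then show ?case using Un'[OF range_subsetD[OF E] Suc] by simp
        qed (use empty' in auto)
        moreover have "e / 2 > 0" using that by simp
        ultimately obtain C where C: "C \<in> \<C>" "measure M (sym_diff (\<Union>i<n. E i) C) < e / 2"
          using approx_byE by blast
        have [measurable]: "C \<in> sets M" using C sub by auto
        have "measure M (sym_diff (\<Union>i. E i) C) \<le>
            measure M (sym_diff (\<Union>i<n. E i) C \<union> ((\<Union>i. E i) - (\<Union>i<n. E i)))"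
          by (intro finite_measure_mono) auto
        also have "\<dots> \<le> measure M (sym_diff (\<Union>i<n. E i) C) + measure M ((\<Union>i. E i) - (\<Union>i<n. E i))"
          by (intro measure_Un_le) auto
        also have "measure M ((\<Union>i. E i) - (\<Union>i<n. E i)) = measure M (\<Union>i. E i) - measure M (\<Union>i<n. E i)"
          by (intro finite_measure_Diff) auto
        finally show ?thesis using C n by (intro bexI[of _ C]) auto
      qed
      then show "\<Union> (range E) \<in> ?A" unfolding approx_by_def by auto
    qed
  qed
qed

text \<open>A lifting on the sub-sigma-algebra \<open>Domain \<Gamma>\<close>. The ideal
  \<open>{{}}\<close> makes null sets lift to the empty set, whence \<open>\<Gamma>\<close> is
  single-valued and constant on classes; having all null sets in the domain makes the domain closed
  under almost sure equality.\<close>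

definition plift :: "'a measure \<Rightarrow> ('a set \<times> 'a set) set \<Rightarrow> bool" where
  "plift M \<Gamma> \<longleftrightarrow>
     hom_graph M M {{}} \<Gamma> \<and> (\<forall>N\<in>null_sets M. (N, {}) \<in> \<Gamma>) \<and>
     (\<forall>A B. (A, B) \<in> \<Gamma> \<longrightarrow> (AE x in M. x \<in> A \<longleftrightarrow> x \<in> B)) \<and>
     (\<forall>A :: nat \<Rightarrow> 'a set. range A \<subseteq> Domain \<Gamma> \<longrightarrow> (\<Union>i. A i) \<in> Domain \<Gamma>)"

lemma pliftD:
  assumes "plift M \<Gamma>"
  shows "hom_graph M M {{}} \<Gamma>" "N \<in> null_sets M \<Longrightarrow> (N, {}) \<in> \<Gamma>"
    "(A, B) \<in> \<Gamma> \<Longrightarrow> AE x in M. x \<in> A \<longleftrightarrow> x \<in> B"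
    "range (F :: nat \<Rightarrow> 'a set) \<subseteq> Domain \<Gamma> \<Longrightarrow> (\<Union>i. F i) \<in> Domain \<Gamma>"
  using assms unfolding plift_def by blast+

lemma sigma_algebra_Domain_plift:
  assumes "plift M \<Gamma>" shows "sigma_algebra (space M) (Domain \<Gamma>)"
proof (rule sigma_algebra.intro)
  note \<Gamma> = pliftD(1)[OF assms]
  show "algebra (space M) (Domain \<Gamma>)"
    unfolding algebra_iff_Un
  proof (intro conjI ballI)
    show "Domain \<Gamma> \<subseteq> Pow (space M)" using hom_graphD(1)[OF \<Gamma>] sets.sets_into_space by blast
    show "{} \<in> Domain \<Gamma>" using hom_graphD(3)[OF \<Gamma>] by blast
    show "space M - A \<in> Domain \<Gamma>" if "A \<in> Domain \<Gamma>" for A using that hom_graphD(5)[OF \<Gamma>] by blast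
    show "A \<union> B \<in> Domain \<Gamma>" if AB: "A \<in> Domain \<Gamma>" "B \<in> Domain \<Gamma>" for A B
    proof -
      obtain A' B' where "(A, A') \<in> \<Gamma>" "(B, B') \<in> \<Gamma>" using AB by blast
      then show ?thesis using hom_graph_Un[OF \<Gamma>] by blast
    qed
  qed
  show "sigma_algebra_axioms (Domain \<Gamma>)" using pliftD(4)[OF assms] by unfold_locales
qed

lemma Domain_plift_subset: "plift M \<Gamma> \<Longrightarrow> Domain \<Gamma> \<subseteq> sets M"
  using hom_graphD(1)[OF pliftD(1)] by blast

lemma plift_null_diff:
  assumes "plift M \<Gamma>" "(A, B) \<in> \<Gamma>" "(A', B') \<in> \<Gamma>" "A - A' \<in> null_sets M"
  shows "B \<subseteq> B'"
  using hom_graphD(6)[OF pliftD(1)[OF assms(1)] hom_graph_Diff[OF pliftD(1)[OF assms(1)] assms(2,3)] assms(4)]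
  by auto

text \<open>f is the largest domain set essentially inside E, and g the largest essentially outside;
  they exist because the domain is closed under countable unions. Every lift that the image of E
  must contain lies in \<open>\<phi>\<close>, and every lift that it must avoid lies in
  \<open>\<gamma>\<close>.\<close>

lemma plift_step:
  assumes "finite_measure M" and \<Gamma>: "plift M \<Gamma>" and E: "E \<in> sets M"
  obtains \<Gamma>' where "plift M \<Gamma>'" "\<Gamma> \<subseteq> \<Gamma>'" "E \<in> Domain \<Gamma>'"
proof -
  interpret finite_measure M by fact
  note hom = pliftD(1)[OF \<Gamma>]
  have hull: "\<exists>f \<phi>. (f, \<phi>) \<in> \<Gamma> \<and> f - E \<in> null_sets M \<and> (\<forall>F A. (F, A) \<in> \<Gamma> \<longrightarrow> F - E \<in> null_sets M \<longrightarrow> A \<subseteq> \<phi>)"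
    if E: "E \<in> sets M" for E
  proof -
    define \<C> where "\<C> = {F \<in> Domain \<Gamma>. F - E \<in> null_sets M}"
    have "\<C> \<subseteq> sets M" using Domain_plift_subset[OF \<Gamma>] unfolding \<C>_def by blast
    moreover have "{} \<in> \<C>" using hom_graphD(3)[OF hom] unfolding \<C>_def by auto
    moreover have "A \<union> B \<in> \<C>" if "A \<in> \<C>" "B \<in> \<C>" for A B
    proof -
      have "A \<union> B - E \<in> null_sets M" using that unfolding \<C>_def by (simp add: Un_Diff null_sets.Un)
      moreover have "A \<union> B \<in> Domain \<Gamma>"
        using that ring_of_sets.Un[OF algebra.axioms(1)[OF
            sigma_algebra.axioms(1)[OF sigma_algebra_Domain_plift[OF \<Gamma>]]]]
        unfolding \<C>_def by blast
      ultimately show ?thesis unfolding \<C>_def by simp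
    qed
    ultimately obtain A :: "nat \<Rightarrow> _" where A: "range A \<subseteq> \<C>" "\<And>B. B \<in> \<C> \<Longrightarrow> B - (\<Union>i. A i) \<in> null_sets M"
      using countable_essential_union[of \<C>] by (metis empty_iff)
    have "range A \<subseteq> Domain \<Gamma>" using A(1) unfolding \<C>_def by blast
    then obtain \<phi> where \<phi>: "(\<Union>i. A i, \<phi>) \<in> \<Gamma>" using pliftD(4)[OF \<Gamma>, of A] by blast
    have "\<And>i. A i - E \<in> null_sets M" using A(1) unfolding \<C>_def by blast
    then have "(\<Union>i. A i - E) \<in> null_sets M" by blast
    moreover have "(\<Union>i. A i - E) = (\<Union>i. A i) - E" by blast
    ultimately have "(\<Union>i. A i) - E \<in> null_sets M" by simp
    moreover have "B \<subseteq> \<phi>" if "(F, B) \<in> \<Gamma>" "F - E \<in> null_sets M" for F B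
      using plift_null_diff[OF \<Gamma> that(1) \<phi>] A(2)[of F] that unfolding \<C>_def by blast
    ultimately show ?thesis using \<phi> by blast
  qed
  obtain f \<phi> where f: "(f, \<phi>) \<in> \<Gamma>" "f - E \<in> null_sets M"
    "\<And>F A. (F, A) \<in> \<Gamma> \<Longrightarrow> F - E \<in> null_sets M \<Longrightarrow> A \<subseteq> \<phi>"
    using hull[OF E] by blast
  obtain g \<gamma> where g: "(g, \<gamma>) \<in> \<Gamma>" "g - (space M - E) \<in> null_sets M"
    "\<And>F A. (F, A) \<in> \<Gamma> \<Longrightarrow> F - (space M - E) \<in> null_sets M \<Longrightarrow> A \<subseteq> \<gamma>"
    using hull[of "space M - E"] E by blast
  have diff_compl: "F - (space M - E) = F \<inter> E" if "(F, A) \<in> \<Gamma>" for F A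
    using hom_graphD(1)[OF hom that] sets.sets_into_space by blast
  have meas [measurable]: "\<phi> \<in> sets M" "\<gamma> \<in> sets M" "f \<in> sets M" "g \<in> sets M" "E \<in> sets M"
    using f(1) g(1) hom_graphD(1,2)[OF hom] E by auto
  have gE: "g \<inter> E \<in> null_sets M" using g(1,2) diff_compl by metis
  have disj: "\<phi> \<inter> \<gamma> = {}"
  proof -
    have "f \<inter> g \<in> null_sets M"
      by (rule null_sets_subset[OF null_sets.Un[OF f(2) gE]]) auto
    then show ?thesis using hom_graphD(6)[OF hom hom_graphD(4)[OF hom f(1) g(1)]] by simp
  qed
  \<comment> \<open>Adding \<open>\<phi>\<close> and removing \<open>\<gamma>\<close> makes E
    respect the existing lifts. Both corrections are null, because \<open>\<phi>\<close> agrees with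
    f and \<open>\<gamma>\<close> with g almost everywhere.\<close>
  define a where "a = (E \<union> \<phi>) - \<gamma>"
  have a: "a \<in> sets M" unfolding a_def by simp
  have below: "A \<inter> a \<in> {{}}" if "(F, A) \<in> \<Gamma>" "F \<inter> E \<in> null_sets M" for F A
    using g(3)[OF that(1)] diff_compl[OF that(1)] that(2) unfolding a_def by auto
  have above: "A - a \<in> {{}}" if "(F, A) \<in> \<Gamma>" "F - E \<in> null_sets M" for F A
    using f(3)[OF that] disj unfolding a_def by auto
  have step: "hom_graph M M {{}} (graph_step E a \<Gamma>)" "\<Gamma> \<subseteq> graph_step E a \<Gamma>" "(E, a) \<in> graph_step E a \<Gamma>"
    by (intro hom_graph_step[OF hom set_ideal_empty E a] below above; assumption)+
  have Ea: "AE x in M. x \<in> E \<longleftrightarrow> x \<in> a"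
    using pliftD(3)[OF \<Gamma> f(1)] pliftD(3)[OF \<Gamma> g(1)] AE_not_in[OF f(2)] AE_not_in[OF gE]
    by eventually_elim (auto simp: a_def)
  have "plift M (graph_step E a \<Gamma>)"
    unfolding plift_def
  proof (intro conjI ballI allI impI)
    show "hom_graph M M {{}} (graph_step E a \<Gamma>)" by (rule step)
    show "(N, {}) \<in> graph_step E a \<Gamma>" if "N \<in> null_sets M" for N
      using step(2) pliftD(2)[OF \<Gamma> that] by blast
    show "AE x in M. x \<in> G \<longleftrightarrow> x \<in> B" if GB: "(G, B) \<in> graph_step E a \<Gamma>" for G B
    proof -
      obtain F A F' A' where 1: "(F, A) \<in> \<Gamma>" "(F', A') \<in> \<Gamma>"
        "G = (F \<inter> E) \<union> (F' - E)" "B = (A \<inter> a) \<union> (A' - a)"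
        using GB unfolding graph_step_def by blast
      show ?thesis
        using pliftD(3)[OF \<Gamma> 1(1)] pliftD(3)[OF \<Gamma> 1(2)] Ea
        by eventually_elim (auto simp: 1(3,4))
    qed
    fix G :: "nat \<Rightarrow> 'a set" assume G: "range G \<subseteq> Domain (graph_step E a \<Gamma>)"
    have "\<exists>F F'. F \<in> Domain \<Gamma> \<and> F' \<in> Domain \<Gamma> \<and> G i = (F \<inter> E) \<union> (F' - E)" for i
    proof -
      have "G i \<in> Domain (graph_step E a \<Gamma>)" using G by auto
      then show ?thesis unfolding graph_step_def by blast
    qed
    then obtain F F' where F: "\<And>i. F i \<in> Domain \<Gamma>" "\<And>i. F' i \<in> Domain \<Gamma>" "\<And>i. G i = (F i \<inter> E) \<union> (F' i - E)"
      by metis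
    have "(\<Union>i. G i) = ((\<Union>i. F i) \<inter> E) \<union> ((\<Union>i. F' i) - E)" using F(3) by auto
    moreover have "(\<Union>i. F i) \<in> Domain \<Gamma>" "(\<Union>i. F' i) \<in> Domain \<Gamma>"
      using F pliftD(4)[OF \<Gamma>, of F] pliftD(4)[OF \<Gamma>, of F'] by auto
    ultimately show "(\<Union>i. G i) \<in> Domain (graph_step E a \<Gamma>)"
      unfolding graph_step_def by blast
  qed
  with step that show ?thesis by blast
qed

section \<open>Partial liftings along a filtration\<close>

text \<open>Completeness serves the limit step: sets defined there by pointwise choice are
  measurable because they agree almost everywhere with measurable ones.\<close>

locale lifting_filtration = prob_space M + complete_measure M for M :: "'a measure" +
  fixes \<G> :: "nat \<Rightarrow> ('a set \<times> 'a set) set"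
  assumes plift: "plift M (\<G> n)" and incr: "\<G> n \<subseteq> \<G> (Suc n)"
begin

text \<open>For D of stage n: the conditional probability of E given the sigma-algebra of stage n is
  at least c almost everywhere on D. No version of it has to be chosen.\<close>

definition dense_on :: "nat \<Rightarrow> real \<Rightarrow> 'a set \<Rightarrow> 'a set \<Rightarrow> bool" where
  "dense_on n c E D \<longleftrightarrow> (\<forall>D'\<in>Domain (\<G> n). D' \<subseteq> D \<longrightarrow> c * prob D' \<le> prob (E \<inter> D'))"

text \<open>The points where the lifted conditional probabilities of E tend to 1: B is the lift of a
  set D on which the conditional probability is at least c. This is the classical lower density of
  the martingale limit, expressed by set liftings only.\<close>

definition dens :: "'a set \<Rightarrow> 'a set" where
  "dens E = {x \<in> space M. \<forall>c<1. \<exists>n. \<forall>m\<ge>n. \<exists>D B. (D, B) \<in> \<G> m \<and> x \<in> B \<and> dense_on m c E D}"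

text \<open>The sigma-algebra generated by all stages, described as the closure of their
  union.\<close>

definition limit_sets :: "'a set set" where
  "limit_sets = approx_by M (\<Union>n. Domain (\<G> n))"

lemma mono: "n \<le> m \<Longrightarrow> \<G> n \<subseteq> \<G> m"
  using lift_Suc_mono_le[of \<G>] incr by blast

lemma hom: "hom_graph M M {{}} (\<G> n)"
  using plift pliftD(1) by blast

lemma Domain_mono: "n \<le> m \<Longrightarrow> Domain (\<G> n) \<subseteq> Domain (\<G> m)"
  using mono by blast

lemma Domain_sets: "D \<in> Domain (\<G> n) \<Longrightarrow> D \<in> sets M"
  using Domain_plift_subset[OF plift] by blast

lemma sigma_algebra_Domain: "sigma_algebra (space M) (Domain (\<G> n))"
  using sigma_algebra_Domain_plift[OF plift] .

lemma Domain_Int: "A \<in> Domain (\<G> n) \<Longrightarrow> B \<in> Domain (\<G> n) \<Longrightarrow> A \<inter> B \<in> Domain (\<G> n)"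
  using hom_graphD(4)[OF hom] by blast

lemma Domain_Diff: "A \<in> Domain (\<G> n) \<Longrightarrow> B \<in> Domain (\<G> n) \<Longrightarrow> A - B \<in> Domain (\<G> n)"
  using ring_of_sets.Diff[OF algebra.axioms(1)[OF sigma_algebra.axioms(1)[OF sigma_algebra_Domain]]] by blast

lemma dense_on_mono: "dense_on n c E D \<Longrightarrow> c' \<le> c \<Longrightarrow> dense_on n c' E D"
  unfolding dense_on_def by (meson measure_nonneg mult_right_mono order_trans)

text \<open>Hahn decomposition of \<open>prob (E \<inter> D) - c * prob D\<close> on the
  sigma-algebra of stage n; the positive set D plays the part of the set where the conditional
  probability of E is at least c.\<close>

lemma hahn:
  assumes E: "E \<in> sets M" and c: "0 \<le> c"
  obtains D where "D \<in> Domain (\<G> n)" "dense_on n c E D"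
    "\<And>D'. D' \<in> Domain (\<G> n) \<Longrightarrow> D' \<inter> D = {} \<Longrightarrow> prob (E \<inter> D') \<le> c * prob D'"
proof -
  define F where "F = sigma (space M) (Domain (\<G> n))"
  have F: "sets F = Domain (\<G> n)" "space F = space M"
    unfolding F_def using sigma_algebra.sets_measure_of_eq[OF sigma_algebra_Domain[of n]]
    by (auto simp: space_measure_of_conv)
  define M1 where "M1 = density M (indicator E)"
  define M2 where "M2 = scale_measure (ennreal c) M"
  have sub1: "subalgebra M1 F" and sub2: "subalgebra M2 F"
    unfolding subalgebra_def F M1_def M2_def using Domain_sets[of _ n] by (auto simp: F space_scale_measure)
  have M1: "emeasure M1 D = ennreal (prob (E \<inter> D))" if "D \<in> Domain (\<G> n)" for D
    using Domain_sets[OF that] E unfolding M1_def by (simp add: emeasure_restricted emeasure_eq_measure)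
  have M2: "emeasure M2 D = ennreal (c * prob D)" for D
    using c unfolding M2_def by (simp add: emeasure_eq_measure ennreal_mult')
  let ?M1 = "restr_to_subalg M1 F" and ?M2 = "restr_to_subalg M2 F"
  have r: "emeasure ?M1 D = ennreal (prob (E \<inter> D))" "emeasure ?M2 D = ennreal (c * prob D)"
    if "D \<in> Domain (\<G> n)" for D
    using that emeasure_restr_to_subalg[OF sub1] emeasure_restr_to_subalg[OF sub2] M1 M2 F(1) by auto
  have top: "space M \<in> Domain (\<G> n)" using hom_graph_space[OF hom] by blast
  have "\<exists>Y\<in>sets ?M1. (\<forall>X\<in>sets ?M1. X \<subseteq> Y \<longrightarrow> emeasure ?M2 X \<le> emeasure ?M1 X) \<and>
      (\<forall>X\<in>sets ?M1. X \<inter> Y = {} \<longrightarrow> emeasure ?M1 X \<le> emeasure ?M2 X)"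
  proof (rule finite_unsigned_Hahn_decomposition)
    have sp: "space ?M1 = space M" "space ?M2 = space M"
      by (auto simp: space_restr_to_subalg M1_def M2_def space_scale_measure)
    show "finite_measure ?M1" "finite_measure ?M2"
      by (rule finite_measureI; simp add: sp r[OF top])+
    show "sets ?M2 = sets ?M1"
      by (simp add: sets_restr_to_subalg[OF sub1] sets_restr_to_subalg[OF sub2])
  qed
  then obtain Y where Y: "Y \<in> Domain (\<G> n)"
    "\<And>X. X \<in> Domain (\<G> n) \<Longrightarrow> X \<subseteq> Y \<Longrightarrow> ennreal (c * prob X) \<le> ennreal (prob (E \<inter> X))"
    "\<And>X. X \<in> Domain (\<G> n) \<Longrightarrow> X \<inter> Y = {} \<Longrightarrow> ennreal (prob (E \<inter> X)) \<le> ennreal (c * prob X)"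
    unfolding sets_restr_to_subalg[OF sub1] F(1) using r by (metis (no_types, lifting))
  show ?thesis
  proof (rule that[OF Y(1)])
    show "dense_on n c E Y" unfolding dense_on_def using Y(2) by (simp add: ennreal_le_iff)
    show "prob (E \<inter> D') \<le> c * prob D'" if "D' \<in> Domain (\<G> n)" "D' \<inter> Y = {}" for D'
      using Y(3)[OF that] c by (simp add: ennreal_le_iff)
  qed
qed

text \<open>A maximal inequality: the first stages at which the density of \<open>E\<close> fails to exceed \<open>c\<close> on an
  approximation \<open>E'\<close> of \<open>E\<close> split \<open>E'\<close> into disjoint pieces, each having a fraction \<open>1 - c\<close> outside \<open>E\<close>.\<close>

lemma eventually_dense:
  assumes E: "E \<in> limit_sets" and c: "0 \<le> c" "c < 1"
    and D: "\<And>n. D n \<in> Domain (\<G> n)"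
    and D': "\<And>n D'. D' \<in> Domain (\<G> n) \<Longrightarrow> D' \<inter> D n = {} \<Longrightarrow> prob (E \<inter> D') \<le> c * prob D'"
  shows "AE x in M. x \<in> E \<longrightarrow> (\<exists>n. \<forall>m\<ge>n. x \<in> D m)"
proof -
  have [measurable]: "E \<in> sets M" "\<And>n. D n \<in> sets M"
    using E D Domain_sets unfolding limit_sets_def approx_by_def by auto
  define bad where "bad = E - (\<Union>n. \<Inter>m\<in>{n..}. D m)"
  have [measurable]: "bad \<in> sets M" unfolding bad_def by measurable
  have bound: "prob bad \<le> e + e / (1 - c)" if e: "e > 0" for e
  proof -
    obtain E' where E': "E' \<in> (\<Union>n. Domain (\<G> n))" "prob (sym_diff E E') < e"
      using approx_byE[OF E[unfolded limit_sets_def] e] by blast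
    obtain n where n: "E' \<in> Domain (\<G> n)" using E' by blast
    have [measurable]: "E' \<in> sets M" using n Domain_sets by blast
    \<comment> \<open>Counting starts at the stage n that contains \<open>E'\<close>, so that
      \<open>T j\<close> belongs to stage \<open>n + j\<close> and the bound \<open>D'\<close>
      applies to it.\<close>
    define T where "T j = (E' \<inter> (\<Inter>k\<in>{n..<n + j}. D k)) - D (n + j)" for j
    have stage: "E' \<inter> (\<Inter>k\<in>{n..<n + j}. D k) \<in> Domain (\<G> (n + j))" for j
    proof (induction j)
      case (Suc j)
      have "E' \<inter> (\<Inter>k\<in>{n..<n + Suc j}. D k) = (E' \<inter> (\<Inter>k\<in>{n..<n + j}. D k)) \<inter> D (n + j)"
        by (auto simp: less_Suc_eq)
      also have "\<dots> \<in> Domain (\<G> (n + j))" using Suc D Domain_Int by blast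
      finally show ?case using Domain_mono[of "n + j" "n + Suc j"] by auto
    qed (use n in simp)
    have T_dom: "T j \<in> Domain (\<G> (n + j))" for j
      unfolding T_def using stage D Domain_Diff by blast
    have [measurable]: "T j \<in> sets M" for j using T_dom Domain_sets by blast
    have disj: "disjoint_family T"
    proof -
      have "T i \<inter> T j = {}" if "i < j" for i j
        using that unfolding T_def by auto
      then show ?thesis unfolding disjoint_family_on_def by (metis Int_commute linorder_neqE_nat)
    qed
    have le: "(1 - c) * prob (T j) \<le> prob (T j - E)" for j
    proof -
      have "prob (E \<inter> T j) \<le> c * prob (T j)"
        by (rule D'[OF T_dom]) (auto simp: T_def)
      moreover have "prob (T j - E) = prob (T j) - prob (E \<inter> T j)"
        using finite_measure_Diff'[of "T j" E] by (simp add: Int_commute)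
      ultimately show ?thesis by (simp add: algebra_simps)
    qed
    have sum: "(\<lambda>j. prob (T j)) sums prob (\<Union>j. T j)"
      using disj by (intro finite_measure_UNION) auto
    have sum': "(\<lambda>j. prob (T j - E)) sums prob (\<Union>j. T j - E)"
      using disj by (intro finite_measure_UNION) (auto simp: disjoint_family_on_def)
    have "(1 - c) * prob (\<Union>j. T j) \<le> prob (\<Union>j. T j - E)"
      by (rule sums_le[OF le sums_mult[OF sum] sum'])
    also have "\<dots> \<le> prob (sym_diff E E')"
      by (intro finite_measure_mono) (auto simp: T_def)
    finally have T_le: "prob (\<Union>j. T j) \<le> e / (1 - c)"
      using E'(2) c by (simp add: field_simps)
    have "bad \<subseteq> sym_diff E E' \<union> (\<Union>j. T j)"
    proof
      fix x assume x: "x \<in> bad"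
      show "x \<in> sym_diff E E' \<union> (\<Union>j. T j)"
      proof (cases "x \<in> E'")
        case True
        obtain m where "m \<ge> n" "x \<notin> D m" using x unfolding bad_def by auto
        then have ex: "\<exists>j. x \<notin> D (n + j)" by (metis le_Suc_ex)
        define j where "j = (LEAST j. x \<notin> D (n + j))"
        have "x \<notin> D (n + j)" using LeastI_ex[OF ex] unfolding j_def .
        moreover have "x \<in> D k" if "k \<in> {n..<n + j}" for k
          using not_less_Least[of "k - n" "\<lambda>j. x \<notin> D (n + j)"] that unfolding j_def by auto
        ultimately have "x \<in> T j" using True unfolding T_def by auto
        then show ?thesis by blast
      qed (use x in \<open>auto simp: bad_def\<close>)
    qed
    then have "prob bad \<le> prob (sym_diff E E' \<union> (\<Union>j. T j))"
      by (intro finite_measure_mono) auto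
    also have "\<dots> \<le> prob (sym_diff E E') + prob (\<Union>j. T j)"
      by (intro measure_Un_le) auto
    finally show ?thesis using E'(2) T_le by linarith
  qed
  have "prob bad \<le> d" if "d > 0" for d
  proof -
    \<comment> \<open>The choice \<open>e = d * b / 2\<close> turns \<open>e + e / b\<close> into
      \<open>d * b / 2 + d / 2\<close>, which is at most d because \<open>b \<le> 1\<close>.\<close>
    define b where "b = 1 - c"
    have b: "0 < b" "b \<le> 1" using c unfolding b_def by auto
    have "prob bad \<le> d * b / 2 + d * b / 2 / b"
      using b that unfolding b_def by (intro bound) auto
    also have "\<dots> = d * b / 2 + d / 2" using b by simp
    also have "d * b \<le> d" using b that by (simp add: mult_left_le)
    finally show ?thesis by simp
  qed
  then have "prob bad \<le> 0" by (rule field_le_epsilon) simp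
  then have "prob bad = 0" using measure_nonneg[of M bad] by linarith
  then have "AE x in M. x \<notin> bad"
    by (intro AE_not_in) (simp add: null_setsI emeasure_eq_measure)
  then show ?thesis by eventually_elim (auto simp: bad_def)
qed

text \<open>Levy's zero-one law for indicators, applied at the countably many thresholds
  \<open>1 - 1 / Suc k\<close>. Replacing each Hahn set D by its lift B costs countably many null
  sets.\<close>

lemma AE_dens:
  assumes E: "E \<in> limit_sets"
  shows "AE x in M. x \<in> E \<longrightarrow> x \<in> dens E"
proof -
  have E': "E \<in> sets M" using E unfolding limit_sets_def approx_by_def by auto
  define c :: "nat \<Rightarrow> real" where "c k = 1 - 1 / Suc k" for k
  have c: "0 \<le> c k" "c k < 1" for k unfolding c_def by auto
  define good where "good k n D \<longleftrightarrow> D \<in> Domain (\<G> n) \<and> dense_on n (c k) E D \<and>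
      (\<forall>D'. D' \<in> Domain (\<G> n) \<longrightarrow> D' \<inter> D = {} \<longrightarrow> prob (E \<inter> D') \<le> c k * prob D')" for k n D
  have "\<exists>D. good k n D" for k n
    unfolding good_def using hahn[OF E' c(1)[of k], of n] by metis
  then obtain D where "\<And>k n. good k n (D k n)" by metis
  then have D: "\<And>k n. D k n \<in> Domain (\<G> n)" "\<And>k n. dense_on n (c k) E (D k n)"
    "\<And>k n D'. D' \<in> Domain (\<G> n) \<Longrightarrow> D' \<inter> D k n = {} \<Longrightarrow> prob (E \<inter> D') \<le> c k * prob D'"
    unfolding good_def by auto
  have "\<exists>B. (D k n, B) \<in> \<G> n" for k n using D(1) by blast
  then obtain B where B: "\<And>k n. (D k n, B k n) \<in> \<G> n" by metis
  have "AE x in M. \<forall>k. x \<in> E \<longrightarrow> (\<exists>n. \<forall>m\<ge>n. x \<in> D k m)"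
    unfolding AE_all_countable
  proof
    fix k show "AE x in M. x \<in> E \<longrightarrow> (\<exists>n. \<forall>m\<ge>n. x \<in> D k m)"
      by (rule eventually_dense[OF E c(1)[of k] c(2)]) (use D in auto)
  qed
  moreover have "AE x in M. \<forall>k n. x \<in> D k n \<longleftrightarrow> x \<in> B k n"
    unfolding AE_all_countable using pliftD(3)[OF plift B] by blast
  ultimately show ?thesis
    using AE_space
  proof eventually_elim
    case (elim x)
    show ?case
      unfolding dens_def
    proof (intro impI CollectI conjI allI)
      assume x: "x \<in> E"
      show "x \<in> space M" by fact
      fix d :: real assume "d < 1"
      then obtain k where "1 / Suc k < 1 - d" using nat_approx_posE[of "1 - d"] by auto
      then have k: "d \<le> c k" unfolding c_def by simp
      obtain n where "\<forall>m\<ge>n. x \<in> D k m" using elim x by blast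
      then have "\<forall>m\<ge>n. (D k m, B k m) \<in> \<G> m \<and> x \<in> B k m \<and> dense_on m d E (D k m)"
        using B elim(2) dense_on_mono[OF D(2) k] by blast
      then show "\<exists>n. \<forall>m\<ge>n. \<exists>D B. (D, B) \<in> \<G> m \<and> x \<in> B \<and> dense_on m d E D" by blast
    qed
  qed
qed

lemma dens_subset_space: "dens E \<subseteq> space M"
  unfolding dens_def by blast

text \<open>The threshold \<open>1/2\<close> already decides: a domain set on which a null E has
  density at least \<open>1/2\<close> is null, so its lift is empty.\<close>

lemma dens_null:
  assumes "E \<in> null_sets M" shows "dens E = {}"
proof (rule ccontr)
  assume "dens E \<noteq> {}"
  then obtain x where "x \<in> dens E" by blast
  then have "\<forall>c<1. \<exists>n. \<forall>m\<ge>n. \<exists>D B. (D, B) \<in> \<G> m \<and> x \<in> B \<and> dense_on m c E D"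
    unfolding dens_def by blast
  from this[rule_format, of "1/2"] obtain n D B
    where DB: "(D, B) \<in> \<G> n" "x \<in> B" "dense_on n (1/2) E D" by auto
  have D: "D \<in> sets M" "D \<in> Domain (\<G> n)" using DB(1) Domain_sets by blast+
  have "prob (E \<inter> D) = 0"
    using null_sets_subset[OF assms, of "E \<inter> D"] D assms by (auto simp: measure_eq_0_null_sets)
  then have "prob D \<le> 0" using DB(3) D(2) unfolding dense_on_def by auto
  then have "prob D = 0" using measure_nonneg[of M D] by linarith
  then have "D \<in> null_sets M" using D(1) by (simp add: null_setsI emeasure_eq_measure)
  then show False using hom_graphD(6)[OF hom DB(1)] DB(2) by blast
qed

lemma dens_mono:
  assumes "E \<in> sets M" "F \<in> sets M" "E \<subseteq> F" shows "dens E \<subseteq> dens F"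
proof -
  have "dense_on m c F D" if "dense_on m c E D" for m c D
    unfolding dense_on_def
  proof (intro ballI impI)
    fix D' assume D': "D' \<in> Domain (\<G> m)" "D' \<subseteq> D"
    have "prob (E \<inter> D') \<le> prob (F \<inter> D')"
      using assms Domain_sets[OF D'(1)] by (intro finite_measure_mono) auto
    moreover have "c * prob D' \<le> prob (E \<inter> D')" using that D' unfolding dense_on_def by blast
    ultimately show "c * prob D' \<le> prob (F \<inter> D')" by linarith
  qed
  then show ?thesis unfolding dens_def by blast
qed

text \<open>Inclusion-exclusion: densities at least \<open>c'\<close> for both sets give at least
  \<open>2 * c' - 1\<close> for the intersection, which is c for
  \<open>c' = (1 + c) / 2\<close>.\<close>

lemma dens_Int:
  assumes E: "E \<in> sets M" and F: "F \<in> sets M" shows "dens E \<inter> dens F \<subseteq> dens (E \<inter> F)"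
proof
  fix x assume x: "x \<in> dens E \<inter> dens F"
  have "\<exists>n. \<forall>m\<ge>n. \<exists>D B. (D, B) \<in> \<G> m \<and> x \<in> B \<and> dense_on m c (E \<inter> F) D" if c: "c < 1" for c
  proof -
    define c' where "c' = (1 + c) / 2"
    have "c' < 1" using c unfolding c'_def by simp
    then obtain n1 n2 where
      n1: "\<forall>m\<ge>n1. \<exists>D B. (D, B) \<in> \<G> m \<and> x \<in> B \<and> dense_on m c' E D" and
      n2: "\<forall>m\<ge>n2. \<exists>D B. (D, B) \<in> \<G> m \<and> x \<in> B \<and> dense_on m c' F D"
      using x unfolding dens_def by blast
    have "\<exists>D B. (D, B) \<in> \<G> m \<and> x \<in> B \<and> dense_on m c (E \<inter> F) D" if m: "m \<ge> max n1 n2" for m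
    proof -
      obtain D1 B1 D2 B2 where 1: "(D1, B1) \<in> \<G> m" "x \<in> B1" "dense_on m c' E D1"
        and 2: "(D2, B2) \<in> \<G> m" "x \<in> B2" "dense_on m c' F D2"
        using n1[rule_format, of m] n2[rule_format, of m] m by auto
      have "dense_on m c (E \<inter> F) (D1 \<inter> D2)"
        unfolding dense_on_def
      proof (intro ballI impI)
        fix D assume D: "D \<in> Domain (\<G> m)" "D \<subseteq> D1 \<inter> D2"
        have [measurable]: "D \<in> sets M" "E \<in> sets M" "F \<in> sets M" using D Domain_sets E F by auto
        have "c' * prob D \<le> prob (E \<inter> D)" "c' * prob D \<le> prob (F \<inter> D)"
          using 1(3) 2(3) D unfolding dense_on_def by auto
        moreover have "prob (E \<inter> D) + prob (F \<inter> D) = prob (E \<inter> D \<union> F \<inter> D) + prob ((E \<inter> D) \<inter> (F \<inter> D))"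
          using measure_Un3[of "E \<inter> D" M "F \<inter> D"] by (simp add: fmeasurable_eq_sets)
        moreover have "prob (E \<inter> D \<union> F \<inter> D) \<le> prob D" by (intro finite_measure_mono) auto
        moreover have "(E \<inter> D) \<inter> (F \<inter> D) = E \<inter> F \<inter> D" by blast
        moreover have "2 * (c' * prob D) = prob D + c * prob D"
          unfolding c'_def by (simp add: field_simps)
        ultimately show "c * prob D \<le> prob (E \<inter> F \<inter> D)" by (smt (verit))
      qed
      then show ?thesis using hom_graphD(4)[OF hom 1(1) 2(1)] 1(2) 2(2) by blast
    qed
    then show ?thesis by blast
  qed
  then show "x \<in> dens (E \<inter> F)" using x unfolding dens_def by blast
qed

text \<open>From stage n on, E belongs to the domain and has density 1 relative to itself, so it
  serves as its own D.\<close>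

lemma dens_extends:
  assumes EB: "(E, B) \<in> \<G> n" shows "B \<subseteq> dens E"
proof -
  have "dense_on m c E E" if "c < 1" for m c
    unfolding dense_on_def
  proof (intro ballI impI)
    fix D assume "D \<subseteq> E"
    then have "E \<inter> D = D" by blast
    then show "c * prob D \<le> prob (E \<inter> D)" using that mult_right_mono[of c 1 "prob D"] by simp
  qed
  moreover have "(E, B) \<in> \<G> m" if "n \<le> m" for m using mono[OF that] EB by blast
  moreover have "B \<subseteq> space M" using hom_graphD(2)[OF hom EB] sets.sets_into_space by blast
  ultimately show ?thesis unfolding dens_def by blast
qed

lemma limit_sets_sets: "E \<in> limit_sets \<Longrightarrow> E \<in> sets M"
  unfolding limit_sets_def approx_by_def by blast

lemma Domain_limit_sets: "Domain (\<G> n) \<subseteq> limit_sets"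
proof -
  have "(\<Union>n. Domain (\<G> n)) \<subseteq> sets M" using Domain_sets by blast
  then show ?thesis unfolding limit_sets_def using approx_by_superset by blast
qed

lemma sigma_algebra_limit_sets: "sigma_algebra (space M) limit_sets"
  unfolding limit_sets_def
proof (rule sigma_algebra_approx_by)
  show "(\<Union>n. Domain (\<G> n)) \<subseteq> sets M" using Domain_sets by blast
  show "{} \<in> (\<Union>n. Domain (\<G> n))" using hom_graphD(3)[OF hom] by blast
  show "space M - C \<in> (\<Union>n. Domain (\<G> n))" if "C \<in> (\<Union>n. Domain (\<G> n))" for C
    using that hom_graphD(5)[OF hom] by blast
  fix C D assume "C \<in> (\<Union>n. Domain (\<G> n))" "D \<in> (\<Union>n. Domain (\<G> n))"
  then obtain n m C' D' where "(C, C') \<in> \<G> n" "(D, D') \<in> \<G> m" by blast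
  then have "(C, C') \<in> \<G> (max n m)" "(D, D') \<in> \<G> (max n m)"
    using mono[of n "max n m"] mono[of m "max n m"] by auto
  then have "(C \<union> D, C' \<union> D') \<in> \<G> (max n m)" by (rule hom_graph_Un[OF hom])
  then show "C \<union> D \<in> (\<Union>n. Domain (\<G> n))" by blast
qed

text \<open>At every point the sets of density one there form a filter; extending each of these filters to
  an ultrafilter turns the lower density into a lifting.\<close>

theorem plift_limit:
  "\<exists>\<Gamma>. plift M \<Gamma> \<and> (\<forall>n. \<G> n \<subseteq> \<Gamma>) \<and> Domain \<Gamma> = limit_sets \<and>
     (\<forall>E B. (E, B) \<in> \<Gamma> \<longrightarrow> dens E \<subseteq> B)"
proof -
  have dens_space: "dens (space M) = space M"
    using dens_extends[OF hom_graph_space[OF hom]] dens_subset_space by blast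
  \<comment> \<open>The subsets of \<open>{x}\<close> form the two-element algebra, and only the
    empty set is null for the counting measure. A total homomorphism into it is an ultrafilter on
    \<open>sets M\<close> free of null sets, so the extension theorem for measure algebras
    applies.\<close>
  have ultra: "\<exists>\<Gamma>. hom_graph M (count_space {x}) {{}} \<Gamma> \<and> (\<forall>E\<in>sets M. \<exists>A. (E, A) \<in> \<Gamma>) \<and>
      (\<forall>E\<in>sets M. x \<in> dens E \<longrightarrow> (E, {x}) \<in> \<Gamma>)" if x: "x \<in> space M" for x
  proof -
    define \<Gamma>0 where "\<Gamma>0 = {(E, A). E \<in> sets M \<and>
      (A = {x} \<and> x \<in> dens E \<or> A = {} \<and> x \<in> dens (space M - E))}"
    have "hom_graph M (count_space {x}) {{}} \<Gamma>0"
      unfolding hom_graph_def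
    proof (intro conjI allI impI)
      show "\<Gamma>0 \<subseteq> sets M \<times> sets (count_space {x})" unfolding \<Gamma>0_def by auto
      show "({}, {}) \<in> \<Gamma>0" unfolding \<Gamma>0_def using dens_space x by simp
      fix E A assume EA: "(E, A) \<in> \<Gamma>0"
      then have E: "E \<in> sets M" unfolding \<Gamma>0_def by auto
      show "(E \<inter> E', A \<inter> A') \<in> \<Gamma>0" if EA': "(E', A') \<in> \<Gamma>0" for E' A'
      proof -
        have E': "E' \<in> sets M" using EA' unfolding \<Gamma>0_def by auto
        have "dens (space M - E) \<subseteq> dens (space M - E \<inter> E')" "dens (space M - E') \<subseteq> dens (space M - E \<inter> E')"
          by (rule dens_mono; use E E' in blast)+
        then show ?thesis using EA EA' dens_Int[OF E E'] unfolding \<Gamma>0_def by auto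
      qed
      show "(space M - E, space (count_space {x}) - A) \<in> \<Gamma>0"
      proof -
        have "space M - (space M - E) = E" using sets.sets_into_space[OF E] by blast
        then show ?thesis using EA unfolding \<Gamma>0_def by auto
      qed
      assume "E \<in> null_sets M"
      then show "A \<in> {{}}" using EA dens_null unfolding \<Gamma>0_def by auto
    qed
    then have 0: "hom_graph M (count_space {x}) (null_sets (count_space {x})) \<Gamma>0"
      unfolding null_sets_count_space .
    have fin: "finite_measure (count_space {x})" by (rule finite_measure_count_space) simp
    obtain \<Gamma> where "hom_graph M (count_space {x}) (null_sets (count_space {x})) \<Gamma>" "\<Gamma>0 \<subseteq> \<Gamma>"
        "\<And>E. E \<in> sets M \<Longrightarrow> \<exists>A. (E, A) \<in> \<Gamma>"
      using hom_graph_extend[OF fin 0] by blast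
    moreover have "(E, {x}) \<in> \<Gamma>" if "E \<in> sets M" "x \<in> dens E" for E
      using that \<open>\<Gamma>0 \<subseteq> \<Gamma>\<close> unfolding \<Gamma>0_def by blast
    ultimately show ?thesis by (auto simp: null_sets_count_space)
  qed
  then obtain U where U: "\<And>x. x \<in> space M \<Longrightarrow> hom_graph M (count_space {x}) {{}} (U x)"
    "\<And>x E. x \<in> space M \<Longrightarrow> E \<in> sets M \<Longrightarrow> \<exists>A. (E, A) \<in> U x"
    "\<And>x E. x \<in> space M \<Longrightarrow> E \<in> sets M \<Longrightarrow> x \<in> dens E \<Longrightarrow> (E, {x}) \<in> U x"
    by metis
  have cases: "(E, {x}) \<in> U x \<or> (E, {}) \<in> U x" if xE: "x \<in> space M" "E \<in> sets M" for x E
  proof -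
    obtain A where A: "(E, A) \<in> U x" using U(2)[OF xE] by blast
    then have "A = {} \<or> A = {x}" using hom_graphD(2)[OF U(1)[OF xE(1)] A] by auto
    then show ?thesis using A by blast
  qed
  have excl: False if "x \<in> space M" "(E, {x}) \<in> U x" "(E, {}) \<in> U x" for x E
    using hom_graphD(6)[OF U(1) hom_graph_Diff[OF U(1) that(2,3)]] that(1) by auto
  define \<delta> where "\<delta> E = {x \<in> space M. (E, {x}) \<in> U x}" for E
  have \<delta>_Int: "\<delta> (E \<inter> F) = \<delta> E \<inter> \<delta> F" if E: "E \<in> sets M" and F: "F \<in> sets M" for E F
  proof -
    have "(E \<inter> F, {x}) \<in> U x \<longleftrightarrow> (E, {x}) \<in> U x \<and> (F, {x}) \<in> U x" if x: "x \<in> space M" for x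
    proof
      show "(E \<inter> F, {x}) \<in> U x" if "(E, {x}) \<in> U x \<and> (F, {x}) \<in> U x"
        using that hom_graphD(4)[OF U(1)[OF x], of E "{x}" F "{x}"] by simp
      assume EF: "(E \<inter> F, {x}) \<in> U x"
      show "(E, {x}) \<in> U x \<and> (F, {x}) \<in> U x"
      proof (rule ccontr)
        assume "\<not> ?thesis"
        then have "(E, {}) \<in> U x \<or> (F, {}) \<in> U x" using cases[OF x E] cases[OF x F] by blast
        then have "(E \<inter> F, {}) \<in> U x"
          using cases[OF x E] cases[OF x F] hom_graphD(4)[OF U(1)[OF x]]
          by (metis Int_empty_left Int_empty_right)
        then show False using excl[OF x EF] by blast
      qed
    qed
    then show ?thesis unfolding \<delta>_def by blast
  qed
  have \<delta>_compl: "\<delta> (space M - E) = space M - \<delta> E" if E: "E \<in> sets M" for E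
  proof -
    have "(space M - E, {x}) \<in> U x \<longleftrightarrow> (E, {x}) \<notin> U x" if x: "x \<in> space M" for x
    proof
      assume "(space M - E, {x}) \<in> U x"
      then show "(E, {x}) \<notin> U x" using hom_graphD(5)[OF U(1)[OF x], of E "{x}"] excl[OF x] by auto
    next
      assume "(E, {x}) \<notin> U x"
      then show "(space M - E, {x}) \<in> U x" using cases[OF x E] hom_graphD(5)[OF U(1)[OF x], of E "{}"] by simp
    qed
    then show ?thesis unfolding \<delta>_def by blast
  qed
  have \<delta>_null: "\<delta> N = {}" if "N \<in> null_sets M" for N
    using hom_graphD(6)[OF U(1)] that unfolding \<delta>_def by blast
  have dens_\<delta>: "dens E \<subseteq> \<delta> E" if "E \<in> sets M" for E
    using U(3) that dens_subset_space unfolding \<delta>_def by blast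
  interpret L: sigma_algebra "space M" limit_sets by (rule sigma_algebra_limit_sets)
  have AE_\<delta>: "AE x in M. x \<in> E \<longleftrightarrow> x \<in> \<delta> E" if E: "E \<in> limit_sets" for E
  proof -
    have E': "E \<in> sets M" using E limit_sets_sets by blast
    then have "dens E \<subseteq> \<delta> E" "dens (space M - E) \<subseteq> space M - \<delta> E"
      using dens_\<delta>[of E] dens_\<delta>[of "space M - E"] \<delta>_compl[of E] by auto
    note sub = this
    show ?thesis
      using AE_dens[OF E] AE_dens[OF L.compl_sets[OF E]] AE_space by eventually_elim (use sub in auto)
  qed
  \<comment> \<open>\<open>\<delta>\<close> respects Boolean operations on all of
    \<open>sets M\<close>, but agreement with its argument almost everywhere is known only on
    \<open>limit_sets\<close>; hence the restriction.\<close>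
  define \<Gamma> where "\<Gamma> = {(E, \<delta> E) | E. E \<in> limit_sets}"
  have "plift M \<Gamma>"
    unfolding plift_def hom_graph_def
  proof (intro conjI allI impI ballI)
    have "\<delta> E \<in> sets M" if "E \<in> limit_sets" for E
      using in_sets_AE[OF AE_\<delta>[OF that] limit_sets_sets[OF that]] unfolding \<delta>_def by blast
    then show "\<Gamma> \<subseteq> sets M \<times> sets M" unfolding \<Gamma>_def using limit_sets_sets by blast
    show null: "(N, {}) \<in> \<Gamma>" if "N \<in> null_sets M" for N
    proof -
      have "N \<in> Domain (\<G> 0)" using pliftD(2)[OF plift that] by blast
      then show ?thesis unfolding \<Gamma>_def using \<delta>_null[OF that] Domain_limit_sets by blast
    qed
    show "({}, {}) \<in> \<Gamma>" by (rule null) simp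
    show "(A \<inter> A', B \<inter> B') \<in> \<Gamma>" if "(A, B) \<in> \<Gamma>" "(A', B') \<in> \<Gamma>" for A B A' B'
      using that \<delta>_Int[of A A'] limit_sets_sets L.Int[of A A'] unfolding \<Gamma>_def by auto
    show "(space M - A, space M - B) \<in> \<Gamma>" if "(A, B) \<in> \<Gamma>" for A B
      using that \<delta>_compl[of A] limit_sets_sets L.compl_sets[of A] unfolding \<Gamma>_def by auto
    show "B \<in> {{}}" if "(A, B) \<in> \<Gamma>" "A \<in> null_sets M" for A B
      using that \<delta>_null unfolding \<Gamma>_def by auto
    show "AE x in M. x \<in> A \<longleftrightarrow> x \<in> B" if "(A, B) \<in> \<Gamma>" for A B
      using that AE_\<delta> unfolding \<Gamma>_def by blast
    show "(\<Union>i. A i) \<in> Domain \<Gamma>" if "range A \<subseteq> Domain \<Gamma>" for A :: "nat \<Rightarrow> 'a set"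
      using that L.countable_UN[of A UNIV] unfolding \<Gamma>_def by blast
  qed
  moreover have "\<G> n \<subseteq> \<Gamma>" for n
  proof
    fix p assume p: "p \<in> \<G> n"
    obtain E B where EB: "p = (E, B)" by (cases p)
    have EB': "(E, B) \<in> \<G> n" using p EB by simp
    have E: "E \<in> limit_sets" "E \<in> sets M" "B \<subseteq> space M"
      using EB' Domain_limit_sets Domain_sets hom_graphD(2)[OF hom EB'] sets.sets_into_space by blast+
    \<comment> \<open>Only inclusions are available; using them for E and for its complement yields
      equality.\<close>
    have "B \<subseteq> \<delta> E" using dens_extends[OF EB'] dens_\<delta>[OF E(2)] by blast
    moreover have "space M - B \<subseteq> space M - \<delta> E"
      using dens_extends[OF hom_graphD(5)[OF hom EB']] dens_\<delta>[of "space M - E"] \<delta>_compl[OF E(2)] E(2) by auto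
    moreover have "\<delta> E \<subseteq> space M" unfolding \<delta>_def by blast
    ultimately have "B = \<delta> E" using E(3) by blast
    then show "p \<in> \<Gamma>" using E(1) EB unfolding \<Gamma>_def by blast
  qed
  moreover have "Domain \<Gamma> = limit_sets" unfolding \<Gamma>_def by blast
  moreover have "dens E \<subseteq> B" if "(E, B) \<in> \<Gamma>" for E B
    using that dens_\<delta> limit_sets_sets unfolding \<Gamma>_def by blast
  ultimately show ?thesis by blast
qed

end

section \<open>Extension of partial liftings\<close>

text \<open>The clause on countable unions is not finitary, so a chain is bounded in one of two
  ways. If every countable subfamily has an upper bound inside the chain, the union of the chain
  works. Otherwise some countable subfamily is bounded by no member; it is then cofinal, and the
  limit along the increasing sequence it yields is an upper bound. A maximal element is total by the
  one-set extension.\<close>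

theorem plift_extend:
  assumes "prob_space M" "complete_measure M" and \<Gamma>0: "plift M \<Gamma>0"
  obtains \<Gamma> where "plift M \<Gamma>" "\<Gamma>0 \<subseteq> \<Gamma>" "Domain \<Gamma> = sets M"
proof -
  interpret prob_space M by fact
  interpret complete_measure M by fact
  let ?S = "{\<Gamma>. plift M \<Gamma> \<and> \<Gamma>0 \<subseteq> \<Gamma>}"
  have "\<exists>U\<in>?S. \<forall>X\<in>C. X \<subseteq> U" if C: "subset.chain ?S C" for C
  proof (cases "C = {}")
    case True
    then show ?thesis using \<Gamma>0 by auto
  next
    case False
    have CS: "plift M \<Gamma>" "\<Gamma>0 \<subseteq> \<Gamma>" if "\<Gamma> \<in> C" for \<Gamma>
      using C that unfolding subset_chain_def by auto
    have total: "\<Gamma> \<subseteq> \<Gamma>' \<or> \<Gamma>' \<subseteq> \<Gamma>" if "\<Gamma> \<in> C" "\<Gamma>' \<in> C" for \<Gamma> \<Gamma>'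
      using C that unfolding subset_chain_def by auto
    obtain \<Gamma>1 where \<Gamma>1: "\<Gamma>1 \<in> C" using False by blast
    show ?thesis
    proof (cases "\<forall>D\<subseteq>C. countable D \<longrightarrow> (\<exists>U\<in>C. \<forall>X\<in>D. X \<subseteq> U)")
      case True
      have "plift M (\<Union>C)"
        unfolding plift_def
      proof (intro conjI ballI allI impI)
        show "hom_graph M M {{}} (\<Union>C)"
          using total by (intro hom_graph_Union_chain pliftD(1) CS(1) False)
        show "(N, {}) \<in> \<Union>C" if "N \<in> null_sets M" for N
          using pliftD(2)[OF CS(1)[OF \<Gamma>1] that] \<Gamma>1 by blast
        show "AE x in M. x \<in> A \<longleftrightarrow> x \<in> B" if AB: "(A, B) \<in> \<Union>C" for A B
        proof -
          obtain \<Gamma> where "\<Gamma> \<in> C" "(A, B) \<in> \<Gamma>" using AB by blast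
          then show ?thesis by (intro pliftD(3)[OF CS(1)])
        qed
        fix A :: "nat \<Rightarrow> 'a set" assume A: "range A \<subseteq> Domain (\<Union>C)"
        have "\<exists>\<Gamma>. \<Gamma> \<in> C \<and> A i \<in> Domain \<Gamma>" for i
        proof -
          have "A i \<in> Domain (\<Union>C)" using A by auto
          then show ?thesis by blast
        qed
        then obtain \<Gamma> where \<Gamma>: "\<And>i. \<Gamma> i \<in> C" "\<And>i. A i \<in> Domain (\<Gamma> i)" by metis
        have "range \<Gamma> \<subseteq> C" "countable (range \<Gamma>)" using \<Gamma>(1) by auto
        then obtain U where "U \<in> C" "\<forall>X\<in>range \<Gamma>. X \<subseteq> U" using True by metis
        then have U: "U \<in> C" "\<And>i. \<Gamma> i \<subseteq> U" by auto
        have "A i \<in> Domain U" for i using \<Gamma>(2)[of i] U(2)[of i] by blast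
        then have "range A \<subseteq> Domain U" by blast
        then have "(\<Union>i. A i) \<in> Domain U" by (rule pliftD(4)[OF CS(1)[OF U(1)]])
        then show "(\<Union>i. A i) \<in> Domain (\<Union>C)" using U(1) by blast
      qed
      moreover have "\<Gamma>0 \<subseteq> \<Union>C" using CS(2)[OF \<Gamma>1] \<Gamma>1 by blast
      ultimately show ?thesis by blast
    next
      case False
      then obtain D where D: "D \<subseteq> C" "countable D" and "\<not> (\<exists>U\<in>C. \<forall>X\<in>D. X \<subseteq> U)" by metis
      then have D3: "\<exists>X\<in>D. \<not> X \<subseteq> U" if "U \<in> C" for U using that by blast
      have "D \<noteq> {}" using D3[OF \<Gamma>1] by blast
      define d where "d = from_nat_into D"
      have d: "range d = D" unfolding d_def using \<open>D \<noteq> {}\<close> D(2) by (rule range_from_nat_into)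
      \<comment> \<open>In a chain this union is the largest of its finitely many members, so the
        sequence increases and stays in C.\<close>
      define \<G> where "\<G> n = \<Union>(d ` {..n})" for n
      have \<G>_C: "\<G> n \<in> C" for n
      proof -
        have "d ` {..n} \<subseteq> C" using d D(1) by blast
        then have "subset.chain C (d ` {..n})" using total unfolding subset_chain_def by blast
        then have "\<G> n \<in> d ` {..n}" unfolding \<G>_def by (intro Union_in_chain[of _ C]) auto
        then show ?thesis using \<open>d ` {..n} \<subseteq> C\<close> by blast
      qed
      interpret F: lifting_filtration M \<G>
      proof
        show "plift M (\<G> n)" for n by (rule CS(1)[OF \<G>_C])
        show "\<G> n \<subseteq> \<G> (Suc n)" for n unfolding \<G>_def by (intro Union_mono image_mono) auto
      qed
      obtain \<Gamma> where \<Gamma>: "plift M \<Gamma>" "\<And>n. \<G> n \<subseteq> \<Gamma>" using F.plift_limit by blast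
      have "X \<subseteq> \<Gamma>" if X: "X \<in> C" for X
      proof -
        obtain Y where Y: "Y \<in> D" "\<not> Y \<subseteq> X" using D3[OF X] by blast
        then have "X \<subseteq> Y" using total[OF X, of Y] D(1) by blast
        moreover obtain n where "Y = d n" using Y(1) d by blast
        ultimately have "X \<subseteq> \<G> n" unfolding \<G>_def by blast
        then show ?thesis using \<Gamma>(2)[of n] by (rule subset_trans)
      qed
      moreover have "\<Gamma>0 \<subseteq> \<Gamma>" using CS(2)[OF \<G>_C[of 0]] \<Gamma>(2)[of 0] by (rule subset_trans)
      ultimately show ?thesis using \<Gamma>(1) by blast
    qed
  qed
  then obtain \<Gamma> where \<Gamma>: "plift M \<Gamma>" "\<Gamma>0 \<subseteq> \<Gamma>"
    and max: "\<And>\<Gamma>'. plift M \<Gamma>' \<Longrightarrow> \<Gamma> \<subseteq> \<Gamma>' \<Longrightarrow> \<Gamma>' = \<Gamma>"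
    using subset_Zorn[of ?S] by auto
  have "E \<in> Domain \<Gamma>" if E: "E \<in> sets M" for E
  proof -
    obtain \<Gamma>' where \<Gamma>': "plift M \<Gamma>'" "\<Gamma> \<subseteq> \<Gamma>'" "E \<in> Domain \<Gamma>'"
      by (rule plift_step[OF finite_measure_axioms \<Gamma>(1) E])
    then show ?thesis using max[OF \<Gamma>'(1,2)] by simp
  qed
  then have "Domain \<Gamma> = sets M" using Domain_plift_subset[OF \<Gamma>(1)] by blast
  then show ?thesis using that \<Gamma> by blast
qed

section \<open>From total graphs to liftings of sets\<close>

lemma plift_AE_eq:
  assumes \<Gamma>: "plift M \<Gamma>" "(A, B) \<in> \<Gamma>" "(A', B') \<in> \<Gamma>" and eq: "AE x in M. x \<in> A \<longleftrightarrow> x \<in> A'"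
  shows "B = B'"
proof -
  have [measurable]: "A \<in> sets M" "A' \<in> sets M" using hom_graphD(1)[OF pliftD(1)[OF \<Gamma>(1)]] \<Gamma> by auto
  have "AE x in M. x \<notin> A - A'" "AE x in M. x \<notin> A' - A" using eq by (eventually_elim, auto)+
  then have "A - A' \<in> null_sets M" "A' - A \<in> null_sets M" by (simp_all add: AE_iff_null_sets)
  then show ?thesis using plift_null_diff[OF \<Gamma>] plift_null_diff[OF \<Gamma>(1,3,2)] by blast
qed

lemma plift_total_lifting:
  assumes \<Gamma>: "plift M \<Gamma>" and total: "Domain \<Gamma> = sets M"
  obtains \<sigma> where "\<sigma> \<in> Liftings M" "\<And>A B. (A, B) \<in> \<Gamma> \<Longrightarrow> \<sigma> A = B"
proof -
  note hom = pliftD(1)[OF \<Gamma>]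
  define \<sigma> where "\<sigma> A = (SOME B. (A, B) \<in> \<Gamma>)" for A
  have \<sigma>: "(A, \<sigma> A) \<in> \<Gamma>" if "A \<in> sets M" for A
    using that total unfolding \<sigma>_def by (metis DomainE someI_ex)
  have uniq: "\<sigma> A = B" if "(A, B) \<in> \<Gamma>" for A B
    using plift_AE_eq[OF \<Gamma> \<sigma> that] hom_graphD(1)[OF hom that] by simp
  have "\<sigma> \<in> Liftings M"
    unfolding Liftings_def lifting_def lower_density_def
  proof (intro CollectI conjI ballI impI)
    fix A assume A: "A \<in> sets M"
    show "\<sigma> A \<in> sets M" by (rule hom_graphD(2)[OF hom \<sigma>[OF A]])
    show "AE x in M. x \<in> \<sigma> A \<longleftrightarrow> x \<in> A" using pliftD(3)[OF \<Gamma> \<sigma>[OF A]] by eventually_elim simp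
    show "\<sigma> (space M - A) = space M - \<sigma> A" by (rule uniq[OF hom_graphD(5)[OF hom \<sigma>[OF A]]])
    fix B assume B: "B \<in> sets M"
    show "\<sigma> (A \<inter> B) = \<sigma> A \<inter> \<sigma> B" by (rule uniq[OF hom_graphD(4)[OF hom \<sigma>[OF A] \<sigma>[OF B]]])
    show "\<sigma> A = \<sigma> B" if "AE x in M. x \<in> A \<longleftrightarrow> x \<in> B" by (rule plift_AE_eq[OF \<Gamma> \<sigma>[OF A] \<sigma>[OF B] that])
  next
    show "\<sigma> {} = {}" by (rule uniq[OF hom_graphD(3)[OF hom]])
    show "\<sigma> (space M) = space M" by (rule uniq[OF hom_graph_space[OF hom]])
  qed
  then show ?thesis using that uniq by blast
qed

section \<open>Density points for a countable family of sets\<close>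

text \<open>The atom containing x of the algebra generated by \<open>g 0\<close>, ...,
  \<open>g (n - 1)\<close>; the strict bound on i makes stage 0 the trivial algebra.\<close>

definition atom :: "'a set \<Rightarrow> (nat \<Rightarrow> 'a set) \<Rightarrow> nat \<Rightarrow> 'a \<Rightarrow> 'a set" where
  "atom X g n x = {z \<in> X. \<forall>i<n. z \<in> g i \<longleftrightarrow> x \<in> g i}"

text \<open>Off a null set this is \<open>dens\<close> for the finite stages generated by g, with
  the ratios over atoms multiplied out. It involves no lifting, only measures of explicit sets under
  countable quantifiers, and so remains measurable when N depends on a parameter.\<close>

definition density_core :: "'a measure \<Rightarrow> (nat \<Rightarrow> 'a set) \<Rightarrow> 'a set \<Rightarrow> 'a set" where
  "density_core N g A = {x \<in> space N. (\<forall>n. 0 < measure N (atom (space N) g n x)) \<and>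
     (\<forall>k. \<exists>n. \<forall>m\<ge>n. (1 - 1 / Suc k) * measure N (atom (space N) g m x) \<le>
        measure N (A \<inter> atom (space N) g m x))}"

lemma atom_self: "x \<in> X \<Longrightarrow> x \<in> atom X g n x"
  unfolding atom_def by simp

lemma atom_eq: "z \<in> atom X g n x \<Longrightarrow> atom X g n z = atom X g n x"
  unfolding atom_def by auto

lemma atom_Suc_subset: "atom X g (Suc n) x \<subseteq> atom X g n x"
  unfolding atom_def by auto

lemma finite_atoms: "finite (range (atom X g n))"
proof -
  have "atom X g n x = (\<lambda>J. {z \<in> X. \<forall>i<n. z \<in> g i \<longleftrightarrow> i \<in> J}) {i. i < n \<and> x \<in> g i}" for x
    unfolding atom_def by auto
  then have "range (atom X g n) \<subseteq> (\<lambda>J. {z \<in> X. \<forall>i<n. z \<in> g i \<longleftrightarrow> i \<in> J}) ` Pow {..<n}" by blast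
  then show ?thesis by (rule finite_subset) simp
qed

lemma atom_sets:
  assumes "\<And>i. g i \<in> sets N" shows "atom (space N) g n x \<in> sets N"
proof -
  have "atom (space N) g n x = (\<Inter>i<n. if x \<in> g i then g i else space N - g i) \<inter> space N"
    unfolding atom_def by (auto split: if_splits)
  also have "\<dots> \<in> sets N"
  proof (cases "n = 0")
    case False
    then show ?thesis using assms by (intro sets.Int sets.top sets.finite_INT) auto
  qed simp
  finally show ?thesis .
qed

section \<open>Liftings on the finite stages of a sequence of sets\<close>

locale atom_filtration = prob_space N for N :: "'a measure" +
  fixes g :: "nat \<Rightarrow> 'a set"
  assumes g_sets [measurable]: "g i \<in> sets N"
begin

abbreviation "cell \<equiv> atom (space N) g"

lemma cell_sets [measurable]: "cell n x \<in> sets N"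
  by (rule atom_sets) (rule g_sets)

definition exceptional :: "'a set" where
  "exceptional = {x \<in> space N. \<exists>n. cell n x \<in> null_sets N}"

text \<open>Points in null atoms are treated like one fixed point outside all of them; this makes the
  liftings on the finite stages below compatible.\<close>

definition base_point :: "'a \<Rightarrow> 'a" where
  "base_point x = (if x \<in> exceptional then SOME z. z \<in> space N - exceptional else x)"

text \<open>The sigma-algebra generated by the atoms of stage n and the null sets of the completion.
  On null atoms the two alternatives hold together, which is why the lift below is read off at
  \<open>base_point\<close>.\<close>

definition stage :: "nat \<Rightarrow> 'a set set" where
  "stage n = {A \<in> sets (completion N). \<forall>x\<in>space N.
     cell n x - A \<in> null_sets (completion N) \<or> cell n x \<inter> A \<in> null_sets (completion N)}"

definition stage_lift :: "nat \<Rightarrow> 'a set \<Rightarrow> 'a set" where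
  "stage_lift n A = {x \<in> space N. cell n (base_point x) - A \<in> null_sets (completion N)}"

definition stage_graph :: "nat \<Rightarrow> ('a set \<times> 'a set) set" where
  "stage_graph n = {(A, stage_lift n A) | A. A \<in> stage n}"

lemma exceptional_null: "exceptional \<in> null_sets N"
proof -
  have "exceptional = (\<Union>n. \<Union>(range (cell n) \<inter> null_sets N))"
  proof (intro equalityI subsetI)
    fix x assume "x \<in> exceptional"
    then show "x \<in> (\<Union>n. \<Union>(range (cell n) \<inter> null_sets N))"
      using atom_self[of x "space N" g] unfolding exceptional_def by blast
  next
    fix x assume "x \<in> (\<Union>n. \<Union>(range (cell n) \<inter> null_sets N))"
    then obtain n z where nz: "x \<in> cell n z" "cell n z \<in> null_sets N" by blast
    then have "cell n x \<in> null_sets N" using atom_eq[OF nz(1)] by simp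
    moreover have "x \<in> space N" using nz(1) unfolding atom_def by blast
    ultimately show "x \<in> exceptional" unfolding exceptional_def by blast
  qed
  also have "\<dots> \<in> null_sets N"
  proof (rule null_sets_UN)
    fix n
    have "finite (range (cell n) \<inter> null_sets N)" using finite_atoms[of "space N" g n] by blast
    then have "(\<Union>a\<in>range (cell n) \<inter> null_sets N. a) \<in> null_sets N"
      by (intro null_sets_UN' countable_finite) auto
    then show "\<Union>(range (cell n) \<inter> null_sets N) \<in> null_sets N" by simp
  qed
  finally show ?thesis .
qed

lemma base_point:
  assumes "x \<in> space N" shows "base_point x \<in> space N - exceptional"
proof -
  have "AE x in N. x \<in> space N - exceptional"
    using AE_not_in[OF exceptional_null] AE_space by eventually_elim simp
  then have "\<exists>z. z \<in> space N - exceptional"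
    using AE_False not_AE_zero_E by (metis (mono_tags, lifting) eventually_mono AE_E_prob)
  then have "(SOME z. z \<in> space N - exceptional) \<in> space N - exceptional" by (rule someI_ex)
  then show ?thesis unfolding base_point_def using assms by simp
qed

lemma cell_not_null: "x \<in> space N - exceptional \<Longrightarrow> cell n x \<notin> null_sets (completion N)"
  unfolding exceptional_def by (auto simp: null_sets_completion_iff)

lemma cell_not_both:
  assumes "x \<in> space N - exceptional" "cell n x - A \<in> null_sets (completion N)"
  shows "cell n x \<inter> A \<notin> null_sets (completion N)"
proof
  assume "cell n x \<inter> A \<in> null_sets (completion N)"
  then have "(cell n x - A) \<union> (cell n x \<inter> A) \<in> null_sets (completion N)" using assms(2) by blast
  then show False using cell_not_null[OF assms(1), of n] by (simp add: Un_Diff_Int)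
qed

lemma AE_stage_lift:
  assumes A: "A \<in> stage n" shows "AE x in completion N. x \<in> A \<longleftrightarrow> x \<in> stage_lift n A"
proof -
  let ?P = "\<lambda>a x. (a - A \<in> null_sets (completion N) \<longrightarrow> x \<notin> a - A) \<and>
      (a \<inter> A \<in> null_sets (completion N) \<longrightarrow> x \<notin> a \<inter> A)"
  have "AE x in completion N. ?P a x" for a
  proof -
    have "AE x in completion N. a - A \<in> null_sets (completion N) \<longrightarrow> x \<notin> a - A"
      by (cases "a - A \<in> null_sets (completion N)") (auto dest: AE_not_in)
    moreover have "AE x in completion N. a \<inter> A \<in> null_sets (completion N) \<longrightarrow> x \<notin> a \<inter> A"
      by (cases "a \<inter> A \<in> null_sets (completion N)") (auto dest: AE_not_in)
    ultimately show ?thesis by eventually_elim blast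
  qed
  then have *: "AE x in completion N. \<forall>a\<in>range (cell n). ?P a x"
    by (intro AE_finite_allI finite_atoms)
  have exc: "AE x in completion N. x \<notin> exceptional"
    using exceptional_null by (intro AE_not_in null_sets_completionI)
  show ?thesis
    using * exc AE_space
  proof eventually_elim
    case (elim x)
    have x: "x \<in> space N" "base_point x = x" using elim(2,3) unfolding base_point_def by auto
    have P: "?P (cell n x) x" using elim(1) by blast
    have "cell n x - A \<in> null_sets (completion N) \<or> cell n x \<inter> A \<in> null_sets (completion N)"
      using A x(1) unfolding stage_def by blast
    then show ?case
      using P atom_self[OF x(1), of g n] x cell_not_both[of x n A] elim(2) unfolding stage_lift_def by auto
  qed
qed

lemma stage_Int:
  assumes A: "A \<in> stage n" and B: "B \<in> stage n"
  shows "A \<inter> B \<in> stage n"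
  unfolding stage_def
proof (intro CollectI conjI ballI)
  show "A \<inter> B \<in> sets (completion N)" using A B unfolding stage_def by blast
  fix x assume x: "x \<in> space N"
  have "cell n x - A \<in> null_sets (completion N) \<or> cell n x \<inter> A \<in> null_sets (completion N)"
    "cell n x - B \<in> null_sets (completion N) \<or> cell n x \<inter> B \<in> null_sets (completion N)"
    using A B x unfolding stage_def by blast+
  then show "cell n x - A \<inter> B \<in> null_sets (completion N) \<or> cell n x \<inter> (A \<inter> B) \<in> null_sets (completion N)"
    unfolding Diff_Int
    using completion.complete2[of "cell n x \<inter> (A \<inter> B)" "cell n x \<inter> A"]
      completion.complete2[of "cell n x \<inter> (A \<inter> B)" "cell n x \<inter> B"] by blast
qed

lemma stage_lift_Int: "stage_lift n (A \<inter> B) = stage_lift n A \<inter> stage_lift n B"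
proof -
  have "cell n x - A \<inter> B \<in> null_sets (completion N) \<longleftrightarrow>
      cell n x - A \<in> null_sets (completion N) \<and> cell n x - B \<in> null_sets (completion N)" for x
    using completion.complete2[of "cell n x - A" "cell n x - A \<inter> B"]
      completion.complete2[of "cell n x - B" "cell n x - A \<inter> B"] null_sets.Un[of "cell n x - A" "completion N" "cell n x - B"]
    by (auto simp: Diff_Int)
  then show ?thesis unfolding stage_lift_def by blast
qed

lemma cell_Diff_compl: "cell n x - (space N - A) = cell n x \<inter> A"
  unfolding atom_def by blast

lemma cell_Int_compl: "cell n x \<inter> (space N - A) = cell n x - A"
  unfolding atom_def by blast

lemma stage_compl: "A \<in> stage n \<Longrightarrow> space N - A \<in> stage n"
  unfolding stage_def
  using cell_Diff_compl cell_Int_compl sets.compl_sets[of A "completion N"] by auto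

lemma stage_lift_compl:
  assumes A: "A \<in> stage n" shows "stage_lift n (space N - A) = space N - stage_lift n A"
proof -
  have "cell n z \<inter> A \<in> null_sets (completion N) \<longleftrightarrow> cell n z - A \<notin> null_sets (completion N)"
    if "z \<in> space N - exceptional" for z
    using cell_not_both[OF that] A that unfolding stage_def by blast
  then show ?thesis using base_point unfolding stage_lift_def cell_Diff_compl by blast
qed

lemma stage_lift_null:
  assumes "A \<in> null_sets (completion N)" shows "A \<in> stage n" "stage_lift n A = {}"
proof -
  have *: "cell n x \<inter> A \<in> null_sets (completion N)" for x
    by (rule completion.complete2[OF _ assms]) blast
  then show "A \<in> stage n" using assms unfolding stage_def by blast
  show "stage_lift n A = {}" using * cell_not_both base_point unfolding stage_lift_def by blast
qed

lemma plift_stage: "plift (completion N) (stage_graph n)"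
  unfolding plift_def hom_graph_def
proof (intro conjI allI impI ballI)
  have "stage_lift n A \<in> sets (completion N)" if "A \<in> stage n" for A
    using completion.in_sets_AE[OF AE_stage_lift[OF that]] that unfolding stage_def stage_lift_def by auto
  then show "stage_graph n \<subseteq> sets (completion N) \<times> sets (completion N)"
    unfolding stage_graph_def by (auto simp: stage_def)
  show null: "(A, {}) \<in> stage_graph n" if "A \<in> null_sets (completion N)" for A
    using stage_lift_null[OF that, of n] unfolding stage_graph_def by auto
  show "({}, {}) \<in> stage_graph n" by (rule null) simp
  show "(A \<inter> A', B \<inter> B') \<in> stage_graph n" if "(A, B) \<in> stage_graph n" "(A', B') \<in> stage_graph n"
    for A B A' B'
    using that stage_Int[of A n A'] stage_lift_Int[of n A A'] unfolding stage_graph_def by auto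
  show "(space (completion N) - A, space (completion N) - B) \<in> stage_graph n"
    if "(A, B) \<in> stage_graph n" for A B
    using that stage_compl[of A n] stage_lift_compl[of A n] unfolding stage_graph_def by auto
  show "B \<in> {{}}" if "(A, B) \<in> stage_graph n" "A \<in> null_sets (completion N)" for A B
    using that stage_lift_null(2) unfolding stage_graph_def by auto
  show "AE x in completion N. x \<in> A \<longleftrightarrow> x \<in> B" if "(A, B) \<in> stage_graph n" for A B
    using that AE_stage_lift[of A n] unfolding stage_graph_def by auto
  fix A :: "nat \<Rightarrow> 'a set" assume "range A \<subseteq> Domain (stage_graph n)"
  then have A: "A i \<in> stage n" for i unfolding stage_graph_def by blast
  have "(\<Union>i. A i) \<in> stage n"
    unfolding stage_def
  proof (intro CollectI conjI ballI)
    show "(\<Union>i. A i) \<in> sets (completion N)" using A unfolding stage_def by blast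
    fix x assume x: "x \<in> space N"
    show "cell n x - (\<Union>i. A i) \<in> null_sets (completion N) \<or> cell n x \<inter> (\<Union>i. A i) \<in> null_sets (completion N)"
    proof (cases "\<exists>i. cell n x - A i \<in> null_sets (completion N)")
      case True
      then obtain i where "cell n x - A i \<in> null_sets (completion N)" by blast
      then have "cell n x - (\<Union>i. A i) \<in> null_sets (completion N)"
        by (rule completion.complete2[rotated]) blast
      then show ?thesis ..
    next
      case False
      then have "cell n x \<inter> A i \<in> null_sets (completion N)" for i
        using A[of i] x unfolding stage_def by blast
      then have "(\<Union>i. cell n x \<inter> A i) \<in> null_sets (completion N)" by blast
      then show ?thesis by simp
    qed
  qed
  then show "(\<Union>i. A i) \<in> Domain (stage_graph n)" unfolding stage_graph_def by blast
qed

text \<open>The base point is the same at every stage and none of its atoms is null, so passing to a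
  smaller atom cannot reverse the decision whether A essentially contains it.\<close>

lemma stage_graph_incr: "stage_graph n \<subseteq> stage_graph (Suc n)"
proof -
  have "A \<in> stage (Suc n) \<and> stage_lift (Suc n) A = stage_lift n A" if A: "A \<in> stage n" for A
  proof
    have *: "cell n x - A \<in> null_sets (completion N) \<longrightarrow> cell (Suc n) x - A \<in> null_sets (completion N)"
      "cell n x \<inter> A \<in> null_sets (completion N) \<longrightarrow> cell (Suc n) x \<inter> A \<in> null_sets (completion N)" for x
      using atom_Suc_subset[of "space N" g n x]
        completion.complete2[of "cell (Suc n) x - A" "cell n x - A" N]
        completion.complete2[of "cell (Suc n) x \<inter> A" "cell n x \<inter> A" N] by auto
    then show "A \<in> stage (Suc n)" using A unfolding stage_def by blast
    have "cell (Suc n) z - A \<in> null_sets (completion N) \<longleftrightarrow> cell n z - A \<in> null_sets (completion N)"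
      if "z \<in> space N - exceptional" for z
      using * cell_not_both[OF that, of "Suc n" A] A that unfolding stage_def by blast
    then show "stage_lift (Suc n) A = stage_lift n A" using base_point unfolding stage_lift_def by blast
  qed
  then show ?thesis unfolding stage_graph_def by auto
qed

sublocale F: lifting_filtration "completion N" stage_graph
  by (intro lifting_filtration.intro prob_space_completion completion.complete_measure_axioms
      lifting_filtration_axioms.intro plift_stage stage_graph_incr)

lemma cell_stage: "cell n x \<in> stage n"
  unfolding stage_def
proof (intro CollectI conjI ballI)
  show "cell n x \<in> sets (completion N)" by simp
  fix z
  have "cell n z - cell n x = {} \<or> cell n z \<inter> cell n x = {}"
    unfolding atom_def by auto
  moreover have "{} \<in> null_sets (completion N)" by simp
  ultimately show "cell n z - cell n x \<in> null_sets (completion N) \<or> cell n z \<inter> cell n x \<in> null_sets (completion N)"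
    by metis
qed

text \<open>A set of stage m inside the atom of x is null or essentially the whole atom, so
  \<open>dense_on\<close> for that atom reduces to the single inequality in
  \<open>density_core\<close>.\<close>

lemma density_core_subset:
  assumes A: "A \<in> sets N" shows "density_core N g A \<subseteq> F.dens A"
proof
  fix x assume x: "x \<in> density_core N g A"
  then have sp: "x \<in> space N" and pos: "\<And>n. 0 < measure N (cell n x)" unfolding density_core_def by auto
  have "x \<notin> exceptional"
    unfolding exceptional_def using pos by (auto dest!: measure_eq_0_null_sets) (metis less_irrefl)
  then have bp: "base_point x = x" unfolding base_point_def by simp
  have "\<exists>n. \<forall>m\<ge>n. \<exists>D B. (D, B) \<in> stage_graph m \<and> x \<in> B \<and> F.dense_on m c A D" if c: "c < 1" for c
  proof -
    obtain k where k: "1 / Suc k < 1 - c" using nat_approx_posE[of "1 - c"] c by auto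
    obtain n where n: "\<And>m. m \<ge> n \<Longrightarrow> (1 - 1 / Suc k) * measure N (cell m x) \<le> measure N (A \<inter> cell m x)"
      using x unfolding density_core_def by blast
    have "F.dense_on m c A (cell m x)" if m: "m \<ge> n" for m
      unfolding F.dense_on_def
    proof (intro ballI impI)
      fix D assume D: "D \<in> Domain (stage_graph m)" "D \<subseteq> cell m x"
      have meas: "D \<in> sets (completion N)" using D(1) unfolding stage_graph_def stage_def by blast
      have "cell m x - D \<in> null_sets (completion N) \<or> cell m x \<inter> D \<in> null_sets (completion N)"
        using D(1) sp unfolding stage_graph_def stage_def by blast
      then show "c * measure (completion N) D \<le> measure (completion N) (A \<inter> D)"
      proof
        assume null: "cell m x - D \<in> null_sets (completion N)"
        have "measure (completion N) D = measure (completion N) (cell m x)"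
          using null meas D(2) by (intro measure_eq_AE) (auto dest!: AE_not_in elim!: eventually_mono)
        moreover have "measure (completion N) (A \<inter> D) = measure (completion N) (A \<inter> cell m x)"
          using null meas D(2) A by (intro measure_eq_AE) (auto dest!: AE_not_in elim!: eventually_mono)
        moreover have "c * measure N (cell m x) \<le> (1 - 1 / Suc k) * measure N (cell m x)"
          using k by (intro mult_right_mono) auto
        ultimately show ?thesis using n[OF m] A by simp
      next
        assume "cell m x \<inter> D \<in> null_sets (completion N)"
        then have "D \<in> null_sets (completion N)" using D(2) by (simp add: Int_absorb1)
        then show ?thesis by (simp add: measure_eq_0_null_sets)
      qed
    qed
    moreover have "(cell m x, stage_lift m (cell m x)) \<in> stage_graph m" "x \<in> stage_lift m (cell m x)" for m
      using cell_stage sp bp unfolding stage_graph_def stage_lift_def by auto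
    ultimately show ?thesis by blast
  qed
  then show "x \<in> F.dens A" unfolding F.dens_def using sp by simp
qed

text \<open>A set D of stage m whose lift contains x contains essentially the whole atom of x, so
  density on D passes to that atom. Points of \<open>exceptional\<close> are removed because
  \<open>density_core\<close> demands atoms of positive measure.\<close>

lemma dens_subset_density_core:
  assumes A: "A \<in> sets N" shows "F.dens A - exceptional \<subseteq> density_core N g A"
proof
  fix x assume x: "x \<in> F.dens A - exceptional"
  then have sp: "x \<in> space N - exceptional" using F.dens_subset_space by auto
  then have bp: "base_point x = x" unfolding base_point_def by simp
  have "0 < measure N (cell n x)" for n
    using sp unfolding exceptional_def by (auto simp: zero_less_measure_iff null_sets_def emeasure_eq_measure)
  moreover have "\<exists>n. \<forall>m\<ge>n. (1 - 1 / Suc k) * measure N (cell m x) \<le> measure N (A \<inter> cell m x)" for k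
  proof -
    define c :: real where "c = 1 - 1 / Suc k"
    have "c < 1" unfolding c_def by simp
    then obtain n where n: "\<And>m. m \<ge> n \<Longrightarrow> \<exists>D B. (D, B) \<in> stage_graph m \<and> x \<in> B \<and> F.dense_on m c A D"
      using x unfolding F.dens_def by blast
    have "c * measure N (cell m x) \<le> measure N (A \<inter> cell m x)" if m: "m \<ge> n" for m
    proof -
      obtain D where D: "D \<in> stage m" "x \<in> stage_lift m D" "F.dense_on m c A D"
        using n[OF m] unfolding stage_graph_def by blast
      have null: "cell m x - D \<in> null_sets (completion N)" using D(2) bp unfolding stage_lift_def by simp
      have meas: "D \<in> sets (completion N)" using D(1) unfolding stage_def by blast
      have dom: "D \<inter> cell m x \<in> Domain (stage_graph m)"
        using stage_Int[OF D(1) cell_stage] unfolding stage_graph_def by blast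
      have "c * measure (completion N) (D \<inter> cell m x) \<le> measure (completion N) (A \<inter> (D \<inter> cell m x))"
        using D(3)[unfolded F.dense_on_def, rule_format, OF dom Int_lower1] .
      also have "\<dots> \<le> measure (completion N) (A \<inter> cell m x)"
        using A meas by (intro F.finite_measure_mono) auto
      also have "measure (completion N) (D \<inter> cell m x) = measure (completion N) (cell m x)"
        using null meas by (intro measure_eq_AE) (auto dest!: AE_not_in elim!: eventually_mono)
      finally show ?thesis using A by simp
    qed
    then show ?thesis unfolding c_def by blast
  qed
  ultimately show "x \<in> density_core N g A" unfolding density_core_def using sp by blast
qed

lemma approx_by_limit_sets: "approx_by N (range g) \<subseteq> F.limit_sets"
proof
  fix E assume E: "E \<in> approx_by N (range g)"
  \<comment> \<open>\<open>Suc i\<close>, because the atoms of stage n consult only indices below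
    n.\<close>
  have "g i \<in> stage (Suc i)" for i
  proof -
    have "cell (Suc i) x - g i \<in> null_sets (completion N) \<or>
        cell (Suc i) x \<inter> g i \<in> null_sets (completion N)" for x
    proof -
      have "cell (Suc i) x - g i = {} \<or> cell (Suc i) x \<inter> g i = {}" unfolding atom_def by blast
      moreover have "{} \<in> null_sets (completion N)" by simp
      ultimately show ?thesis by metis
    qed
    then show ?thesis unfolding stage_def by simp
  qed
  then have gD: "range g \<subseteq> (\<Union>n. Domain (stage_graph n))" unfolding stage_graph_def by blast
  have E': "E \<in> sets N" using E unfolding approx_by_def by blast
  show "E \<in> F.limit_sets"
    unfolding F.limit_sets_def approx_by_def
  proof (intro CollectI conjI allI impI)
    show "E \<in> sets (completion N)" using E' by simp
    fix e :: real assume "e > 0"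
    then obtain C where C: "C \<in> range g" "measure N (sym_diff E C) < e" by (rule approx_byE[OF E])
    have "C \<in> sets N" using C(1) by auto
    then have "measure (completion N) (sym_diff E C) < e" using C(2) E' by simp
    then show "\<exists>C\<in>\<Union>n. Domain (stage_graph n). measure (completion N) (sym_diff E C) < e"
      using C(1) gD by blast
  qed
qed

text \<open>The limit step puts \<open>dens\<close> inside the values on \<open>limit_sets\<close>,
  and total extension preserves these values. Extending from the limit, not from an arbitrary
  partial lifting, is what secures the density points.\<close>

theorem lifting_density_core:
  obtains \<sigma> where "\<sigma> \<in> Liftings (completion N)"
    "\<And>A. A \<in> approx_by N (range g) \<Longrightarrow> density_core N g A \<subseteq> \<sigma> A"
proof -
  obtain \<Gamma> where \<Gamma>: "plift (completion N) \<Gamma>" "Domain \<Gamma> = F.limit_sets" "\<And>E B. (E, B) \<in> \<Gamma> \<Longrightarrow> F.dens E \<subseteq> B"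
    using F.plift_limit by blast
  obtain \<Gamma>' where \<Gamma>': "plift (completion N) \<Gamma>'" "\<Gamma> \<subseteq> \<Gamma>'" "Domain \<Gamma>' = sets (completion N)"
    by (rule plift_extend[OF prob_space_completion completion.complete_measure_axioms \<Gamma>(1)])
  obtain \<sigma> where \<sigma>: "\<sigma> \<in> Liftings (completion N)" "\<And>A B. (A, B) \<in> \<Gamma>' \<Longrightarrow> \<sigma> A = B"
    by (rule plift_total_lifting[OF \<Gamma>'(1,3)]) blast
  have "density_core N g A \<subseteq> \<sigma> A" if A: "A \<in> approx_by N (range g)" for A
  proof -
    have "A \<in> sets N" using A unfolding approx_by_def by blast
    have "A \<in> Domain \<Gamma>" using A approx_by_limit_sets \<Gamma>(2) by blast
    then obtain B where B: "(A, B) \<in> \<Gamma>" by blast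
    have "\<sigma> A = B" using \<sigma>(2) B \<Gamma>'(2) by blast
    then show ?thesis using \<Gamma>(3)[OF B] density_core_subset[OF \<open>A \<in> sets N\<close>] by blast
  qed
  with \<sigma>(1) that show ?thesis by blast
qed

lemma AE_density_core:
  assumes A: "A \<in> approx_by N (range g)"
  shows "AE x in N. x \<in> A \<longrightarrow> x \<in> density_core N g A"
proof -
  have "A \<in> sets N" using A unfolding approx_by_def by blast
  note sub = dens_subset_density_core[OF this]
  have "AE x in N. x \<in> A \<longrightarrow> x \<in> F.dens A"
    using F.AE_dens[of A] A approx_by_limit_sets unfolding AE_completion_iff by blast
  then show ?thesis using AE_not_in[OF exceptional_null] by eventually_elim (use sub in blast)
qed

end

section \<open>Liftings of bounded functions\<close>

lemma LiftingsD:
  assumes "\<delta> \<in> Liftings M"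
  shows "A \<in> sets M \<Longrightarrow> \<delta> A \<in> sets M"
    "A \<in> sets M \<Longrightarrow> AE x in M. x \<in> \<delta> A \<longleftrightarrow> x \<in> A"
    "A \<in> sets M \<Longrightarrow> B \<in> sets M \<Longrightarrow> AE x in M. x \<in> A \<longleftrightarrow> x \<in> B \<Longrightarrow> \<delta> A = \<delta> B"
    "\<delta> {} = {}" "\<delta> (space M) = space M"
    "A \<in> sets M \<Longrightarrow> B \<in> sets M \<Longrightarrow> \<delta> (A \<inter> B) = \<delta> A \<inter> \<delta> B"
    "A \<in> sets M \<Longrightarrow> \<delta> (space M - A) = space M - \<delta> A"
proof -
  have *: "lower_density M \<delta>" "\<forall>A\<in>sets M. \<delta> (space M - A) = space M - \<delta> A"
    using assms unfolding Liftings_def lifting_def by blast+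
  note ** = *(1)[unfolded lower_density_def]
  show "A \<in> sets M \<Longrightarrow> \<delta> A \<in> sets M"
    "A \<in> sets M \<Longrightarrow> AE x in M. x \<in> \<delta> A \<longleftrightarrow> x \<in> A" using **[THEN conjunct1] by blast+
  show "A \<in> sets M \<Longrightarrow> B \<in> sets M \<Longrightarrow> AE x in M. x \<in> A \<longleftrightarrow> x \<in> B \<Longrightarrow> \<delta> A = \<delta> B"
    by (rule **[THEN conjunct2, THEN conjunct1, rule_format])
  show "\<delta> {} = {}" "\<delta> (space M) = space M" using **[THEN conjunct2, THEN conjunct2] by blast+
  show "A \<in> sets M \<Longrightarrow> B \<in> sets M \<Longrightarrow> \<delta> (A \<inter> B) = \<delta> A \<inter> \<delta> B"
    using **[THEN conjunct2, THEN conjunct2] by blast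
  show "A \<in> sets M \<Longrightarrow> \<delta> (space M - A) = space M - \<delta> A" using *(2) by blast
qed

lemma Liftings_mono:
  assumes "\<delta> \<in> Liftings M" "A \<in> sets M" "B \<in> sets M" "A \<subseteq> B" shows "\<delta> A \<subseteq> \<delta> B"
  using LiftingsD(6)[OF assms(1-3)] assms(4) by (metis Int_absorb2 Int_lower2)

lemma Liftings_idem:
  assumes "\<delta> \<in> Liftings M" "A \<in> sets M" shows "\<delta> (\<delta> A) = \<delta> A"
  by (rule LiftingsD(3)[OF assms(1) LiftingsD(1)[OF assms] assms(2) LiftingsD(2)[OF assms]])

text \<open>For x in the space, \<open>x \<in> \<delta> E\<close> defines an ultrafilter among the
  measurable sets, and the induced lifting of a bounded function is its limit along the generated
  filter.\<close>

definition lift_filter :: "'a measure \<Rightarrow> ('a set \<Rightarrow> 'a set) \<Rightarrow> 'a \<Rightarrow> 'a filter" where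
  "lift_filter M \<delta> x = Abs_filter (\<lambda>P. \<exists>E\<in>sets M. x \<in> \<delta> E \<and> (\<forall>z\<in>E. P z))"

definition lifted :: "'a measure \<Rightarrow> ('a set \<Rightarrow> 'a set) \<Rightarrow> ('a \<Rightarrow> real) \<Rightarrow> 'a \<Rightarrow> real" where
  "lifted M \<delta> f x = Lim (lift_filter M \<delta> x) f"

context
  fixes M :: "'a measure" and \<delta> :: "'a set \<Rightarrow> 'a set"
  assumes \<delta>: "\<delta> \<in> Liftings M"
begin

lemma eventually_lift_filter:
  assumes x: "x \<in> space M"
  shows "eventually P (lift_filter M \<delta> x) \<longleftrightarrow> (\<exists>E\<in>sets M. x \<in> \<delta> E \<and> (\<forall>z\<in>E. P z))"
  unfolding lift_filter_def
proof (rule eventually_Abs_filter, rule is_filter.intro)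
  show "\<exists>E\<in>sets M. x \<in> \<delta> E \<and> (\<forall>z\<in>E. True)" using LiftingsD(5)[OF \<delta>] x by auto
  show "\<exists>E\<in>sets M. x \<in> \<delta> E \<and> (\<forall>z\<in>E. P z \<and> Q z)"
    if P: "\<exists>E\<in>sets M. x \<in> \<delta> E \<and> (\<forall>z\<in>E. P z)" and Q: "\<exists>E\<in>sets M. x \<in> \<delta> E \<and> (\<forall>z\<in>E. Q z)" for P Q
  proof -
    obtain E F where EF: "E \<in> sets M" "x \<in> \<delta> E" "\<forall>z\<in>E. P z" "F \<in> sets M" "x \<in> \<delta> F" "\<forall>z\<in>F. Q z"
      using P Q by blast
    then show ?thesis using LiftingsD(6)[OF \<delta> EF(1,4)] by (intro bexI[of _ "E \<inter> F"]) auto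
  qed
qed blast

text \<open>A lifting sends sets of full measure to the whole space, so almost sure statements hold
  along the filter at every point, without exceptional x.\<close>

lemma eventually_lift_filter_AE:
  assumes x: "x \<in> space M" and AE: "AE z in M. P z"
  shows "eventually P (lift_filter M \<delta> x)"
proof -
  obtain N where N: "{z \<in> space M. \<not> P z} \<subseteq> N" "N \<in> sets M" "emeasure M N = 0" by (rule AE_E[OF AE])
  have "AE z in M. z \<in> space M - N \<longleftrightarrow> z \<in> space M"
    using AE_not_in[of N M] N by (auto simp: null_sets_def elim: eventually_mono)
  then have "\<delta> (space M - N) = space M"
    using LiftingsD(3)[OF \<delta>, of "space M - N" "space M"] LiftingsD(5)[OF \<delta>] N by auto
  then show ?thesis unfolding eventually_lift_filter[OF x] using N x by (intro bexI[of _ "space M - N"]) auto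
qed

lemma eventually_lift_filter_space: "x \<in> space M \<Longrightarrow> \<forall>\<^sub>F z in lift_filter M \<delta> x. z \<in> space M"
  by (rule eventually_lift_filter_AE) auto

lemma lift_filter_not_bot: "x \<in> space M \<Longrightarrow> lift_filter M \<delta> x \<noteq> bot"
  unfolding trivial_limit_def eventually_lift_filter using LiftingsD(4)[OF \<delta>] by (metis all_not_in_conv)

lemma eventually_lift_filter_iff:
  assumes x: "x \<in> space M" and P: "{z \<in> space M. P z} \<in> sets M"
  shows "eventually P (lift_filter M \<delta> x) \<longleftrightarrow> x \<in> \<delta> {z \<in> space M. P z}"
proof
  assume "eventually P (lift_filter M \<delta> x)"
  then obtain E where E: "E \<in> sets M" "x \<in> \<delta> E" "\<forall>z\<in>E. P z" unfolding eventually_lift_filter[OF x] by blast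
  have "E \<subseteq> {z \<in> space M. P z}" using E sets.sets_into_space by blast
  then show "x \<in> \<delta> {z \<in> space M. P z}" using Liftings_mono[OF \<delta> E(1) P] E(2) by blast
next
  assume "x \<in> \<delta> {z \<in> space M. P z}"
  then show "eventually P (lift_filter M \<delta> x)" unfolding eventually_lift_filter[OF x] using P by blast
qed

text \<open>Compactness of \<open>{-B..B}\<close> provides a cluster point. Since
  \<open>\<delta>\<close> commutes with complements, a measurable event that does not hold
  eventually fails eventually, and this turns the cluster point into the limit.\<close>

lemma tendsto_lifted:
  assumes f: "f \<in> Linf M" and x: "x \<in> space M"
  shows "(f \<longlongrightarrow> lifted M \<delta> f x) (lift_filter M \<delta> x)"
proof -
  let ?F = "lift_filter M \<delta> x"
  have [measurable]: "f \<in> borel_measurable M" using f unfolding Linf_def by blast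
  obtain B where B: "\<And>z. z \<in> space M \<Longrightarrow> \<bar>f z\<bar> \<le> B"
    using f unfolding Linf_def bounded_real by auto
  have "\<forall>\<^sub>F z in ?F. f z \<in> {-B..B}"
    using eventually_lift_filter_space[OF x] by eventually_elim (use B in force)
  then have "\<forall>\<^sub>F t in filtermap f ?F. t \<in> {-B..B}" unfolding eventually_filtermap .
  moreover have "filtermap f ?F \<noteq> bot" using lift_filter_not_bot[OF x] by (simp add: filtermap_bot_iff)
  ultimately obtain t where t: "inf (nhds t) (filtermap f ?F) \<noteq> bot"
    using compact_filter[of "{-B..B}"] by auto
  have "(f \<longlongrightarrow> t) ?F"
  proof (rule topological_tendstoI)
    fix U :: "real set" assume U: "open U" "t \<in> U"
    then have [measurable]: "U \<in> sets borel" by simp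
    have U': "{z \<in> space M. f z \<in> U} \<in> sets M" by measurable
    show "\<forall>\<^sub>F z in ?F. f z \<in> U"
    proof (rule ccontr)
      assume "\<not> ?thesis"
      then have "x \<in> space M - \<delta> {z \<in> space M. f z \<in> U}" using eventually_lift_filter_iff[OF x U'] x by blast
      also have "\<dots> = \<delta> {z \<in> space M. f z \<notin> U}"
      proof -
        have "space M - {z \<in> space M. f z \<in> U} = {z \<in> space M. f z \<notin> U}" by blast
        then show ?thesis using LiftingsD(7)[OF \<delta> U'] by simp
      qed
      finally have "\<forall>\<^sub>F z in ?F. f z \<notin> U"
        by (subst eventually_lift_filter_iff[OF x]) measurable
      then have "\<forall>\<^sub>F s in filtermap f ?F. s \<notin> U" unfolding eventually_filtermap .
      moreover have "\<forall>\<^sub>F s in nhds t. s \<in> U" using U by (rule eventually_nhds_in_open)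
      ultimately have "\<forall>\<^sub>F s in inf (nhds t) (filtermap f ?F). False"
        unfolding eventually_inf by blast
      then show False using t by (simp add: trivial_limit_def)
    qed
  qed
  then show ?thesis unfolding lifted_def using tendsto_Lim[OF lift_filter_not_bot[OF x]] by metis
qed

lemma lifted_eqI:
  assumes "x \<in> space M" "(f \<longlongrightarrow> t) (lift_filter M \<delta> x)" shows "lifted M \<delta> f x = t"
  unfolding lifted_def using tendsto_Lim[OF lift_filter_not_bot] assms by blast

text \<open>An eventual bound passes to the limit only weakly; the rational q strictly above r
  restores strictness and keeps the later unions countable.\<close>

lemma lifted_greater_iff:
  assumes f: "f \<in> Linf M" and x: "x \<in> space M"
  shows "r < lifted M \<delta> f x \<longleftrightarrow> (\<exists>q\<in>\<rat>. r < q \<and> x \<in> \<delta> {z \<in> space M. q < f z})"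
proof -
  have [measurable]: "f \<in> borel_measurable M" using f unfolding Linf_def by blast
  have ev: "x \<in> \<delta> {z \<in> space M. q < f z} \<longleftrightarrow> (\<forall>\<^sub>F z in lift_filter M \<delta> x. q < f z)" for q
    by (subst eventually_lift_filter_iff[OF x]) auto
  note lim = tendsto_lifted[OF f x]
  show ?thesis
    unfolding ev
  proof
    assume "r < lifted M \<delta> f x"
    then obtain q where "q \<in> \<rat>" "r < q" "q < lifted M \<delta> f x" using Rats_dense_in_real by blast
    then show "\<exists>q\<in>\<rat>. r < q \<and> (\<forall>\<^sub>F z in lift_filter M \<delta> x. q < f z)" using order_tendstoD(1)[OF lim] by blast
  next
    assume "\<exists>q\<in>\<rat>. r < q \<and> (\<forall>\<^sub>F z in lift_filter M \<delta> x. q < f z)"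
    then obtain q where q: "r < q" "\<forall>\<^sub>F z in lift_filter M \<delta> x. q < f z" by blast
    have "q \<le> lifted M \<delta> f x"
      by (rule tendsto_lowerbound[OF lim _ lift_filter_not_bot[OF x]])
        (use q(2) in \<open>auto elim: eventually_mono\<close>)
    then show "r < lifted M \<delta> f x" using q(1) by simp
  qed
qed

lemma Linf_uminus: "f \<in> Linf M \<Longrightarrow> (\<lambda>x. - f x) \<in> Linf M"
  unfolding Linf_def bounded_real by auto

lemma lifted_uminus: "f \<in> Linf M \<Longrightarrow> x \<in> space M \<Longrightarrow> lifted M \<delta> (\<lambda>x. - f x) x = - lifted M \<delta> f x"
  by (intro lifted_eqI tendsto_minus tendsto_lifted)

lemma lifted_less_iff:
  assumes f: "f \<in> Linf M" and x: "x \<in> space M"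
  shows "lifted M \<delta> f x < r \<longleftrightarrow> (\<exists>q\<in>\<rat>. q < r \<and> x \<in> \<delta> {z \<in> space M. f z < q})"
proof -
  have "lifted M \<delta> f x < r \<longleftrightarrow> - r < lifted M \<delta> (\<lambda>x. - f x) x" using lifted_uminus[OF f x] by auto
  also have "\<dots> \<longleftrightarrow> (\<exists>q\<in>\<rat>. - r < q \<and> x \<in> \<delta> {z \<in> space M. q < - f z})"
    by (rule lifted_greater_iff[OF Linf_uminus[OF f] x])
  also have "\<dots> \<longleftrightarrow> (\<exists>q\<in>\<rat>. q < r \<and> x \<in> \<delta> {z \<in> space M. f z < q})"
  proof -
    have *: "{z \<in> space M. - q < - f z} = {z \<in> space M. f z < q}" for q by auto
    show ?thesis
    proof
      assume "\<exists>q\<in>\<rat>. - r < q \<and> x \<in> \<delta> {z \<in> space M. q < - f z}"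
      then obtain q where "q \<in> \<rat>" "- r < q" "x \<in> \<delta> {z \<in> space M. q < - f z}" by blast
      then show "\<exists>q\<in>\<rat>. q < r \<and> x \<in> \<delta> {z \<in> space M. f z < q}"
        using *[of "- q"] by (intro bexI[of _ "- q"]) auto
    next
      assume "\<exists>q\<in>\<rat>. q < r \<and> x \<in> \<delta> {z \<in> space M. f z < q}"
      then obtain q where "q \<in> \<rat>" "q < r" "x \<in> \<delta> {z \<in> space M. f z < q}" by blast
      then show "\<exists>q\<in>\<rat>. - r < q \<and> x \<in> \<delta> {z \<in> space M. q < - f z}"
        using *[of q] by (intro bexI[of _ "- q"]) auto
    qed
  qed
  finally show ?thesis .
qed

lemma lifted_bounds:
  assumes f: "f \<in> Linf M" and x: "x \<in> space M" and B: "\<And>z. z \<in> space M \<Longrightarrow> a \<le> f z \<and> f z \<le> b"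
  shows "a \<le> lifted M \<delta> f x" "lifted M \<delta> f x \<le> b"
proof -
  have "\<forall>\<^sub>F z in lift_filter M \<delta> x. a \<le> f z" "\<forall>\<^sub>F z in lift_filter M \<delta> x. f z \<le> b"
    using eventually_lift_filter_space[OF x] by (eventually_elim, use B in blast)+
  then show "a \<le> lifted M \<delta> f x" "lifted M \<delta> f x \<le> b"
    using tendsto_lowerbound[OF tendsto_lifted[OF f x]] tendsto_upperbound[OF tendsto_lifted[OF f x]]
      lift_filter_not_bot[OF x] by blast+
qed

lemma lifted_in_Linf:
  assumes f: "f \<in> Linf M" shows "lifted M \<delta> f \<in> Linf M"
proof -
  have [measurable]: "f \<in> borel_measurable M" using f unfolding Linf_def by blast
  have "lifted M \<delta> f \<in> borel_measurable M"
  proof (rule borel_measurable_iff_greater[THEN iffD2], intro allI)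
    fix r
    have "{x \<in> space M. r < lifted M \<delta> f x} =
        (\<Union>q\<in>{q\<in>\<rat>. r < q}. \<delta> {z \<in> space M. q < f z})"
    proof (intro equalityI subsetI)
      fix x assume "x \<in> {x \<in> space M. r < lifted M \<delta> f x}"
      then show "x \<in> (\<Union>q\<in>{q\<in>\<rat>. r < q}. \<delta> {z \<in> space M. q < f z})"
        using lifted_greater_iff[OF f, of x r] by auto
    next
      fix x assume "x \<in> (\<Union>q\<in>{q\<in>\<rat>. r < q}. \<delta> {z \<in> space M. q < f z})"
      then obtain q where q: "q \<in> \<rat>" "r < q" "x \<in> \<delta> {z \<in> space M. q < f z}" by blast
      have "\<delta> {z \<in> space M. q < f z} \<in> sets M" by (rule LiftingsD(1)[OF \<delta>]) measurable
      then have "x \<in> space M" using q(3) sets.sets_into_space by blast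
      then show "x \<in> {x \<in> space M. r < lifted M \<delta> f x}"
        using lifted_greater_iff[OF f, of x r] q by blast
    qed
    also have "\<dots> \<in> sets M"
      using countable_rat by (intro sets.countable_UN'' countable_Collect LiftingsD(1)[OF \<delta>]) auto
    finally show "{x \<in> space M. r < lifted M \<delta> f x} \<in> sets M" .
  qed
  moreover obtain B where B: "\<And>z. z \<in> space M \<Longrightarrow> \<bar>f z\<bar> \<le> B"
    using f unfolding Linf_def bounded_real by auto
  have "bounded (lifted M \<delta> f ` space M)"
    unfolding bounded_real
  proof (intro exI ballI)
    fix t assume "t \<in> lifted M \<delta> f ` space M"
    then obtain x where x: "x \<in> space M" "t = lifted M \<delta> f x" by blast
    show "\<bar>t\<bar> \<le> B" using lifted_bounds[OF f x(1), of "-B" B] B x(2) by (simp add: abs_le_iff) (metis minus_le_iff)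
  qed
  ultimately show ?thesis unfolding Linf_def by blast
qed

text \<open>Off one null set, x lies in each rational level set exactly when it lies in its lift; a
  difference between \<open>f x\<close> and the limit would show at some rational level.\<close>

lemma AE_lifted:
  assumes f: "f \<in> Linf M" shows "AE x in M. lifted M \<delta> f x = f x"
proof -
  have [measurable]: "f \<in> borel_measurable M" using f unfolding Linf_def by blast
  have "AE x in M. \<forall>q\<in>\<rat>. (x \<in> \<delta> {z \<in> space M. q < f z} \<longleftrightarrow> x \<in> {z \<in> space M. q < f z}) \<and>
      (x \<in> \<delta> {z \<in> space M. f z < q} \<longleftrightarrow> x \<in> {z \<in> space M. f z < q})"
    by (intro AE_ball_countable[THEN iffD2] countable_rat ballI AE_conjI LiftingsD(2)[OF \<delta>]) auto
  then show ?thesis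
    using AE_space
  proof eventually_elim
    case (elim x)
    have "\<not> lifted M \<delta> f x < f x"
    proof
      assume "lifted M \<delta> f x < f x"
      then obtain q where q: "q \<in> \<rat>" "lifted M \<delta> f x < q" "q < f x" using Rats_dense_in_real by blast
      then have "x \<in> \<delta> {z \<in> space M. q < f z}" using elim by blast
      moreover obtain r where "r \<in> \<rat>" "r < q" "x \<in> \<delta> {z \<in> space M. f z < r}"
        using lifted_less_iff[OF f elim(2)] q(2) by blast
      moreover have "x \<in> {z \<in> space M. f z < r}" using elim calculation by blast
      ultimately show False using q(3) by simp
    qed
    moreover have "\<not> f x < lifted M \<delta> f x"
    proof
      assume "f x < lifted M \<delta> f x"
      then obtain q where q: "q \<in> \<rat>" "f x < q" "x \<in> \<delta> {z \<in> space M. q < f z}"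
        using lifted_greater_iff[OF f elim(2)] by blast
      then have "x \<in> {z \<in> space M. q < f z}" using elim by blast
      then show False using q(2) by simp
    qed
    ultimately show ?case by linarith
  qed
qed

text \<open>Bounded measurable functions are continuous along the filters of the lifting at almost
  every point; this will carry information from nearby fibres to the fibre at y.\<close>

lemma AE_tendsto_lift_filter:
  assumes f: "f \<in> Linf M" shows "AE x in M. (f \<longlongrightarrow> f x) (lift_filter M \<delta> x)"
  using AE_lifted[OF f] AE_space by eventually_elim (use tendsto_lifted[OF f] in fastforce)

theorem induced_function_lifting_lifted: "induced_function_lifting M \<delta> (lifted M \<delta>)"
  unfolding induced_function_lifting_def function_lifting_def
proof (intro conjI ballI allI impI)
  show "lifted M \<delta> f \<in> Linf M" if "f \<in> Linf M" for f using lifted_in_Linf[OF that] .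
  show "AE x in M. lifted M \<delta> f x = f x" if "f \<in> Linf M" for f using AE_lifted[OF that] .
  show "lifted M \<delta> f x = lifted M \<delta> g x"
    if "f \<in> Linf M" "g \<in> Linf M" "AE x in M. f x = g x" "x \<in> space M" for f g x
  proof (rule lifted_eqI[OF that(4)])
    have "\<forall>\<^sub>F z in lift_filter M \<delta> x. g z = f z"
      using eventually_lift_filter_AE[OF that(4,3)] by eventually_elim simp
    then show "(f \<longlongrightarrow> lifted M \<delta> g x) (lift_filter M \<delta> x)"
      using tendsto_lifted[OF that(2,4)] by (simp cong: tendsto_cong)
  qed
  show "lifted M \<delta> (\<lambda>_. c) x = c" if "x \<in> space M" for c x
    using that by (intro lifted_eqI) auto
  show "0 \<le> lifted M \<delta> f x"
    if f: "f \<in> Linf M" and pos: "\<forall>x\<in>space M. 0 \<le> f x" and x: "x \<in> space M" for f x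
  proof -
    have "\<forall>\<^sub>F z in lift_filter M \<delta> x. 0 \<le> f z"
      using eventually_lift_filter_space[OF x] by eventually_elim (use pos in blast)
    then show ?thesis using tendsto_lowerbound[OF tendsto_lifted[OF f x]] lift_filter_not_bot[OF x] by blast
  qed
  show "lifted M \<delta> (\<lambda>z. a * f z + b * g z) x = a * lifted M \<delta> f x + b * lifted M \<delta> g x"
    if "f \<in> Linf M" "g \<in> Linf M" "x \<in> space M" for f g a b x
    using that by (intro lifted_eqI tendsto_intros tendsto_lifted)
  show "lifted M \<delta> (\<lambda>z. f z * g z) x = lifted M \<delta> f x * lifted M \<delta> g x"
    if "f \<in> Linf M" "g \<in> Linf M" "x \<in> space M" for f g x
    using that by (intro lifted_eqI tendsto_intros tendsto_lifted)
  show "lifted M \<delta> (indicat_real A) x = indicat_real (\<delta> A) x" if A: "A \<in> sets M" and x: "x \<in> space M" for A x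
  proof (rule lifted_eqI[OF x])
    show "(indicat_real A \<longlongrightarrow> indicat_real (\<delta> A) x) (lift_filter M \<delta> x)"
    proof (cases "x \<in> \<delta> A")
      case True
      then have "\<forall>\<^sub>F z in lift_filter M \<delta> x. indicat_real A z = 1"
        unfolding eventually_lift_filter[OF x] using A by (intro bexI[of _ A]) auto
      then show ?thesis using True by (simp add: tendsto_eventually)
    next
      case False
      then have "x \<in> \<delta> (space M - A)" using LiftingsD(7)[OF \<delta> A] x by blast
      then have "\<forall>\<^sub>F z in lift_filter M \<delta> x. indicat_real A z = 0"
        unfolding eventually_lift_filter[OF x] using A by (intro bexI[of _ "space M - A"]) auto
      then show ?thesis using False by (simp add: tendsto_eventually)
    qed
  qed
qed

end

section \<open>Disintegrations\<close>

primrec algebra_stage :: "'a set \<Rightarrow> 'a set set \<Rightarrow> nat \<Rightarrow> 'a set set" where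
  "algebra_stage X G 0 = insert {} G"
| "algebra_stage X G (Suc n) = algebra_stage X G n \<union> (\<lambda>C. X - C) ` algebra_stage X G n \<union>
     (\<lambda>(C, D). C \<union> D) ` (algebra_stage X G n \<times> algebra_stage X G n)"

text \<open>Closing a countable family in countably many rounds keeps it countable. An algebra is
  wanted for \<open>sigma_algebra_approx_by\<close>, and its enumeration supplies the finite stages
  for atoms.\<close>

lemma countable_algebra:
  assumes "countable G" "G \<subseteq> sets M"
  obtains g :: "nat \<Rightarrow> 'a set" where "range g \<subseteq> sets M" "G \<subseteq> range g" "{} \<in> range g"
    "\<And>C. C \<in> range g \<Longrightarrow> space M - C \<in> range g"
    "\<And>C D. C \<in> range g \<Longrightarrow> D \<in> range g \<Longrightarrow> C \<union> D \<in> range g"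
proof -
  let ?A = "algebra_stage (space M) G"
  define \<A> where "\<A> = (\<Union>n. ?A n)"
  have count: "countable (?A n)" for n
    by (induction n) (use assms(1) in auto)
  have sets: "?A n \<subseteq> sets M" for n
    by (induction n) (use assms(2) in auto)
  have mono: "?A n \<subseteq> ?A m" if "n \<le> m" for n m
    using that by (rule lift_Suc_mono_le[rotated]) auto
  have "countable \<A>" unfolding \<A>_def using count by auto
  moreover have ne: "{} \<in> \<A>" unfolding \<A>_def by (auto intro!: exI[of _ 0])
  ultimately have range: "range (from_nat_into \<A>) = \<A>" by (intro range_from_nat_into) auto
  have "space M - C \<in> \<A>" if C: "C \<in> \<A>" for C
  proof -
    obtain n where "C \<in> ?A n" using C unfolding \<A>_def by blast
    then have "space M - C \<in> ?A (Suc n)" by auto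
    then show ?thesis unfolding \<A>_def by blast
  qed
  moreover have "C \<union> D \<in> \<A>" if CD: "C \<in> \<A>" "D \<in> \<A>" for C D
  proof -
    obtain n m where "C \<in> ?A n" "D \<in> ?A m" using CD unfolding \<A>_def by blast
    then have "C \<in> ?A (max n m)" "D \<in> ?A (max n m)" using mono[of n "max n m"] mono[of m "max n m"] by auto
    then have "C \<union> D \<in> ?A (Suc (max n m))" by auto
    then show ?thesis unfolding \<A>_def by blast
  qed
  moreover have "\<A> \<subseteq> sets M" using sets unfolding \<A>_def by blast
  moreover have "G \<subseteq> ?A 0" by auto
  then have "G \<subseteq> \<A>" unfolding \<A>_def by blast
  ultimately show ?thesis using that[of "from_nat_into \<A>"] ne unfolding range by blast
qed

text \<open>\<open>\<tau>\<close> is \<open>\<sigma>\<close> applied to a total extension of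
  \<open>\<Gamma>0\<close>. The extended values are determined modulo null sets, which
  \<open>\<sigma>\<close> ignores, so \<open>\<tau>\<close> is an exact homomorphism; as a value of
  \<open>\<sigma>\<close>, each \<open>\<tau> E\<close> is fixed by idempotence.\<close>

lemma lifting_of_hom_graph:
  assumes N: "finite_measure N" and \<sigma>: "\<sigma> \<in> Liftings (completion N)"
    and \<Gamma>0: "hom_graph M N (null_sets N) \<Gamma>0"
  shows "\<exists>\<tau>. (\<forall>E\<in>sets M. \<tau> E \<in> sets (completion N) \<and> \<sigma> (\<tau> E) = \<tau> E \<and>
        \<tau> (space M - E) = space N - \<tau> E \<and> (\<forall>F\<in>sets M. \<tau> (E \<inter> F) = \<tau> E \<inter> \<tau> F)) \<and>
      (\<forall>E\<in>null_sets M. \<tau> E = {}) \<and> (\<forall>E A. (E, A) \<in> \<Gamma>0 \<longrightarrow> \<tau> E = \<sigma> A)"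
proof -
  obtain \<Gamma> where \<Gamma>: "hom_graph M N (null_sets N) \<Gamma>" "\<Gamma>0 \<subseteq> \<Gamma>" "\<And>E. E \<in> sets M \<Longrightarrow> \<exists>A. (E, A) \<in> \<Gamma>"
    by (rule hom_graph_extend[OF N \<Gamma>0]) blast
  note hom = \<Gamma>(1)
  define H where "H E = (SOME A. (E, A) \<in> \<Gamma>)" for E
  have H: "(E, H E) \<in> \<Gamma>" if "E \<in> sets M" for E
    using someI_ex[OF \<Gamma>(3)[OF that]] unfolding H_def .
  have H_sets: "H E \<in> sets (completion N)" if "E \<in> sets M" for E
    using hom_graphD(2)[OF hom H[OF that]] by simp
  have uniq: "\<sigma> (H E) = \<sigma> A" if EA: "(E, A) \<in> \<Gamma>" for E A
  proof -
    have E: "E \<in> sets M" using hom_graphD(1)[OF hom EA] .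
    have "H E - A \<in> null_sets N" "A - H E \<in> null_sets N"
      using hom_graphD(6)[OF hom hom_graph_Diff[OF hom H[OF E] EA]]
        hom_graphD(6)[OF hom hom_graph_Diff[OF hom EA H[OF E]]] by auto
    then have "AE x in N. x \<in> H E \<longleftrightarrow> x \<in> A"
      by (auto dest!: AE_not_in elim: eventually_elim2)
    then have "AE x in completion N. x \<in> H E \<longleftrightarrow> x \<in> A" by (rule AE_completion)
    then show ?thesis
      using LiftingsD(3)[OF \<sigma> H_sets[OF E]] hom_graphD(2)[OF hom EA] by simp
  qed
  have compl: "\<sigma> (H (space M - E)) = space N - \<sigma> (H E)" if E: "E \<in> sets M" for E
    using uniq[OF hom_graphD(5)[OF hom H[OF E]]] LiftingsD(7)[OF \<sigma> H_sets[OF E]] by simp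
  have Int: "\<sigma> (H (E \<inter> F)) = \<sigma> (H E) \<inter> \<sigma> (H F)" if E: "E \<in> sets M" and F: "F \<in> sets M" for E F
    using uniq[OF hom_graphD(4)[OF hom H[OF E] H[OF F]]] LiftingsD(6)[OF \<sigma> H_sets[OF E] H_sets[OF F]] by simp
  have null: "\<sigma> (H E) = {}" if E: "E \<in> null_sets M" for E
  proof -
    have "H E \<in> null_sets N" using hom_graphD(6)[OF hom H E] E by blast
    then have "AE x in completion N. x \<in> H E \<longleftrightarrow> x \<in> {}"
      using AE_completion[OF AE_not_in, of "H E" N] by simp
    then show ?thesis using LiftingsD(3)[OF \<sigma> H_sets, of E "{}"] LiftingsD(4)[OF \<sigma>] E by auto
  qed
  note idem = Liftings_idem[OF \<sigma> H_sets]
  show ?thesis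
    by (intro exI[of _ "\<lambda>E. \<sigma> (H E)"] conjI ballI allI impI)
      (use compl Int null uniq idem \<Gamma>(2) LiftingsD(1)[OF \<sigma> H_sets] in auto)
qed

section \<open>Fibre measures and joint measurability\<close>

locale disintegration = P: prob_space P + Q: prob_space Q + R: prob_space R
  for P :: "'a measure" and Q :: "'b measure" and R :: "('a \<times> 'b) measure" +
  fixes S :: "'b \<Rightarrow> 'a measure"
  assumes sets_R [measurable_cong]: "sets R = sets (P \<Otimes>\<^sub>M Q)"
    and distr_fst: "distr R P fst = P" and distr_snd: "distr R Q snd = Q"
    and regular_conditional: "product_regular_conditional_probability P Q R S"
begin

lemma S_prob: "y \<in> space Q \<Longrightarrow> prob_space (S y)"
  and S_sets: "y \<in> space Q \<Longrightarrow> sets (S y) = sets P"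
  and S_emeasure_measurable: "A \<in> sets P \<Longrightarrow> (\<lambda>y. emeasure (S y) A) \<in> borel_measurable Q"
  and R_rectangle: "A \<in> sets P \<Longrightarrow> B \<in> sets Q \<Longrightarrow> emeasure R (A \<times> B) = (\<integral>\<^sup>+y\<in>B. emeasure (S y) A \<partial>Q)"
  using regular_conditional unfolding product_regular_conditional_probability_def by auto

lemma S_space: "y \<in> space Q \<Longrightarrow> space (S y) = space P"
  using S_sets sets_eq_imp_space_eq by blast

lemma space_R: "space R = space P \<times> space Q"
  using sets_eq_imp_space_eq[OF sets_R] by (simp add: space_pair_measure)

lemma S_kernel [measurable]: "S \<in> Q \<rightarrow>\<^sub>M subprob_algebra P"
  using S_prob S_sets S_emeasure_measurable
  by (intro measurable_subprob_algebra) (auto intro: prob_space_imp_subprob_space)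

lemma hsection_vimage: "hsection E y = (\<lambda>x. (x, y)) -` E"
  unfolding hsection_def by auto

lemma hsection_sets [measurable]: "E \<in> sets R \<Longrightarrow> hsection E y \<in> sets P"
  unfolding hsection_vimage sets_R by (rule sets_Pair2)

lemma hsection_S: "E \<in> sets R \<Longrightarrow> y \<in> space Q \<Longrightarrow> hsection E y \<in> sets (S y)"
  using hsection_sets S_sets by simp

lemma hsection_compl: "y \<in> space Q \<Longrightarrow> hsection (space R - E) y = space P - hsection E y"
  unfolding space_R hsection_def by auto

lemma emeasure_hsection_measurable:
  assumes E: "E \<in> sets R" shows "(\<lambda>y. emeasure (S y) (hsection E y)) \<in> borel_measurable Q"
proof (rule emeasure_measurable_subprob_algebra2[OF _ S_kernel])
  have "(SIGMA y:space Q. hsection E y) = (\<lambda>(y, x). (x, y)) -` E \<inter> space (Q \<Otimes>\<^sub>M P)"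
    using sets.sets_into_space[OF E] unfolding space_R hsection_def space_pair_measure by auto
  also have "\<dots> \<in> sets (Q \<Otimes>\<^sub>M P)"
    using E[unfolded sets_R] by (intro measurable_sets[OF measurable_pair_swap'])
  finally show "(SIGMA y:space Q. hsection E y) \<in> sets (Q \<Otimes>\<^sub>M P)" .
qed

lemma measure_hsection_measurable:
  assumes E: "E \<in> sets R" shows "(\<lambda>y. measure (S y) (hsection E y)) \<in> borel_measurable Q"
  unfolding measure_def using emeasure_hsection_measurable[OF E] by measurable

lemma measure_hsection_Linf:
  assumes E: "E \<in> sets R" shows "(\<lambda>y. measure (S y) (hsection E y)) \<in> Linf Q"
  unfolding Linf_def bounded_real using measure_hsection_measurable[OF E] prob_space.prob_le_1[OF S_prob]
  by (auto intro!: exI[of _ 1])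

text \<open>R is the mixture over Q of the images of the \<open>S y\<close> on the fibres: both
  measures agree on rectangles, a generator stable under intersection.\<close>

lemma emeasure_R:
  assumes E: "E \<in> sets R" shows "emeasure R E = (\<integral>\<^sup>+y. emeasure (S y) (hsection E y) \<partial>Q)"
proof -
  define K where "K y = distr (S y) (P \<Otimes>\<^sub>M Q) (\<lambda>x. (x, y))" for y
  have K [measurable]: "K \<in> Q \<rightarrow>\<^sub>M subprob_algebra (P \<Otimes>\<^sub>M Q)"
    unfolding K_def by (rule measurable_distr2[OF _ S_kernel]) simp
  have K_emeasure: "emeasure (K y) F = emeasure (S y) (hsection F y)"
    if y: "y \<in> space Q" and F: "F \<in> sets (P \<Otimes>\<^sub>M Q)" for y F
  proof -
    have "(\<lambda>x. (x, y)) \<in> S y \<rightarrow>\<^sub>M P \<Otimes>\<^sub>M Q"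
      using y by (subst measurable_cong_sets[OF S_sets[OF y] refl]) simp
    then have "emeasure (K y) F = emeasure (S y) ((\<lambda>x. (x, y)) -` F \<inter> space (S y))"
      unfolding K_def using F by (rule emeasure_distr)
    also have "(\<lambda>x. (x, y)) -` F \<inter> space (S y) = hsection F y"
      unfolding S_space[OF y] hsection_vimage
      using sets.sets_into_space[OF F] by (auto simp: space_pair_measure)
    finally show ?thesis .
  qed
  have bind: "emeasure (Q \<bind> K) F = (\<integral>\<^sup>+y. emeasure (S y) (hsection F y) \<partial>Q)"
    if F: "F \<in> sets (P \<Otimes>\<^sub>M Q)" for F
    using F by (subst emeasure_bind[OF Q.not_empty K]) (auto intro!: nn_integral_cong K_emeasure)
  have "R = Q \<bind> K"
  proof (rule measure_eqI_generator_eq[OF Int_stable_pair_measure_generator[of P Q],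
        where \<Omega> = "space P \<times> space Q" and A = "\<lambda>_. space P \<times> space Q"])
    show "sets R = sigma_sets (space P \<times> space Q) {a \<times> b |a b. a \<in> sets P \<and> b \<in> sets Q}"
      unfolding sets_R by (rule sets_pair_measure)
    show "sets (Q \<bind> K) = sigma_sets (space P \<times> space Q) {a \<times> b |a b. a \<in> sets P \<and> b \<in> sets Q}"
      using sets_bind[OF _ Q.not_empty, of K "P \<Otimes>\<^sub>M Q"] sets_kernel[OF K] by (simp add: sets_pair_measure)
    show "emeasure R X = emeasure (Q \<bind> K) X"
      if X: "X \<in> {a \<times> b |a b. a \<in> sets P \<and> b \<in> sets Q}" for X
    proof -
      obtain A B where AB: "X = A \<times> B" "A \<in> sets P" "B \<in> sets Q" using X by blast
      have "hsection X y = (if y \<in> B then A else {})" for y unfolding AB hsection_def by auto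
      then have "emeasure (Q \<bind> K) X = (\<integral>\<^sup>+y\<in>B. emeasure (S y) A \<partial>Q)"
        using AB by (subst bind) (auto intro!: nn_integral_cong simp: indicator_def)
      then show ?thesis using R_rectangle AB by simp
    qed
    show "{a \<times> b |a b. a \<in> sets P \<and> b \<in> sets Q} \<subseteq> Pow (space P \<times> space Q)"
      using sets.sets_into_space[of _ P] sets.sets_into_space[of _ Q] by (auto; blast)
    show "range (\<lambda>_. space P \<times> space Q) \<subseteq> {a \<times> b |a b. a \<in> sets P \<and> b \<in> sets Q}" by auto
    show "emeasure R (space P \<times> space Q) \<noteq> \<infinity>"
      using R.emeasure_space_1 unfolding space_R by simp
  qed simp
  then show ?thesis using bind[of E] E sets_R by simp
qed

lemma null_sets_R_iff:
  assumes E: "E \<in> sets R"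
  shows "E \<in> null_sets R \<longleftrightarrow> (AE y in Q. emeasure (S y) (hsection E y) = 0)"
  using nn_integral_0_iff_AE[OF emeasure_hsection_measurable[OF E]] emeasure_R[OF E] E
  by (simp add: null_sets_def)

lemma AE_snd: "AE y in Q. T y \<Longrightarrow> AE z in R. T (snd z)"
  using AE_distrD[of snd R Q T] unfolding distr_snd by simp

text \<open>For fixed n there are finitely many atoms, so the function is a finite sum of products
  of an indicator in x and a measurable function of y.\<close>

lemma measure_hsection_atom:
  assumes E: "E \<in> sets R" and g: "\<And>i. g i \<in> sets P"
  shows "(\<lambda>z. measure (S (snd z)) (hsection E (snd z) \<inter> atom (space P) g n (fst z))) \<in> borel_measurable R"
proof -
  let ?A = "range (atom (space P) g n)"
  define h where "h a y = measure (S y) (hsection (E \<inter> a \<times> space Q) y)" for a y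
  have a: "a \<in> sets P" if "a \<in> ?A" for a using that atom_sets[of g P] g by auto
  have [measurable]: "h a \<in> borel_measurable Q" if "a \<in> ?A" for a
    unfolding h_def using a[OF that] E by (intro measure_hsection_measurable sets.Int) (auto simp: sets_R)
  have "measure (S (snd z)) (hsection E (snd z) \<inter> atom (space P) g n (fst z)) =
      (\<Sum>a\<in>?A. indicator a (fst z) * h a (snd z))" if z: "z \<in> space R" for z
  proof -
    let ?a = "atom (space P) g n (fst z)"
    have z': "fst z \<in> space P" "snd z \<in> space Q" using z unfolding space_R by auto
    have "(\<Sum>a\<in>?A. indicator a (fst z) * h a (snd z)) = (\<Sum>a\<in>?A. if a = ?a then h a (snd z) else 0)"
    proof (rule sum.cong[OF refl])
      fix a assume "a \<in> ?A"
      then have "fst z \<in> a \<longleftrightarrow> a = ?a"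
        using atom_eq[of "fst z" "space P" g n] atom_self[OF z'(1), of g n] by blast
      then show "indicator a (fst z) * h a (snd z) = (if a = ?a then h a (snd z) else 0)"
        by (simp add: indicator_def)
    qed
    also have "\<dots> = h ?a (snd z)" using finite_atoms[of "space P" g n] by simp
    also have "hsection (E \<inter> ?a \<times> space Q) (snd z) = hsection E (snd z) \<inter> ?a"
      using z'(2) unfolding hsection_def by auto
    then have "h ?a (snd z) = measure (S (snd z)) (hsection E (snd z) \<inter> ?a)" unfolding h_def by simp
    finally show ?thesis by simp
  qed
  moreover have "(\<lambda>z. \<Sum>a\<in>?A. indicator a (fst z) * h a (snd z)) \<in> borel_measurable R"
  proof (rule borel_measurable_sum)
    fix a assume "a \<in> ?A"
    then have [measurable]: "a \<in> sets P" "h a \<in> borel_measurable Q" using a by auto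
    show "(\<lambda>z. indicator a (fst z) * h a (snd z)) \<in> borel_measurable R" by measurable
  qed
  ultimately show ?thesis by (subst measurable_cong) auto
qed

text \<open>Built before any fibre lifting is chosen; it is the measurable set that bounds the
  lifting of E from below, up to a null set.\<close>

definition core :: "(nat \<Rightarrow> 'a set) \<Rightarrow> ('a \<times> 'b) set \<Rightarrow> ('a \<times> 'b) set" where
  "core g E = {z \<in> space R. fst z \<in> density_core (S (snd z)) g (hsection E (snd z))}"

lemma core_sets:
  assumes E: "E \<in> sets R" and g: "\<And>i. g i \<in> sets P" shows "core g E \<in> sets R"
proof -
  define h where "h n E z = measure (S (snd z)) (hsection E (snd z) \<inter> atom (space P) g n (fst z))"
    for n :: nat and E :: "('a \<times> 'b) set" and z :: "'a \<times> 'b"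
  have [measurable]: "h n E \<in> borel_measurable R" "h n (space R) \<in> borel_measurable R" for n
    unfolding h_def using measure_hsection_atom[OF E g] measure_hsection_atom[OF sets.top g] by auto
  have "core g E = {z \<in> space R. (\<forall>n. 0 < h n (space R) z) \<and>
      (\<forall>k. \<exists>n. \<forall>m\<ge>n. (1 - 1 / Suc k) * h m (space R) z \<le> h m E z)}"
    unfolding core_def
  proof (intro Collect_cong conj_cong refl)
    fix z assume z: "z \<in> space R"
    then have z': "fst z \<in> space P" "snd z \<in> space Q" unfolding space_R by auto
    have "h n (space R) z = measure (S (snd z)) (atom (space P) g n (fst z))" for n
    proof -
      have "hsection (space R) (snd z) \<inter> atom (space P) g n (fst z) = atom (space P) g n (fst z)"
        unfolding hsection_def space_R atom_def using z'(2) by blast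
      then show ?thesis unfolding h_def by simp
    qed
    then show "fst z \<in> density_core (S (snd z)) g (hsection E (snd z)) \<longleftrightarrow>
        (\<forall>n. 0 < h n (space R) z) \<and>
        (\<forall>k. \<exists>n. \<forall>m\<ge>n. (1 - 1 / Suc k) * h m (space R) z \<le> h m E z)"
      unfolding density_core_def S_space[OF z'(2)] using z'(1) by (simp add: h_def)
  qed
  also have "\<dots> \<in> sets R" by measurable
  finally show ?thesis .
qed

lemma hsection_core: "y \<in> space Q \<Longrightarrow> hsection (core g E) y = density_core (S y) g (hsection E y)"
  by (auto simp: core_def hsection_def space_R density_core_def S_space)

end

section \<open>Germs of sections along the lifting of the base\<close>

locale lifted_disintegration = disintegration +
  fixes \<rho> :: "'b set \<Rightarrow> 'b set" and g :: "nat \<Rightarrow> 'a set"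
  assumes \<rho>: "\<rho> \<in> Liftings Q"
    and g_sets [measurable]: "g i \<in> sets P"
    and g_empty: "{} \<in> range g"
    and g_compl: "C \<in> range g \<Longrightarrow> space P - C \<in> range g"
    and g_Un: "C \<in> range g \<Longrightarrow> D \<in> range g \<Longrightarrow> C \<union> D \<in> range g"
    and g_dense: "A \<in> sets P \<Longrightarrow> e > 0 \<Longrightarrow>
      \<exists>C\<in>sigma_sets (space P) (range g). measure P (sym_diff A C) < e"
begin

abbreviation near :: "'b \<Rightarrow> 'b filter" where
  "near \<equiv> lift_filter Q \<rho>"

lemma g_in_sets: "C \<in> range g \<Longrightarrow> C \<in> sets P"
  by auto

lemma g_Int:
  assumes "C \<in> range g" "D \<in> range g" shows "C \<inter> D \<in> range g"
proof -
  have "space P - ((space P - C) \<union> (space P - D)) \<in> range g" using assms by (intro g_compl g_Un)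
  moreover have "space P - ((space P - C) \<union> (space P - D)) = C \<inter> D"
    using assms[THEN g_in_sets, THEN sets.sets_into_space] by blast
  ultimately show ?thesis by simp
qed

lemma sigma_algebra_near_g:
  assumes y: "y \<in> space Q"
  shows "sigma_algebra (space P) (approx_by (S y) (range g))"
proof -
  interpret S: prob_space "S y" using S_prob[OF y] .
  have "sigma_algebra (space (S y)) (approx_by (S y) (range g))"
  proof (rule S.sigma_algebra_approx_by[OF _ g_empty])
    show "range g \<subseteq> sets (S y)" unfolding S_sets[OF y] by (rule image_subsetI) (rule g_sets)
    show "space (S y) - C \<in> range g" if "C \<in> range g" for C using g_compl[OF that] S_space[OF y] by simp
  qed (rule g_Un)
  then show ?thesis using S_space[OF y] by simp
qed

text \<open>\<open>g_dense\<close> speaks of P only. As P is the mixture of the \<open>S y\<close>,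
  the integrals over Q of \<open>emeasure (S y) (D n)\<close> tend to 0, so the infimum over n
  vanishes for almost every y. The sets \<open>C n\<close>, taken from the generated sigma-algebra,
  are in turn approximated by the algebra under every \<open>S y\<close>.\<close>

lemma AE_rectangle_approx:
  assumes A: "A \<in> sets P" shows "AE y in Q. A \<in> approx_by (S y) (range g)"
proof -
  have "\<exists>C. C \<in> sigma_sets (space P) (range g) \<and> measure P (sym_diff A C) < 1 / Suc n" for n
    using g_dense[OF A, of "1 / Suc n"] by auto
  then obtain C where C: "\<And>n. C n \<in> sigma_sets (space P) (range g)"
    "\<And>n. measure P (sym_diff A (C n)) < 1 / Suc n" by metis
  have "sigma_sets (space P) (range g) \<subseteq> sets P" using g_sets by (intro sets.sigma_sets_subset) auto
  then have [measurable]: "C n \<in> sets P" for n using C(1) by blast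
  define D where "D n = sym_diff A (C n)" for n
  have D [measurable]: "D n \<in> sets P" for n unfolding D_def using A by auto
  have PD: "emeasure P (D n) = (\<integral>\<^sup>+y. emeasure (S y) (D n) \<partial>Q)" for n
  proof -
    have "emeasure P (D n) = emeasure (distr R P fst) (D n)" using distr_fst by simp
    also have "\<dots> = emeasure R (fst -` D n \<inter> space R)" by (rule emeasure_distr) auto
    also have "fst -` D n \<inter> space R = D n \<times> space Q"
      using sets.sets_into_space[OF D] unfolding space_R by auto
    also have "emeasure R \<dots> = (\<integral>\<^sup>+y\<in>space Q. emeasure (S y) (D n) \<partial>Q)" by (rule R_rectangle) auto
    also have "\<dots> = (\<integral>\<^sup>+y. emeasure (S y) (D n) \<partial>Q)" by (rule nn_integral_cong) simp
    finally show ?thesis .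
  qed
  have [measurable]: "(\<lambda>y. emeasure (S y) (D n)) \<in> borel_measurable Q" for n
    by (rule S_emeasure_measurable[OF D])
  have "(\<integral>\<^sup>+y. (INF n. emeasure (S y) (D n)) \<partial>Q) \<le> ennreal (1 / Suc n)" for n
  proof -
    have "(\<integral>\<^sup>+y. (INF n. emeasure (S y) (D n)) \<partial>Q) \<le> (\<integral>\<^sup>+y. emeasure (S y) (D n) \<partial>Q)"
      by (intro nn_integral_mono INF_lower) auto
    also have "\<dots> = emeasure P (D n)" using PD by simp
    also have "\<dots> \<le> ennreal (1 / Suc n)"
      using C(2)[of n] unfolding P.emeasure_eq_measure D_def by (intro ennreal_leI) simp
    finally show ?thesis .
  qed
  note bound = this
  have "(\<integral>\<^sup>+y. (INF n. emeasure (S y) (D n)) \<partial>Q) \<le> 0"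
  proof (rule ennreal_le_epsilon)
    fix e :: real assume "e > 0"
    then obtain n where "1 / Suc n < e" using nat_approx_posE by metis
    then have "ennreal (1 / Suc n) \<le> ennreal e" by (intro ennreal_leI) simp
    then show "(\<integral>\<^sup>+y. (INF n. emeasure (S y) (D n)) \<partial>Q) \<le> 0 + ennreal e"
      using bound[of n] by simp
  qed
  then have "AE y in Q. (INF n. emeasure (S y) (D n)) = 0"
    by (subst nn_integral_0_iff_AE[symmetric]) auto
  then show ?thesis
    using AE_space
  proof eventually_elim
    case (elim y)
    interpret S: prob_space "S y" using S_prob[OF elim(2)] .
    note Ssets = S_sets[OF elim(2)]
    interpret L: sigma_algebra "space P" "approx_by (S y) (range g)"
      by (rule sigma_algebra_near_g[OF elim(2)])
    have "range g \<subseteq> sets (S y)" unfolding Ssets by (rule image_subsetI) (rule g_sets)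
    then have "range g \<subseteq> approx_by (S y) (range g)" by (rule approx_by_superset)
    then have "sigma_sets (space P) (range g) \<subseteq> approx_by (S y) (range g)" by (rule L.sigma_sets_subset)
    then have CL: "C n \<in> approx_by (S y) (range g)" for n using C(1) by blast
    have "\<exists>B\<in>range g. measure (S y) (sym_diff A B) < e" if e: "e > 0" for e
    proof -
      have "(INF n. emeasure (S y) (D n)) < ennreal (e / 2)" using elim(1) e by simp
      then obtain n where "emeasure (S y) (D n) < ennreal (e / 2)" unfolding INF_less_iff by blast
      then have n: "measure (S y) (sym_diff A (C n)) < e / 2"
        using e by (simp add: S.emeasure_eq_measure ennreal_less_iff D_def)
      obtain B where B: "B \<in> range g" "measure (S y) (sym_diff (C n) B) < e / 2"
        by (rule approx_byE[OF CL[of n] half_gt_zero[OF e]])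
      have m: "A \<in> sets (S y)" "C n \<in> sets (S y)" "B \<in> sets (S y)"
        unfolding Ssets using A g_in_sets[OF B(1)] by simp_all
      have "measure (S y) (sym_diff A B) \<le> measure (S y) (sym_diff A (C n) \<union> sym_diff (C n) B)"
        using m by (intro S.finite_measure_mono) auto
      also have "\<dots> \<le> measure (S y) (sym_diff A (C n)) + measure (S y) (sym_diff (C n) B)"
        using m by (intro measure_Un_le) auto
      finally show ?thesis using n B by (intro bexI[of _ B]) auto
    qed
    then show ?case unfolding approx_by_def using A Ssets by blast
  qed
qed

text \<open>Induction over the product sigma-algebra: for each y the approximable sets form a
  sigma-algebra, and a countable union merges only countably many exceptional null sets.\<close>

lemma AE_hsection_approx:
  assumes E: "E \<in> sets R" shows "AE y in Q. hsection E y \<in> approx_by (S y) (range g)"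
proof -
  have "E \<in> sigma_sets (space P \<times> space Q) {a \<times> b |a b. a \<in> sets P \<and> b \<in> sets Q}"
    using E unfolding sets_R sets_pair_measure .
  then show ?thesis
  proof induction
    case (Basic X)
    then obtain A B where AB: "X = A \<times> B" "A \<in> sets P" "B \<in> sets Q" by blast
    have h: "hsection X y = (if y \<in> B then A else {})" for y unfolding AB hsection_def by auto
    show ?case
      using AE_rectangle_approx[OF AB(2)] AE_space
    proof eventually_elim
      case (elim y)
      interpret L: sigma_algebra "space P" "approx_by (S y) (range g)"
        by (rule sigma_algebra_near_g[OF elim(2)])
      show ?case unfolding h using elim by simp
    qed
  next
    case Empty
    show ?case
      using AE_space
    proof eventually_elim
      case (elim y)
      interpret L: sigma_algebra "space P" "approx_by (S y) (range g)"
        by (rule sigma_algebra_near_g[OF elim])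
      show ?case unfolding hsection_def by simp
    qed
  next
    case (Compl X)
    show ?case
      using Compl.IH AE_space
    proof eventually_elim
      case (elim y)
      interpret L: sigma_algebra "space P" "approx_by (S y) (range g)"
        by (rule sigma_algebra_near_g[OF elim(2)])
      show ?case using L.compl_sets[OF elim(1)] hsection_compl[OF elim(2), of X] unfolding space_R by simp
    qed
  next
    case (Union X)
    have "AE y in Q. \<forall>i. hsection (X i) y \<in> approx_by (S y) (range g)"
      unfolding AE_all_countable using Union.IH by blast
    then show ?case
      using AE_space
    proof eventually_elim
      case (elim y)
      interpret L: sigma_algebra "space P" "approx_by (S y) (range g)"
        by (rule sigma_algebra_near_g[OF elim(2)])
      have "hsection (\<Union>i. X i) y = (\<Union>i. hsection (X i) y)" unfolding hsection_def by blast
      also have "\<dots> \<in> approx_by (S y) (range g)" using elim(1) by (intro L.countable_UN) auto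
      finally show ?case .
    qed
  qed
qed

text \<open>E enters only through its sections along \<open>near y\<close>, so changing E by a null
  set of R is invisible. The same C has to serve both sides, which ties the class of A to that of
  E.\<close>

definition germ :: "'b \<Rightarrow> (('a \<times> 'b) set \<times> 'a set) set" where
  "germ y = {(E, A). E \<in> sets R \<and> A \<in> sets P \<and> (\<forall>e>0. \<exists>C\<in>range g.
     (\<forall>\<^sub>F y' in near y. measure (S y') (sym_diff (hsection E y') C) < e) \<and>
     measure (S y) (sym_diff A C) < e)}"

text \<open>Transfers a bound on the measure of \<open>g i\<close> along the filter to the fibre at
  y; this is what sends null sets of R to null sets of \<open>S y\<close>.\<close>

definition regular :: "'b \<Rightarrow> bool" where
  "regular y \<longleftrightarrow> (\<forall>i. ((\<lambda>y'. measure (S y') (g i)) \<longlongrightarrow> measure (S y) (g i)) (near y))"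

lemma AE_regular: "AE y in Q. regular y"
  unfolding regular_def AE_all_countable
proof
  fix i
  have "hsection (g i \<times> space Q) y = g i" if "y \<in> space Q" for y
    using that unfolding hsection_def by auto
  moreover have "g i \<times> space Q \<in> sets R" unfolding sets_R by simp
  ultimately have "(\<lambda>y. measure (S y) (g i)) \<in> Linf Q"
    using measure_hsection_Linf[of "g i \<times> space Q"] unfolding Linf_def by (simp cong: measurable_cong)
  then show "AE y in Q. ((\<lambda>y'. measure (S y') (g i)) \<longlongrightarrow> measure (S y) (g i)) (near y)"
    by (rule AE_tendsto_lift_filter[OF \<rho>])
qed

text \<open>For each i the distance from \<open>hsection E y'\<close> to \<open>g i\<close> is a
  bounded measurable function of \<open>y'\<close>, hence continuous along the filter at almost
  every y. A set C close to the section at y is then close along the filter too, and countability of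
  the family keeps the exceptional set null.\<close>

lemma AE_germ:
  assumes E: "E \<in> sets R" shows "AE y in Q. (E, hsection E y) \<in> germ y"
proof -
  have "AE y in Q. \<forall>i. ((\<lambda>y'. measure (S y') (sym_diff (hsection E y') (g i))) \<longlongrightarrow>
      measure (S y) (sym_diff (hsection E y) (g i))) (near y)"
    unfolding AE_all_countable
  proof
    fix i
    let ?F = "sym_diff E (g i \<times> space Q)"
    have h: "hsection ?F y = sym_diff (hsection E y) (g i)" if "y \<in> space Q" for y
      using that unfolding hsection_def by auto
    have "g i \<times> space Q \<in> sets R" unfolding sets_R by simp
    then have "?F \<in> sets R" using E by blast
    then have "(\<lambda>y. measure (S y) (hsection ?F y)) \<in> Linf Q" by (rule measure_hsection_Linf)
    then have "(\<lambda>y. measure (S y) (sym_diff (hsection E y) (g i))) \<in> Linf Q"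
      unfolding Linf_def using h by (simp cong: measurable_cong)
    then show "AE y in Q. ((\<lambda>y'. measure (S y') (sym_diff (hsection E y') (g i))) \<longlongrightarrow>
      measure (S y) (sym_diff (hsection E y) (g i))) (near y)"
      by (rule AE_tendsto_lift_filter[OF \<rho>])
  qed
  then show ?thesis
    using AE_hsection_approx[OF E]
  proof eventually_elim
    case (elim y)
    have "\<exists>C\<in>range g. (\<forall>\<^sub>F y' in near y. measure (S y') (sym_diff (hsection E y') C) < e) \<and>
        measure (S y) (sym_diff (hsection E y) C) < e" if "e > 0" for e
    proof -
      obtain C where C: "C \<in> range g" "measure (S y) (sym_diff (hsection E y) C) < e"
        by (rule approx_byE[OF elim(2) \<open>e > 0\<close>])
      obtain i where i: "C = g i" using C(1) by blast
      have "((\<lambda>y'. measure (S y') (sym_diff (hsection E y') C)) \<longlongrightarrow>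
          measure (S y) (sym_diff (hsection E y) C)) (near y)"
        unfolding i using elim(1) by blast
      from order_tendstoD(2)[OF this C(2)] show ?thesis using C by blast
    qed
    then show ?case unfolding germ_def using E hsection_sets by simp
  qed
qed

text \<open>Intersections follow from subadditivity, complements from invariance of symmetric
  differences. For null E the approximating C is small along the filter, hence small under
  \<open>S y\<close> by regularity, and A is close to C.\<close>

lemma hom_graph_germ:
  assumes y: "y \<in> space Q" and reg: "regular y"
  shows "hom_graph R (S y) (null_sets (S y)) (germ y)"
proof -
  interpret S: prob_space "S y" using S_prob[OF y] .
  note Ssets = S_sets[OF y]
  note ev_space = eventually_lift_filter_space[OF \<rho> y]
  have empty: "({}, {}) \<in> germ y"
  proof -
    have "(\<forall>\<^sub>F y' in near y. measure (S y') (sym_diff (hsection {} y') {}) < e) \<and>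
        measure (S y) (sym_diff {} {}) < e" if "e > 0" for e
      using that by (simp add: hsection_def)
    then show ?thesis unfolding germ_def using g_empty by (intro CollectI case_prodI) blast
  qed
  have Int: "(E \<inter> E', A \<inter> A') \<in> germ y" if EA: "(E, A) \<in> germ y" and EA': "(E', A') \<in> germ y" for E A E' A'
  proof -
    have m: "E \<in> sets R" "E' \<in> sets R" "A \<in> sets P" "A' \<in> sets P" using EA EA' unfolding germ_def by auto
    have "\<exists>C\<in>range g. (\<forall>\<^sub>F y' in near y. measure (S y') (sym_diff (hsection (E \<inter> E') y') C) < e) \<and>
        measure (S y) (sym_diff (A \<inter> A') C) < e" if e: "e > 0" for e
    proof -
      have e2: "e / 2 > 0" using e by simp
      obtain C where C: "C \<in> range g" "measure (S y) (sym_diff A C) < e / 2"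
        "\<forall>\<^sub>F y' in near y. measure (S y') (sym_diff (hsection E y') C) < e / 2"
        using EA e2 unfolding germ_def by blast
      obtain C' where C': "C' \<in> range g" "measure (S y) (sym_diff A' C') < e / 2"
        "\<forall>\<^sub>F y' in near y. measure (S y') (sym_diff (hsection E' y') C') < e / 2"
        using EA' e2 unfolding germ_def by blast
      have sub: "measure (S z) (sym_diff (B \<inter> B') (C \<inter> C')) < e"
        if z: "z \<in> space Q" and B: "B \<in> sets P" "B' \<in> sets P"
          and lt: "measure (S z) (sym_diff B C) < e / 2" "measure (S z) (sym_diff B' C') < e / 2" for z B B'
      proof -
        interpret Z: prob_space "S z" using S_prob[OF z] .
        have "B \<in> sets (S z)" "B' \<in> sets (S z)" "C \<in> sets (S z)" "C' \<in> sets (S z)"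
          using B C C' S_sets[OF z] g_in_sets by auto
        note this[measurable]
        have "measure (S z) (sym_diff (B \<inter> B') (C \<inter> C')) \<le> measure (S z) (sym_diff B C \<union> sym_diff B' C')"
          by (intro Z.finite_measure_mono) auto
        also have "\<dots> \<le> measure (S z) (sym_diff B C) + measure (S z) (sym_diff B' C')"
          by (intro measure_Un_le) auto
        finally show ?thesis using lt by simp
      qed
      have "\<forall>\<^sub>F y' in near y. measure (S y') (sym_diff (hsection (E \<inter> E') y') (C \<inter> C')) < e"
        using C(3) C'(3) ev_space
      proof eventually_elim
        case (elim z)
        have "hsection (E \<inter> E') z = hsection E z \<inter> hsection E' z" unfolding hsection_def by blast
        then show ?case using sub[OF elim(3) hsection_sets[OF m(1)] hsection_sets[OF m(2)] elim(1,2)] by simp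
      qed
      moreover have "measure (S y) (sym_diff (A \<inter> A') (C \<inter> C')) < e"
        using sub[OF y m(3,4) C(2) C'(2)] .
      ultimately show ?thesis using g_Int[OF C(1) C'(1)] by blast
    qed
    then show ?thesis unfolding germ_def using m by auto
  qed
  have compl: "(space R - E, space (S y) - A) \<in> germ y" if EA: "(E, A) \<in> germ y" for E A
  proof -
    have m: "E \<in> sets R" "A \<in> sets P" using EA unfolding germ_def by auto
    have sd: "sym_diff (space P - B) (space P - C) = sym_diff B C" if "B \<in> sets P" "C \<in> sets P" for B C
      using that[THEN sets.sets_into_space] by blast
    have "\<exists>C\<in>range g. (\<forall>\<^sub>F y' in near y. measure (S y') (sym_diff (hsection (space R - E) y') C) < e) \<and>
        measure (S y) (sym_diff (space P - A) C) < e" if e: "e > 0" for e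
    proof -
      obtain C where C: "C \<in> range g" "measure (S y) (sym_diff A C) < e"
        "\<forall>\<^sub>F y' in near y. measure (S y') (sym_diff (hsection E y') C) < e"
        using EA e unfolding germ_def by blast
      have "\<forall>\<^sub>F y' in near y. measure (S y') (sym_diff (hsection (space R - E) y') (space P - C)) < e"
        using C(3) ev_space
      proof eventually_elim
        case (elim z)
        then show ?case
          using hsection_compl[OF elim(2), of E] sd[OF hsection_sets[OF m(1)] g_in_sets[OF C(1)]] by simp
      qed
      moreover have "measure (S y) (sym_diff (space P - A) (space P - C)) < e"
        using sd[OF m(2) g_in_sets[OF C(1)]] C(2) by simp
      ultimately show ?thesis using g_compl[OF C(1)] by blast
    qed
    then show ?thesis unfolding germ_def using m S_space[OF y] by auto
  qed
  have null: "A \<in> null_sets (S y)" if EA: "(E, A) \<in> germ y" and E: "E \<in> null_sets R" for E A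
  proof -
    have m: "E \<in> sets R" "A \<in> sets P" using EA unfolding germ_def by auto
    have "AE y' in Q. emeasure (S y') (hsection E y') = 0" using null_sets_R_iff[OF m(1)] E by blast
    then have ev0: "\<forall>\<^sub>F y' in near y. emeasure (S y') (hsection E y') = 0"
      by (rule eventually_lift_filter_AE[OF \<rho> y])
    have "measure (S y) A \<le> e" if e: "e > 0" for e
    proof -
      have e2: "e / 2 > 0" using e by simp
      obtain C where C: "C \<in> range g" "measure (S y) (sym_diff A C) < e / 2"
        "\<forall>\<^sub>F y' in near y. measure (S y') (sym_diff (hsection E y') C) < e / 2"
        using EA e2 unfolding germ_def by blast
      have "\<forall>\<^sub>F y' in near y. measure (S y') C \<le> e / 2"
        using C(3) ev_space ev0
      proof eventually_elim
        case (elim z)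
        interpret Z: prob_space "S z" using S_prob[OF elim(2)] .
        have "hsection E z \<in> sets (S z)" "C \<in> sets (S z)"
          using C m hsection_sets S_sets[OF elim(2)] g_in_sets by auto
        note this[measurable]
        have "measure (S z) C \<le> measure (S z) (sym_diff (hsection E z) C \<union> hsection E z)"
          by (intro Z.finite_measure_mono) auto
        also have "\<dots> \<le> measure (S z) (sym_diff (hsection E z) C) + measure (S z) (hsection E z)"
          by (intro measure_Un_le) auto
        finally show ?case using elim(1,3) by (simp add: measure_def)
      qed
      moreover have "((\<lambda>y'. measure (S y') C) \<longlongrightarrow> measure (S y) C) (near y)"
        using reg C(1) unfolding regular_def by auto
      ultimately have "measure (S y) C \<le> e / 2"
        by (intro tendsto_upperbound[OF _ _ lift_filter_not_bot[OF \<rho> y]])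
      moreover have "measure (S y) A \<le> measure (S y) (sym_diff A C \<union> C)"
        using m(2) g_in_sets[OF C(1)] Ssets by (intro S.finite_measure_mono) auto
      moreover have "measure (S y) (sym_diff A C \<union> C) \<le> measure (S y) (sym_diff A C) + measure (S y) C"
        using m(2) g_in_sets[OF C(1)] Ssets by (intro measure_Un_le) auto
      ultimately show ?thesis using C(2) by linarith
    qed
    then have "measure (S y) A \<le> 0" by (rule field_le_epsilon[of _ 0, simplified])
    then have "measure (S y) A = 0" using measure_nonneg[of "S y" A] by linarith
    then show ?thesis using m(2) Ssets by (simp add: null_setsI S.emeasure_eq_measure)
  qed
  show ?thesis
    unfolding hom_graph_def
    using empty Int compl null Ssets by (auto simp: germ_def[of y])
qed

end

section \<open>Liftings with fixed sections\<close>

context lifted_disintegration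
begin

text \<open>Collects every requirement on a single fibre. No condition links different y, so
  fibrewise existence permits a choice for all y at once.\<close>

definition fibre_lifting :: "'b \<Rightarrow> ('a set \<Rightarrow> 'a set) \<Rightarrow> (('a \<times> 'b) set \<Rightarrow> 'a set) \<Rightarrow> bool" where
  "fibre_lifting y \<sigma> \<tau> \<longleftrightarrow> \<sigma> \<in> Liftings (completion (S y)) \<and>
     (\<forall>A\<in>approx_by (S y) (range g). density_core (S y) g A \<subseteq> \<sigma> A) \<and>
     (\<forall>E\<in>sets R. \<tau> E \<in> sets (completion (S y)) \<and> \<sigma> (\<tau> E) = \<tau> E \<and>
        \<tau> (space R - E) = space P - \<tau> E \<and> (\<forall>F\<in>sets R. \<tau> (E \<inter> F) = \<tau> E \<inter> \<tau> F)) \<and>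
     (\<forall>E\<in>null_sets R. \<tau> E = {}) \<and>
     (regular y \<longrightarrow> (\<forall>E A. (E, A) \<in> germ y \<longrightarrow> \<tau> E = \<sigma> A))"

lemma atom_filtration_S: "y \<in> space Q \<Longrightarrow> atom_filtration (S y) g"
  using S_prob S_sets by (simp add: atom_filtration_def atom_filtration_axioms_def)

lemma fibre_lifting_exists:
  assumes y: "y \<in> space Q" shows "\<exists>\<sigma> \<tau>. fibre_lifting y \<sigma> \<tau>"
proof -
  interpret S: atom_filtration "S y" g by (rule atom_filtration_S[OF y])
  obtain \<sigma> where \<sigma>: "\<sigma> \<in> Liftings (completion (S y))"
    and dens: "\<And>A. A \<in> approx_by (S y) (range g) \<Longrightarrow> density_core (S y) g A \<subseteq> \<sigma> A"
    by (rule S.lifting_density_core) blast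
  \<comment> \<open>At an irregular y any homomorphism will do, so the trivial graph on the
    two-element algebra is extended.\<close>
  define \<Gamma> where "\<Gamma> = (if regular y then germ y else {({}, {}), (space R, space (S y))})"
  have "hom_graph R (S y) (null_sets (S y)) {({}, {}), (space R, space (S y))}"
    unfolding hom_graph_def by (auto simp: null_sets_def R.emeasure_space_1)
  then have "hom_graph R (S y) (null_sets (S y)) \<Gamma>"
    unfolding \<Gamma>_def using hom_graph_germ[OF y] by simp
  from lifting_of_hom_graph[OF S.finite_measure_axioms \<sigma> this]
  obtain \<tau> where \<tau>: "\<forall>E\<in>sets R. \<tau> E \<in> sets (completion (S y)) \<and> \<sigma> (\<tau> E) = \<tau> E \<and>
        \<tau> (space R - E) = space (S y) - \<tau> E \<and> (\<forall>F\<in>sets R. \<tau> (E \<inter> F) = \<tau> E \<inter> \<tau> F)"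
    "\<forall>E\<in>null_sets R. \<tau> E = {}" "\<forall>E A. (E, A) \<in> \<Gamma> \<longrightarrow> \<tau> E = \<sigma> A"
    by (elim exE conjE) (rule that)
  have "fibre_lifting y \<sigma> \<tau>"
    unfolding fibre_lifting_def
  proof (intro conjI impI)
    show "\<forall>E A. (E, A) \<in> germ y \<longrightarrow> \<tau> E = \<sigma> A" if "regular y" using that \<tau>(3) unfolding \<Gamma>_def by simp
  qed (use \<sigma> dens \<tau>(1,2) in \<open>simp_all add: S_space[OF y]\<close>)
  then show ?thesis by blast
qed

text \<open>Almost every section is approximable and so lies in its density points up to a null set
  of \<open>S y\<close>; \<open>null_sets_R_iff\<close> combines the fibres.\<close>

lemma AE_core:
  assumes E: "E \<in> sets R" shows "AE z in R. z \<in> E \<longrightarrow> z \<in> core g E"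
proof -
  have "core g E \<in> sets R" by (rule core_sets[OF E]) (rule g_sets)
  then have D: "E - core g E \<in> sets R" using E by (rule sets.Diff[rotated])
  have "AE y in Q. emeasure (S y) (hsection (E - core g E) y) = 0"
    using AE_hsection_approx[OF E] AE_space
  proof eventually_elim
    case (elim y)
    interpret S: atom_filtration "S y" g by (rule atom_filtration_S[OF elim(2)])
    have "hsection (E - core g E) y = hsection E y - density_core (S y) g (hsection E y)"
      unfolding hsection_core[OF elim(2), symmetric] by (auto simp: hsection_def)
    then have "AE x in S y. x \<notin> hsection (E - core g E) y"
      using S.AE_density_core[OF elim(1)] by simp
    then show ?case
      using AE_iff_measurable[OF hsection_S[OF D elim(2)], of "\<lambda>x. x \<notin> hsection (E - core g E) y"]
        sets.sets_into_space[OF hsection_S[OF D elim(2)]] by (simp add: Collect_conj_eq Int_absorb1 Int_def[symmetric])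
  qed
  then have "E - core g E \<in> null_sets R" using null_sets_R_iff[OF D] by blast
  from AE_not_in[OF this] show ?thesis by eventually_elim blast
qed

text \<open>\<open>\<pi>0\<close> is an exact homomorphism killing null sets because
  \<open>\<tau> y\<close> is one for every y; agreement with its argument uses almost every y only.
  The cores of E and of its complement enclose \<open>\<pi>0 E\<close> up to null sets.\<close>

theorem lifting_with_fibres:
  obtains \<sigma> \<pi> where "\<And>y. y \<in> space Q \<Longrightarrow> \<sigma> y \<in> Liftings (completion (S y))"
    "\<pi> \<in> Liftings (completion R)"
    "\<And>y E. y \<in> space Q \<Longrightarrow> E \<in> sets (completion R) \<Longrightarrow> hsection (\<pi> E) y \<in> sets (completion (S y))"
    "\<And>y E. y \<in> space Q \<Longrightarrow> E \<in> sets (completion R) \<Longrightarrow> \<sigma> y (hsection (\<pi> E) y) = hsection (\<pi> E) y"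
proof -
  obtain \<sigma> \<tau> where fib: "\<And>y. y \<in> space Q \<Longrightarrow> fibre_lifting y (\<sigma> y) (\<tau> y)"
    using fibre_lifting_exists by metis
  have \<sigma>: "\<sigma> y \<in> Liftings (completion (S y))" if "y \<in> space Q" for y
    using fib[OF that] unfolding fibre_lifting_def by blast
  have \<tau>: "\<tau> y E \<in> sets (completion (S y))" "\<sigma> y (\<tau> y E) = \<tau> y E" "\<tau> y (space R - E) = space P - \<tau> y E"
    if "y \<in> space Q" "E \<in> sets R" for y E
    using fib[OF that(1)] that(2) unfolding fibre_lifting_def by blast+
  have \<tau>_Int: "\<tau> y (E \<inter> F) = \<tau> y E \<inter> \<tau> y F" if "y \<in> space Q" "E \<in> sets R" "F \<in> sets R" for y E F
    using fib[OF that(1)] that(2,3) unfolding fibre_lifting_def by blast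
  have \<tau>_null: "\<tau> y E = {}" if "y \<in> space Q" "E \<in> null_sets R" for y E
    using fib[OF that(1)] that(2) unfolding fibre_lifting_def by blast
  have \<tau>_space: "\<tau> y E \<subseteq> space P" if "y \<in> space Q" "E \<in> sets R" for y E
    using sets.sets_into_space[OF \<tau>(1)[OF that]] S_space[OF that(1)] by simp
  \<comment> \<open>For this fixed E, almost every y is regular with
    \<open>(E, hsection E y)\<close> in its germ, whence
    \<open>\<tau> y E = \<sigma> y (hsection E y)\<close>. The null set of other y may depend on
    E.\<close>
  have \<tau>_core: "AE y in Q. density_core (S y) g (hsection E y) \<subseteq> \<tau> y E" if E: "E \<in> sets R" for E
    using AE_germ[OF E] AE_regular AE_hsection_approx[OF E] AE_space
  proof eventually_elim
    case (elim y)
    have "\<tau> y E = \<sigma> y (hsection E y)"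
      using fib[OF elim(4)] elim(1,2) unfolding fibre_lifting_def by blast
    then show ?case using fib[OF elim(4)] elim(3) unfolding fibre_lifting_def by simp
  qed
  define \<pi>0 where "\<pi>0 E = {z \<in> space R. fst z \<in> \<tau> (snd z) E}" for E
  have sp: "snd z \<in> space Q" "fst z \<in> space P" if "z \<in> space R" for z using that unfolding space_R by auto
  have \<pi>0_compl: "\<pi>0 (space R - E) = space R - \<pi>0 E" if "E \<in> sets R" for E
    unfolding \<pi>0_def using \<tau>(3)[OF sp(1) that] sp(2) by auto
  have \<pi>0_Int: "\<pi>0 (E \<inter> F) = \<pi>0 E \<inter> \<pi>0 F" if "E \<in> sets R" "F \<in> sets R" for E F
    unfolding \<pi>0_def using \<tau>_Int[OF sp(1) that] by auto
  have \<pi>0_null: "\<pi>0 E = {}" if "E \<in> null_sets R" for E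
    unfolding \<pi>0_def using \<tau>_null[OF sp(1) that] by auto
  have AE_sub: "AE z in R. z \<in> E \<longrightarrow> z \<in> \<pi>0 E" if E: "E \<in> sets R" for E
    using AE_core[OF E] AE_snd[OF \<tau>_core[OF E]] AE_space
    by eventually_elim (auto simp: core_def \<pi>0_def)
  have AE_\<pi>0: "AE z in R. z \<in> E \<longleftrightarrow> z \<in> \<pi>0 E" if E: "E \<in> sets R" for E
  proof -
    have "space R - E \<in> sets R" using E by blast
    from AE_sub[OF E] AE_sub[OF this] AE_space show ?thesis
      unfolding \<pi>0_compl[OF E] by eventually_elim blast
  qed
  have \<pi>0_cong: "\<pi>0 E = \<pi>0 F" if E: "E \<in> sets R" and F: "F \<in> sets R" and eq: "AE z in R. z \<in> E \<longleftrightarrow> z \<in> F" for E F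
  proof -
    have sub: "\<pi>0 E \<subseteq> \<pi>0 F" if E: "E \<in> sets R" and F: "F \<in> sets R" and eq: "AE z in R. z \<in> E \<longleftrightarrow> z \<in> F" for E F
    proof -
      have "AE z in R. z \<notin> E - F" using eq by eventually_elim blast
      moreover have "E - F \<in> sets R" using E F by blast
      ultimately have "E - F \<in> null_sets R" by (simp add: AE_iff_null_sets)
      moreover have "E - F = E \<inter> (space R - F)" using sets.sets_into_space[OF E] by blast
      ultimately have "\<pi>0 E \<inter> (space R - \<pi>0 F) = {}"
        using \<pi>0_null \<pi>0_Int[OF E, of "space R - F"] \<pi>0_compl[OF F] F by auto
      then show ?thesis unfolding \<pi>0_def by blast
    qed
    have "AE z in R. z \<in> F \<longleftrightarrow> z \<in> E" using eq by eventually_elim blast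
    then show ?thesis using sub[OF E F eq] sub[OF F E] by blast
  qed
  \<comment> \<open>Any representative in \<open>sets R\<close> gives the same value, by
    \<open>\<pi>0_cong\<close>.\<close>
  define \<pi> where "\<pi> E = \<pi>0 (main_part R E)" for E
  have m: "main_part R E \<in> sets R" "AE z in R. z \<in> E \<longleftrightarrow> z \<in> main_part R E" if E: "E \<in> sets (completion R)" for E
  proof -
    show "main_part R E \<in> sets R" using main_part_sets[OF E] .
    have "AE z in R. z \<notin> null_part R E" by (rule AE_notin_null_part[OF E])
    then show "AE z in R. z \<in> E \<longleftrightarrow> z \<in> main_part R E"
      using main_part_null_part_Un[OF E] by (elim eventually_mono) blast
  qed
  have \<pi>_eqI: "\<pi> E = \<pi>0 F" if E: "E \<in> sets (completion R)" and F: "F \<in> sets R" and eq: "AE z in R. z \<in> E \<longleftrightarrow> z \<in> F" for E F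
  proof -
    have "AE z in R. z \<in> main_part R E \<longleftrightarrow> z \<in> F" using m(2)[OF E] eq by eventually_elim blast
    then show ?thesis unfolding \<pi>_def by (rule \<pi>0_cong[OF m(1)[OF E] F])
  qed
  have AE_\<pi>: "AE z in R. z \<in> \<pi> E \<longleftrightarrow> z \<in> E" if E: "E \<in> sets (completion R)" for E
    using AE_\<pi>0[OF m(1)[OF E]] m(2)[OF E] unfolding \<pi>_def by eventually_elim blast
  have "\<pi> \<in> Liftings (completion R)"
    unfolding Liftings_def lifting_def lower_density_def
  proof (intro CollectI conjI ballI impI)
    fix E assume E: "E \<in> sets (completion R)"
    note mE = m[OF E]
    show ae: "AE z in completion R. z \<in> \<pi> E \<longleftrightarrow> z \<in> E" by (rule AE_completion[OF AE_\<pi>[OF E]])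
    have "AE z in completion R. z \<in> E \<longleftrightarrow> z \<in> \<pi> E" using ae by eventually_elim blast
    then show "\<pi> E \<in> sets (completion R)"
      by (rule completion.in_sets_AE[OF _ E]) (auto simp: \<pi>_def \<pi>0_def)
    show "\<pi> (space (completion R) - E) = space (completion R) - \<pi> E"
    proof -
      have "AE z in R. z \<in> space R - E \<longleftrightarrow> z \<in> space R - main_part R E" using mE(2) by eventually_elim blast
      moreover have "space R - E \<in> sets (completion R)" using sets.compl_sets[OF E] by simp
      ultimately have "\<pi> (space R - E) = \<pi>0 (space R - main_part R E)" using mE(1) by (intro \<pi>_eqI) auto
      then show ?thesis using \<pi>0_compl[OF mE(1)] by (simp add: \<pi>_def)
    qed
    fix F assume F: "F \<in> sets (completion R)"
    note mF = m[OF F]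
    show "\<pi> (E \<inter> F) = \<pi> E \<inter> \<pi> F"
    proof -
      have "AE z in R. z \<in> E \<inter> F \<longleftrightarrow> z \<in> main_part R E \<inter> main_part R F" using mE(2) mF(2) by eventually_elim blast
      then have "\<pi> (E \<inter> F) = \<pi>0 (main_part R E \<inter> main_part R F)" using mE(1) mF(1) E F by (intro \<pi>_eqI) auto
      then show ?thesis using \<pi>0_Int[OF mE(1) mF(1)] by (simp add: \<pi>_def)
    qed
    assume "AE z in completion R. z \<in> E \<longleftrightarrow> z \<in> F"
    then have "AE z in R. z \<in> E \<longleftrightarrow> z \<in> F" unfolding AE_completion_iff .
    then have "AE z in R. z \<in> E \<longleftrightarrow> z \<in> main_part R F" using mF(2) by eventually_elim blast
    then show "\<pi> E = \<pi> F" unfolding \<pi>_def[of F] by (rule \<pi>_eqI[OF E mF(1)])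
  next
    show empty: "\<pi> {} = {}" unfolding \<pi>_def by (simp add: \<pi>0_null)
    show "\<pi> (space (completion R)) = space (completion R)"
      using \<pi>0_compl[of "{}"] \<pi>0_null[of "{}"] by (simp add: \<pi>_def)
  qed
  moreover have "hsection (\<pi> E) y = \<tau> y (main_part R E)" if y: "y \<in> space Q" and E: "E \<in> sets (completion R)" for y E
    unfolding \<pi>_def \<pi>0_def hsection_def space_R using \<tau>_space[OF y m(1)[OF E]] y by auto
  ultimately show ?thesis using that[of \<sigma> \<pi>] \<sigma> \<tau>(1,2) m(1) by simp
qed

end

text \<open>Every strict level set of the section is a union, over rationals, of sets
  \<open>hsection (\<pi> E) y\<close>. These are fixed by \<open>\<sigma>\<close>, so each belongs
  to the filter at all of its points, and the section converges along the filter at x to its own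
  value there.\<close>

lemma lifted_section_fixed:
  assumes \<pi>: "\<pi> \<in> Liftings M" and \<sigma>: "\<sigma> \<in> Liftings N" and f: "f \<in> Linf M"
    and sp: "\<And>x. x \<in> space N \<Longrightarrow> (x, y) \<in> space M"
    and sec: "\<And>E. E \<in> sets M \<Longrightarrow> hsection (\<pi> E) y \<in> sets N"
    and idem: "\<And>E. E \<in> sets M \<Longrightarrow> \<sigma> (hsection (\<pi> E) y) = hsection (\<pi> E) y"
  shows "(\<lambda>x. lifted M \<pi> f (x, y)) \<in> Linf N"
    "\<And>x. x \<in> space N \<Longrightarrow> lifted N \<sigma> (\<lambda>x. lifted M \<pi> f (x, y)) x = lifted M \<pi> f (x, y)"
proof -
  have [measurable]: "f \<in> borel_measurable M" using f unfolding Linf_def by blast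
  let ?h = "\<lambda>x. lifted M \<pi> f (x, y)"
  define up where "up q = hsection (\<pi> {z \<in> space M. q < f z}) y" for q
  define dn where "dn q = hsection (\<pi> {z \<in> space M. f z < q}) y" for q
  have sets: "up q \<in> sets N" "dn q \<in> sets N" for q unfolding up_def dn_def by (auto intro: sec)
  have fixed: "\<sigma> (up q) = up q" "\<sigma> (dn q) = dn q" for q unfolding up_def dn_def by (rule idem, simp)+
  have gt: "r < ?h x \<longleftrightarrow> (\<exists>q\<in>\<rat>. r < q \<and> x \<in> up q)" if "x \<in> space N" for r x
    unfolding up_def hsection_def using lifted_greater_iff[OF \<pi> f sp[OF that]] by simp
  have lt: "?h x < r \<longleftrightarrow> (\<exists>q\<in>\<rat>. q < r \<and> x \<in> dn q)" if "x \<in> space N" for r x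
    unfolding dn_def hsection_def using lifted_less_iff[OF \<pi> f sp[OF that]] by simp
  have "?h \<in> borel_measurable N"
  proof (rule borel_measurable_iff_greater[THEN iffD2], intro allI)
    fix r
    have "{x \<in> space N. r < ?h x} = (\<Union>q\<in>{q\<in>\<rat>. r < q}. up q)"
    proof (intro equalityI subsetI)
      fix x assume "x \<in> {x \<in> space N. r < ?h x}"
      then show "x \<in> (\<Union>q\<in>{q\<in>\<rat>. r < q}. up q)" using gt[of x r] by auto
    next
      fix x assume "x \<in> (\<Union>q\<in>{q\<in>\<rat>. r < q}. up q)"
      then obtain q where q: "q \<in> \<rat>" "r < q" "x \<in> up q" by blast
      then have "x \<in> space N" using sets.sets_into_space[OF sets(1)] by blast
      then show "x \<in> {x \<in> space N. r < ?h x}" using gt[of x r] q by blast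
    qed
    also have "\<dots> \<in> sets N"
      using countable_rat by (intro sets.countable_UN'' countable_Collect sets)
    finally show "{x \<in> space N. r < ?h x} \<in> sets N" .
  qed
  moreover have "bounded (?h ` space N)"
  proof (rule bounded_subset)
    show "bounded (lifted M \<pi> f ` space M)" using lifted_in_Linf[OF \<pi> f] unfolding Linf_def by blast
    show "?h ` space N \<subseteq> lifted M \<pi> f ` space M" using sp by blast
  qed
  ultimately show "?h \<in> Linf N" unfolding Linf_def by blast
  fix x assume x: "x \<in> space N"
  show "lifted N \<sigma> ?h x = ?h x"
  proof (rule lifted_eqI[OF \<sigma> x], rule order_tendstoI)
    fix r assume "r < ?h x"
    then obtain q where q: "q \<in> \<rat>" "r < q" "x \<in> up q" using gt[OF x] by blast
    have "\<forall>z\<in>up q. r < ?h z" using gt q(1,2) sets.sets_into_space[OF sets(1)] by blast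
    then show "\<forall>\<^sub>F z in lift_filter N \<sigma> x. r < ?h z"
      unfolding eventually_lift_filter[OF \<sigma> x] using sets(1) fixed(1) q(3) by blast
  next
    fix r assume "?h x < r"
    then obtain q where q: "q \<in> \<rat>" "q < r" "x \<in> dn q" using lt[OF x] by blast
    have "\<forall>z\<in>dn q. ?h z < r" using lt q(1,2) sets.sets_into_space[OF sets(2)] by blast
    then show "\<forall>\<^sub>F z in lift_filter N \<sigma> x. ?h z < r"
      unfolding eventually_lift_filter[OF \<sigma> x] using sets(2) fixed(2) q(3) by blast
  qed
qed

theorem theorem3p6:
  fixes P :: "'a measure" and Q :: "'b measure" and R :: "('a \<times> 'b) measure"
    and S :: "'b \<Rightarrow> 'a measure"
  assumes "prob_space P" and "prob_space Q"
    and "Liftings Q \<noteq> {}"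
    and "prob_space R" and "sets R = sets (P \<Otimes>\<^sub>M Q)"
    and "distr R P fst = P" and "distr R Q snd = Q"
    and "product_regular_conditional_probability P Q R S"
    and "has_dense_countably_generated_subalgebra P"
  shows "\<exists>\<sigma> \<pi> \<sigma>f \<pi>f.
      (\<forall>y\<in>space Q. \<sigma> y \<in> Liftings (completion (S y)) \<and>
         induced_function_lifting (completion (S y)) (\<sigma> y) (\<sigma>f y)) \<and>
      \<pi> \<in> Liftings (completion R) \<and>
      induced_function_lifting (completion R) \<pi> \<pi>f \<and>
      (\<forall>y\<in>space Q. \<forall>E\<in>sets (completion R).
         hsection (\<pi> E) y \<in> sets (completion (S y)) \<and>
         hsection (\<pi> E) y = \<sigma> y (hsection (\<pi> E) y)) \<and>
      (\<forall>f\<in>Linf (completion R). \<forall>y\<in>space Q.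
         (\<lambda>x. \<pi>f f (x, y)) \<in> Linf (completion (S y)) \<and>
         (\<forall>x\<in>space P. \<pi>f f (x, y) = \<sigma>f y (\<lambda>x. \<pi>f f (x, y)) x))"
proof -
  interpret disintegration P Q R S
    using assms by (intro disintegration.intro disintegration_axioms.intro)
  obtain \<rho> where \<rho>: "\<rho> \<in> Liftings Q" using assms(3) by blast
  obtain G where G: "countable G" "G \<subseteq> sets P"
    "\<And>A e. A \<in> sets P \<Longrightarrow> e > 0 \<Longrightarrow> \<exists>C\<in>sigma_sets (space P) G. measure P (sym_diff A C) < e"
    using assms(9) unfolding has_dense_countably_generated_subalgebra_def by blast
  obtain g :: "nat \<Rightarrow> 'a set" where g: "range g \<subseteq> sets P" "G \<subseteq> range g" "{} \<in> range g"
    "\<And>C. C \<in> range g \<Longrightarrow> space P - C \<in> range g"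
    "\<And>C D. C \<in> range g \<Longrightarrow> D \<in> range g \<Longrightarrow> C \<union> D \<in> range g"
    by (rule countable_algebra[OF G(1,2)]) blast
  interpret lifted_disintegration P Q R S \<rho> g
  proof
    show "g i \<in> sets P" for i using g(1) by blast
    show "\<exists>C\<in>sigma_sets (space P) (range g). measure P (sym_diff A C) < e" if "A \<in> sets P" "e > 0" for A e
      using G(3)[OF that] sigma_sets_mono'[OF g(2)] by blast
  qed (fact \<rho> g(3) | rule g(4,5); assumption)+
  obtain \<sigma> \<pi> where \<sigma>: "\<And>y. y \<in> space Q \<Longrightarrow> \<sigma> y \<in> Liftings (completion (S y))"
    and \<pi>: "\<pi> \<in> Liftings (completion R)"
    and sec: "\<And>y E. y \<in> space Q \<Longrightarrow> E \<in> sets (completion R) \<Longrightarrow> hsection (\<pi> E) y \<in> sets (completion (S y))"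
      "\<And>y E. y \<in> space Q \<Longrightarrow> E \<in> sets (completion R) \<Longrightarrow> \<sigma> y (hsection (\<pi> E) y) = hsection (\<pi> E) y"
    by (rule lifting_with_fibres) blast
  have fun_sec: "(\<lambda>x. lifted (completion R) \<pi> f (x, y)) \<in> Linf (completion (S y)) \<and>
      (\<forall>x\<in>space P. lifted (completion R) \<pi> f (x, y) =
        lifted (completion (S y)) (\<sigma> y) (\<lambda>x. lifted (completion R) \<pi> f (x, y)) x)"
    if f: "f \<in> Linf (completion R)" and y: "y \<in> space Q" for f y
  proof -
    have sp: "(x, y) \<in> space (completion R)" if "x \<in> space (completion (S y))" for x
      using that y unfolding space_completion space_R S_space[OF y] by simp
    show ?thesis
    proof (intro conjI ballI)
      fix x assume "x \<in> space P"
      then have x: "x \<in> space (completion (S y))" unfolding space_completion S_space[OF y] .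
      show "lifted (completion R) \<pi> f (x, y) =
          lifted (completion (S y)) (\<sigma> y) (\<lambda>x. lifted (completion R) \<pi> f (x, y)) x"
        by (rule lifted_section_fixed(2)[OF \<pi> \<sigma>[OF y] f _ _ _ x, symmetric]; (erule sp | erule sec[OF y]))
    qed (rule lifted_section_fixed(1)[OF \<pi> \<sigma>[OF y] f]; (erule sp | erule sec[OF y]))
  qed
  show ?thesis
    by (intro exI[of _ \<sigma>] exI[of _ \<pi>] exI[of _ "\<lambda>y. lifted (completion (S y)) (\<sigma> y)"]
        exI[of _ "lifted (completion R) \<pi>"] conjI ballI)
      (use \<sigma> \<pi> sec fun_sec induced_function_lifting_lifted[OF \<sigma>]
          induced_function_lifting_lifted[OF \<pi>] in simp_all)
qed

end
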